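(* Suppose $k:\mathbb{R}\to\mathbb{R}$ is odd, continuous, and differentiable almost everywhere with $|k'(x)|\le Ae^{\beta|x|}$ for some $A,\beta>0$ and all $x\in\mathbb{R}$. Let $X\in\mathbb{R}^{p\times n}$ have i.i.d. $\mathcal{N}(0,1)$ entries. Then, for any $\alpha>0$, there exist constants $C,C'>0$ depending only on $A$, $\beta$ and $\alpha$ such that $$\mathbb{P}\left[\|K(X)\|>C\max\left(\frac{p}{n},\sqrt{\frac{p}{n}}\right)\right]\le C'\left(p^{-\alpha}+pe^{-\alpha n}\right).$$
   Context: For $X\in\mathbb{R}^{p\times n}$ let $\hat\Sigma=n^{-1}XX^T$, and define the symmetric kernel matrix $K(X)\in\mathbb{R}^{p\times p}$ by $K(X)_{ii'}=\frac{1}{\sqrt n}k(\sqrt n\,\hat\Sigma_{ii'})$ for $i\ne i'$ and $K(X)_{ii}=0$. $\|K(X)\|$ is the spectral ($\ell_2$-operator) norm. The bound is non-asymptotic in $n$ and $p$.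
   Formalization: The kernel k is additionally assumed locally absolutely continuous (its increments are integrals of k'); without this, large multiples of an odd Cantor function, with k'=0 wherever k' exists, contradict constants depending only on A, β and α. *)

theory Defs
  imports "HOL-Probability.Probability"
begin

text \<open>
  Since the dimensions \<open>p\<close> and \<open>n\<close> vary while the constants of the theorem stay fixed, matrices are
  functions of two indices, of which only the rows \<open>i < p\<close> and columns \<open>j < n\<close> matter.
\<close>

definition sample_cov :: "nat \<Rightarrow> (nat \<Rightarrow> nat \<Rightarrow> real) \<Rightarrow> nat \<Rightarrow> nat \<Rightarrow> real" where
  "sample_cov n x i i' = (\<Sum>j<n. x i j * x i' j) / real n"

definition kernel_matrix ::
    "(real \<Rightarrow> real) \<Rightarrow> nat \<Rightarrow> (nat \<Rightarrow> nat \<Rightarrow> real) \<Rightarrow> nat \<Rightarrow> nat \<Rightarrow> real" where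
  "kernel_matrix k n x i i' =
     (if i = i' then 0 else (1 / sqrt (real n)) * k (sqrt (real n) * sample_cov n x i i'))"

definition spectral_norm :: "nat \<Rightarrow> (nat \<Rightarrow> nat \<Rightarrow> real) \<Rightarrow> real" where
  "spectral_norm p B =
     (SUP v\<in>{v. L2_set v {..<p} \<le> 1}. L2_set (\<lambda>i. \<Sum>i'<p. B i i' * v i') {..<p})"

definition iid_std_normal_matrix ::
    "'a measure \<Rightarrow> nat \<Rightarrow> nat \<Rightarrow> (nat \<Rightarrow> nat \<Rightarrow> 'a \<Rightarrow> real) \<Rightarrow> bool" where
  "iid_std_normal_matrix M p n X \<longleftrightarrow>
     prob_space.indep_vars M (\<lambda>_. borel) (\<lambda>(i, j). X i j) ({..<p} \<times> {..<n}) \<and>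
     (\<forall>i<p. \<forall>j<n. distributed M lborel (X i j) std_normal_density)"

text \<open>
  The integral clause says that \<open>k\<close> is locally absolutely continuous, which is how ``continuous and
  differentiable almost everywhere'' has to be understood: it makes the bound on the derivative
  control the increments of \<open>k\<close>. Without it, arbitrarily large multiples of an odd Cantor function
  would be admissible for every \<open>A\<close> and \<open>\<beta>\<close>. The value of \<^const>\<open>deriv\<close> is unspecified on the
  null set where \<open>k\<close> is not differentiable; this affects neither the bound nor the integral.
\<close>

definition admissible_kernel :: "real \<Rightarrow> real \<Rightarrow> (real \<Rightarrow> real) \<Rightarrow> bool" where
  "admissible_kernel A \<beta> k \<longleftrightarrow>
     (\<forall>x. k (- x) = - k x) \<and>
     continuous_on UNIV k \<and>
     (AE x in lborel. k differentiable (at x)) \<and>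
     (\<forall>x. k differentiable (at x) \<longrightarrow> \<bar>deriv k x\<bar> \<le> A * exp (\<beta> * \<bar>x\<bar>)) \<and>
     (\<forall>a b. a \<le> b \<longrightarrow> (deriv k has_integral (k b - k a)) {a..b})"

end

theory Submission
  imports Defs
begin

text \<open>
  Split \<open>k\<close> into bands \<open>k\<^sub>j\<close>, \<open>j < J\<close> with \<open>J\<close> of order \<open>sqrt (ln p)\<close>, where \<open>k\<^sub>j\<close> is odd, vanishes on
  \<open>[-j, j]\<close> and has Lipschitz constant \<open>L\<^sub>j = 2 A exp (\<beta> (j + 1))\<close>. On a good set of matrices the operator norm
  of \<open>X\<close> is \<open>O(sqrt p + sqrt n)\<close> and every row of \<open>K\<^sub>j\<close> has at most \<open>7 p \<rho>\<^sub>j^3\<close> nonzero entries, where \<open>\<rho>\<^sub>j\<close> is a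
  Gaussian in \<open>j\<close>, cut off at \<open>p powr (-1/6)\<close>. There \<open>u\<^sup>T K\<^sub>j v\<close> is a Lipschitz function of \<open>X\<close>, with a
  constant that gains a factor \<open>sqrt \<rho>\<^sub>j\<close> as soon as one of \<open>u\<close>, \<open>v\<close> has no entry above
  \<open>1 / (\<rho>\<^sub>j sqrt p)\<close>, while the pairs of sparse vectors with only larger entries have a net of size
  \<open>exp (O(\<rho>\<^sub>j p))\<close>. Gaussian concentration and a union bound over nets thus give a bound for the norm of \<open>K\<^sub>j\<close>
  proportional to \<open>L\<^sub>j sqrt \<rho>\<^sub>j\<close>, which is summable in \<open>j\<close>.

  The concentration inequality needs neither a convex domain nor differentiability: by the
  Prekopa-Leindler inequality, \<open>E \<phi> * E \<psi> \<le> 1\<close> whenever \<open>\<phi> x * \<psi> y \<le> exp (dist x y ^ 2 / 4)\<close>, and \<open>\<phi>\<close>, \<open>\<psi>\<close>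
  may be cut off to the good set. Since \<open>k\<close> is odd and the good set is invariant under sign changes of rows,
  \<open>u\<^sup>T K\<^sub>j v\<close> has mean zero on it.
\<close>

text \<open>The obstacle is the exponential growth of \<open>k\<close>. Band \<open>j\<close> has
  Lipschitz constant of order exp(\<beta> j), and a net of the full unit ball costs exp(O(p));
  paying both at every band would give a bound growing with p. Sparsity of the bands must supply the
  saving. The third power of \<rho> balances two costs. Given a row of squared length at most C n, a
  Gram entry exceeds j with probability at most 2 exp(-j^2 / (2 C)), which defines \<rho>^3 up to
  the cutoff and a constant. If one vector is light, its squared entries are at most 1 / (\<rho>^2
  p), so the active pairs, those with a large Gram entry, carry mass O(p \<rho>^3 / (\<rho>^2 p)) =
  O(\<rho>), and the full net is affordable. If both are heavy, the mass may be 1, but the net costs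
  only exp(O(\<rho> p)). Both regimes allow the same deviation, of order sqrt(\<rho> p) times the
  Lipschitz constant. The cutoff makes p \<rho>^3 at least sqrt p, so the exceptional events for
  counts and bands have probability O(exp(-sqrt p)) each, which beats every power of p. Its price in
  the sum over bands is exp(O(sqrt(ln p))) p^(-1/12), still bounded.\<close>

section \<open>Gaussian concentration on a set\<close>

lemma nn_integral_layer_cake:
  fixes f :: "real \<Rightarrow> real"
  assumes [measurable]: "f \<in> borel_measurable borel" and nn: "\<And>x. 0 \<le> f x"
  shows "(\<integral>\<^sup>+x. ennreal (f x) \<partial>lborel) = (\<integral>\<^sup>+s. emeasure lborel {x. s < f x} * indicator {0<..} s \<partial>lborel)"
proof -
  have "(\<integral>\<^sup>+x. ennreal (f x) \<partial>lborel) = (\<integral>\<^sup>+x. (\<integral>\<^sup>+s. indicator {0<..<f x} s \<partial>lborel) \<partial>lborel)"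
    using nn by simp
  also have "\<dots> = (\<integral>\<^sup>+x. (\<integral>\<^sup>+s. indicator {x. s < f x} x * indicator {0<..} s \<partial>lborel) \<partial>lborel)"
    by (intro nn_integral_cong) (auto split: split_indicator)
  also have "\<dots> = (\<integral>\<^sup>+s. (\<integral>\<^sup>+x. indicator {x. s < f x} x * indicator {0<..} s \<partial>lborel) \<partial>lborel)"
    by (intro lborel_pair.Fubini') simp
  also have "\<dots> = (\<integral>\<^sup>+s. emeasure lborel {x. s < f x} * indicator {0<..} s \<partial>lborel)"
    by (intro nn_integral_cong) (simp add: nn_integral_multc)
  finally show ?thesis .
qed

lemma std_normal_density_gt_iff:
  assumes "0 < c"
  shows "c < std_normal_density z \<longleftrightarrow> z\<^sup>2 < - 2 * ln (c * sqrt (2 * pi))"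
proof -
  have "c < std_normal_density z \<longleftrightarrow> c * sqrt (2 * pi) < exp (- z\<^sup>2 / 2)"
    by (simp add: std_normal_density_def field_simps)
  also have "\<dots> \<longleftrightarrow> ln (c * sqrt (2 * pi)) < - z\<^sup>2 / 2"
    using assms by (metis exp_less_cancel_iff exp_ln mult_pos_pos pi_gt_zero real_sqrt_gt_zero zero_less_numeral)
  finally show ?thesis by auto
qed

text \<open>The one-dimensional Brunn-Minkowski inequality when U + V lies in [-2l, 2l]: each set is
  contained in its hull from \<open>Inf\<close> to \<open>Sup\<close>, and both extremes add up
  under U + V.\<close>

lemma emeasure_sum_interval:
  fixes U V :: "real set"
  assumes U: "U \<in> sets borel" "U \<noteq> {}" and V: "V \<in> sets borel" "V \<noteq> {}"
    and sum: "\<And>x y. x \<in> U \<Longrightarrow> y \<in> V \<Longrightarrow> \<bar>x + y\<bar> \<le> 2 * l"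
  shows "emeasure lborel U + emeasure lborel V \<le> ennreal (4 * l)"
proof -
  obtain x0 y0 where x0: "x0 \<in> U" and y0: "y0 \<in> V" using U V by auto
  have bU: "bdd_above U" "bdd_below U"
    using sum[OF _ y0] by (auto intro!: bdd_aboveI[of _ "2*l - y0"] bdd_belowI[of _ "- 2*l - y0"] simp: abs_le_iff) 
      (smt (verit))+
  have bV: "bdd_above V" "bdd_below V"
    using sum[OF x0] by (auto intro!: bdd_aboveI[of _ "2*l - x0"] bdd_belowI[of _ "- 2*l - x0"] simp: abs_le_iff) 
      (smt (verit))+
  have *: "emeasure lborel S \<le> ennreal (Sup S - Inf S)" if "bdd_above S" "bdd_below S" "S \<noteq> {}" for S :: "real set"
  proof -
    have "emeasure lborel S \<le> emeasure lborel {Inf S..Sup S}"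
      by (intro emeasure_mono) (auto intro!: cInf_lower cSup_upper simp: that)
    then show ?thesis using that by (simp add: cInf_le_cSup)
  qed
  have s: "Sup U + Sup V \<le> 2 * l"
  proof -
    have "Sup U \<le> 2 * l - y" if "y \<in> V" for y
      using sum[OF _ that] U by (intro cSup_least) (auto simp: abs_le_iff, smt (verit))
    then have "Sup V \<le> 2 * l - Sup U" using V by (intro cSup_least) (auto, smt (verit))
    then show ?thesis by simp
  qed
  have i: "- 2 * l \<le> Inf U + Inf V"
  proof -
    have "- 2 * l - y \<le> Inf U" if "y \<in> V" for y
      using sum[OF _ that] U by (intro cInf_greatest) (auto simp: abs_le_iff, smt (verit))
    then have "- 2 * l - Inf U \<le> Inf V" using V by (intro cInf_greatest) (auto, smt (verit))
    then show ?thesis by simp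
  qed
  have "emeasure lborel U + emeasure lborel V \<le> ennreal (Sup U - Inf U) + ennreal (Sup V - Inf V)"
    using bU bV U V by (intro add_mono *) auto
  also have "\<dots> = ennreal ((Sup U - Inf U) + (Sup V - Inf V))"
    using bU bV U V by (intro ennreal_plus[symmetric]) (auto simp: cInf_le_cSup)
  also have "\<dots> \<le> ennreal (4 * l)" using s i by (intro ennreal_leI) auto
  finally show ?thesis .
qed

text \<open>Dividing by the suprema makes the superlevel sets of both functions nonempty at every
  level below 1, so Brunn-Minkowski applies level by level. Integration over the levels bounds a sum
  of integrals, and the arithmetic-geometric mean inequality turns it into a product.\<close>

lemma prekopa_leindler_gauss:
  fixes u v :: "real \<Rightarrow> real"
  assumes [measurable]: "u \<in> borel_measurable borel" "v \<in> borel_measurable borel"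
    and nn: "\<And>x. 0 \<le> u x" "\<And>x. 0 \<le> v x"
    and le: "\<And>x y. u x * v y \<le> (std_normal_density ((x + y) / 2))\<^sup>2"
    and bdd: "bdd_above (range u)" "bdd_above (range v)"
    and pos: "0 < u x0" "0 < v y0"
  shows "(\<integral>\<^sup>+x. ennreal (u x) \<partial>lborel) * (\<integral>\<^sup>+x. ennreal (v x) \<partial>lborel) \<le> 1"
proof -
  define a b where "a = Sup (range u)" and "b = Sup (range v)"
  have a: "u x \<le> a" for x unfolding a_def using bdd by (intro cSup_upper) auto
  have b: "v x \<le> b" for x unfolding b_def using bdd by (intro cSup_upper) auto
  have ab: "0 < a" "0 < b" using a[of x0] b[of y0] pos by auto
  \<comment> \<open>Scaled so that u x / a > s and v y / b > s force g > s at the midpoint of x and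
    y.\<close>
  define g where "g = (\<lambda>x. std_normal_density x / sqrt (a * b))"
  have lev: "emeasure lborel {x. s < u x / a} + emeasure lborel {x. s < v x / b} \<le> 2 * emeasure lborel {x. s < g x}"
    if s: "0 < s" for s
  proof (cases "s < 1")
    case True
    define U V where "U = {x. s < u x / a}" and "V = {x. s < v x / b}"
    have m: "U \<in> sets borel" "V \<in> sets borel" unfolding U_def V_def by measurable
    have "\<exists>x\<in>range u. s * a < x" using True ab s unfolding a_def
      by (intro less_cSupD) (auto simp flip: a_def)
    then have Une: "U \<noteq> {}" using ab by (auto simp: U_def field_simps)
    have "\<exists>x\<in>range v. s * b < x" using True ab s unfolding b_def
      by (intro less_cSupD) (auto simp flip: b_def)
    then have Vne: "V \<noteq> {}" using ab by (auto simp: V_def field_simps)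
    define c where "c = s * sqrt (a * b)"
    have c: "0 < c" using s ab by (simp add: c_def)
    define l where "l = sqrt (- 2 * ln (c * sqrt (2 * pi)))"
    have sq: "((x + y) / 2)\<^sup>2 < - 2 * ln (c * sqrt (2 * pi))" if "x \<in> U" "y \<in> V" for x y
    proof -
      have "s * a < u x" "s * b < v y" using that ab by (auto simp: U_def V_def field_simps)
      then have "(s * a) * (s * b) < u x * v y" using s ab by (intro mult_strict_mono) (auto intro: less_trans[OF mult_pos_pos])
      also have "\<dots> \<le> (std_normal_density ((x + y) / 2))\<^sup>2" by (rule le)
      finally have "c\<^sup>2 < (std_normal_density ((x + y) / 2))\<^sup>2"
        using ab by (simp add: c_def power_mult_distrib) (simp add: power2_eq_square ac_simps)
      then have "c < std_normal_density ((x + y) / 2)"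
        by (rule power2_less_imp_less) simp
      then show ?thesis using std_normal_density_gt_iff[OF c] by simp
    qed
    have "0 < - 2 * ln (c * sqrt (2 * pi))" using Une Vne sq zero_le_power2 by (metis all_not_in_conv less_le_trans not_less)
    have l2: "l\<^sup>2 = - 2 * ln (c * sqrt (2 * pi))" and lpos: "0 < l" using \<open>0 < - 2 * ln _\<close> by (auto simp: l_def)
    have "\<bar>x + y\<bar> \<le> 2 * l" if "x \<in> U" "y \<in> V" for x y
    proof -
      have "((x + y) / 2)\<^sup>2 < l\<^sup>2" using sq[OF that] l2 by simp
      then have "\<bar>(x + y) / 2\<bar> < l" using lpos by (metis abs_of_pos power2_less_imp_less power2_abs abs_ge_zero less_imp_le)
      then show ?thesis by simp
    qed
    then have "emeasure lborel U + emeasure lborel V \<le> ennreal (4 * l)"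
      using m Une Vne by (intro emeasure_sum_interval) auto
    \<comment> \<open>The Gaussian density is symmetric and unimodal, so the midpoints fill at most
      this interval of length 2 l.\<close>
    moreover have "{x. s < g x} = {-l<..<l}"
    proof -
      have "s < g x \<longleftrightarrow> x \<in> {-l<..<l}" for x
      proof -
        have "s < g x \<longleftrightarrow> c < std_normal_density x" using ab by (simp add: g_def c_def field_simps)
        also have "\<dots> \<longleftrightarrow> x\<^sup>2 < l\<^sup>2" using std_normal_density_gt_iff[OF c] l2 by simp
        also have "\<dots> \<longleftrightarrow> \<bar>x\<bar> < l" using lpos abs_le_square_iff[of l x] by (simp flip: not_le)
        finally show ?thesis by (simp add: abs_less_iff) linarith
      qed
      then show ?thesis by blast
    qed
    ultimately show ?thesis using lpos ennreal_mult'[of 2 "2 * l"] by (simp add: U_def V_def)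
  next
    case False
    have "u x / a \<le> 1" "v x / b \<le> 1" for x using a[of x] b[of x] ab by (simp_all add: divide_le_eq_1)
    then have "\<not> s < u x / a" "\<not> s < v x / b" for x using False by (meson less_le_trans not_less)+
    then show ?thesis by simp
  qed
  have [measurable]: "g \<in> borel_measurable borel" unfolding g_def by measurable
  have "(\<integral>\<^sup>+x. ennreal (u x / a) \<partial>lborel) + (\<integral>\<^sup>+x. ennreal (v x / b) \<partial>lborel)
     = (\<integral>\<^sup>+s. emeasure lborel {x. s < u x / a} * indicator {0<..} s + emeasure lborel {x. s < v x / b} * indicator {0<..} s \<partial>lborel)"
    using nn ab by (subst (1 2) nn_integral_layer_cake) (auto intro!: nn_integral_add[symmetric])
  also have "\<dots> \<le> (\<integral>\<^sup>+s. 2 * (emeasure lborel {x. s < g x} * indicator {0<..} s) \<partial>lborel)"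
    using lev by (intro nn_integral_mono) (auto split: split_indicator)
  also have "\<dots> = 2 * (\<integral>\<^sup>+x. ennreal (g x) \<partial>lborel)"
    using ab by (subst nn_integral_layer_cake) (auto simp: g_def intro!: nn_integral_cmult)
  also have "(\<integral>\<^sup>+x. ennreal (g x) \<partial>lborel) = ennreal (1 / sqrt (a * b)) * (\<integral>\<^sup>+x. ennreal (std_normal_density x) \<partial>lborel)"
    unfolding g_def using ab
    by (subst nn_integral_cmult[symmetric]) (auto simp: ennreal_mult'[symmetric])
  also have "(\<integral>\<^sup>+x. ennreal (std_normal_density x) \<partial>lborel) = 1"
    using prob_space.emeasure_space_1[OF prob_space_normal_density[of 1 0]]
    by (simp add: emeasure_density)
  finally have main: "(\<integral>\<^sup>+x. ennreal (u x / a) \<partial>lborel) + (\<integral>\<^sup>+x. ennreal (v x / b) \<partial>lborel) \<le> 2 * ennreal (1 / sqrt (a * b))"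
    by simp
  define P Q where "P = (\<integral>\<^sup>+x. ennreal (u x / a) \<partial>lborel)" and "Q = (\<integral>\<^sup>+x. ennreal (v x / b) \<partial>lborel)"
  have fin: "P < \<top>" "Q < \<top>" 
  proof -
    have "P + Q < \<top>" using main unfolding P_def Q_def by (rule le_less_trans) (simp add: ennreal_mult_less_top)
    then show "P < \<top>" "Q < \<top>" by auto
  qed
  then obtain P' Q' where PQ: "P = ennreal P'" "Q = ennreal Q'" "0 \<le> P'" "0 \<le> Q'" by (metis less_top ennreal_cases)
  have "ennreal (P' + Q') \<le> ennreal (2 * (1 / sqrt (a * b)))"
    using main PQ by (simp add: P_def[symmetric] Q_def[symmetric] ennreal_mult'[symmetric] flip: ennreal_numeral ennreal_plus)
  then have "P' + Q' \<le> 2 / sqrt (a * b)" using ab by (simp add: ennreal_le_iff)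
  then have "(P' + Q')\<^sup>2 \<le> (2 / sqrt (a * b))\<^sup>2" using PQ by (intro power_mono) auto
  \<comment> \<open>Uses 4 P' Q' \<le> (P' + Q')^2.\<close>
  then have "4 * (P' * Q') \<le> 4 / (a * b)"
    using ab sum_squares_ge_zero[of "P' - Q'" 0] by (simp add: power_divide power2_eq_square algebra_simps)
  then have "a * b * P' * Q' \<le> 1" using ab by (simp add: field_simps)
  have "(\<integral>\<^sup>+x. ennreal (u x) \<partial>lborel) = ennreal a * P" unfolding P_def
    using ab nn by (subst nn_integral_cmult[symmetric]) (auto simp: ennreal_mult'[symmetric])
  moreover have "(\<integral>\<^sup>+x. ennreal (v x) \<partial>lborel) = ennreal b * Q" unfolding Q_def
    using ab nn by (subst nn_integral_cmult[symmetric]) (auto simp: ennreal_mult'[symmetric])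
  moreover have "(ennreal a * P) * (ennreal b * Q) = ennreal (a * b * P' * Q')"
    using PQ ab by (simp add: ennreal_mult'[symmetric] ac_simps)
  ultimately show ?thesis using \<open>a * b * P' * Q' \<le> 1\<close> by simp
qed

section \<open>Product Gaussian measures and concentration on an arbitrary measurable set\<close>

definition gauss1 :: "real measure" where
  "gauss1 = density lborel (\<lambda>x. ennreal (std_normal_density x))"

definition gauss :: "'i set \<Rightarrow> ('i \<Rightarrow> real) measure" where
  "gauss I = PiM I (\<lambda>_. gauss1)"

lemma sets_gauss1 [simp, measurable_cong]: "sets gauss1 = sets borel"
  and space_gauss1 [simp]: "space gauss1 = UNIV"
  by (simp_all add: gauss1_def)

lemma prob_space_gauss1: "prob_space gauss1"
  unfolding gauss1_def by (rule prob_space_normal_density) simp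

interpretation gauss1: prob_space gauss1
  by (rule prob_space_gauss1)

interpretation gauss1_prod: product_prob_space "\<lambda>_. gauss1" UNIV
  by unfold_locales

interpretation gauss: prob_space "gauss I" for I
  unfolding gauss_def by (intro prob_space_PiM prob_space_gauss1)

lemma sets_gauss: "sets (gauss I) = sets (PiM I (\<lambda>_. borel))"
  unfolding gauss_def by (intro sets_PiM_cong) auto

lemma space_gauss: "space (gauss I) = PiE I (\<lambda>_. UNIV)"
  unfolding gauss_def by (simp add: space_PiM)

text \<open>By the parallelogram law the product of the densities at x and y, times exp((x - y)^2 /
  4), is the squared density at the midpoint; this is where the constant 4 comes from. After a
  vanishing factor is excluded, both functions are finite everywhere and become bounded once
  multiplied by the density.\<close>

lemma nn_integral_gauss1_mult_le:
  fixes \<phi> \<psi> :: "real \<Rightarrow> ennreal"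
  assumes [measurable]: "\<phi> \<in> borel_measurable borel" "\<psi> \<in> borel_measurable borel"
    and le: "\<And>x y. \<phi> x * \<psi> y \<le> ennreal (exp ((x - y)\<^sup>2 / 4))"
  shows "(\<integral>\<^sup>+x. \<phi> x \<partial>gauss1) * (\<integral>\<^sup>+x. \<psi> x \<partial>gauss1) \<le> 1"
proof (cases "(\<forall>x. \<phi> x = 0) \<or> (\<forall>x. \<psi> x = 0)")
  case True
  then show ?thesis by auto
next
  case False
  then obtain x0 y0 where x0: "\<phi> x0 \<noteq> 0" and y0: "\<psi> y0 \<noteq> 0" by auto
  have fin: "\<phi> x < \<top>" for x
  proof -
    have "\<phi> x * \<psi> y0 < \<top>" using le[of x y0] by (rule le_less_trans) simp
    then show ?thesis using y0 by (auto simp: ennreal_mult_less_top)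
  qed
  have fin': "\<psi> y < \<top>" for y
  proof -
    have "\<phi> x0 * \<psi> y < \<top>" using le[of x0 y] by (rule le_less_trans) simp
    then show ?thesis using x0 by (auto simp: ennreal_mult_less_top)
  qed
  define u where "u = (\<lambda>x. enn2real (\<phi> x) * std_normal_density x)"
  define v where "v = (\<lambda>x. enn2real (\<psi> x) * std_normal_density x)"
  have nn: "0 \<le> u x" "0 \<le> v x" for x by (simp_all add: u_def v_def)
  have uv: "u x * v y \<le> (std_normal_density ((x + y) / 2))\<^sup>2" for x y
  proof -
    have "ennreal (enn2real (\<phi> x) * enn2real (\<psi> y)) \<le> ennreal (exp ((x - y)\<^sup>2 / 4))"
      using le[of x y] fin fin' by (simp add: ennreal_mult')
    then have "enn2real (\<phi> x) * enn2real (\<psi> y) \<le> exp ((x - y)\<^sup>2 / 4)"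
      by (simp add: ennreal_le_iff)
    then have "u x * v y \<le> exp ((x - y)\<^sup>2 / 4) * (std_normal_density x * std_normal_density y)"
      unfolding u_def v_def
      by (subst mult.assoc, subst mult.left_commute[of "std_normal_density x"], subst mult.assoc[symmetric])
        (intro mult_right_mono, auto)
    also have "\<dots> = (std_normal_density ((x + y) / 2))\<^sup>2"
    proof -
      have "exp ((x - y)\<^sup>2 / 4) * (exp (- x\<^sup>2 / 2) * exp (- y\<^sup>2 / 2)) = (exp (- ((x + y) / 2)\<^sup>2 / 2))\<^sup>2"
        unfolding exp_add[symmetric] exp_of_nat_mult[symmetric]
        by (simp add: power2_eq_square field_simps flip: exp_of_nat_mult exp_add)
      then show ?thesis
        by (simp add: std_normal_density_def power_mult_distrib power_divide mult_ac)
    qed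
    finally show ?thesis .
  qed
  have pos: "0 < u x0" "0 < v y0"
    using x0 y0 fin[of x0] fin'[of y0]
    by (auto simp: u_def v_def enn2real_positive_iff zero_less_iff_neq_zero normal_density_pos)
  have g1: "(std_normal_density z)\<^sup>2 \<le> 1" for z
  proof -
    have "1 / sqrt (2 * pi) \<le> 1" using pi_gt3 by (simp add: real_le_rsqrt)
    then have "std_normal_density z \<le> 1 * 1" unfolding std_normal_density_def by (intro mult_mono) auto
    then show ?thesis by (simp add: power_le_one)
  qed
  have "u x \<le> 1 / v y0" "v x \<le> 1 / u x0" for x
    using order_trans[OF uv[of x y0] g1] order_trans[OF uv[of x0 x] g1] pos by (simp_all add: field_simps)
  then have bdd: "bdd_above (range u)" "bdd_above (range v)" by (auto intro!: bdd_aboveI)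
  have [measurable]: "u \<in> borel_measurable borel" "v \<in> borel_measurable borel"
    unfolding u_def v_def by measurable
  have "(\<integral>\<^sup>+x. \<phi> x \<partial>gauss1) = (\<integral>\<^sup>+x. ennreal (u x) \<partial>lborel)"
    unfolding gauss1_def u_def using fin
    by (subst nn_integral_density) (auto simp: ennreal_mult' mult.commute)
  moreover have "(\<integral>\<^sup>+x. \<psi> x \<partial>gauss1) = (\<integral>\<^sup>+x. ennreal (v x) \<partial>lborel)"
    unfolding gauss1_def v_def using fin'
    by (subst nn_integral_density) (auto simp: ennreal_mult' mult.commute)
  ultimately show ?thesis
    using prekopa_leindler_gauss[OF _ _ nn uv bdd pos] by simp
qed

text \<open>Tensorisation: for fixed values s, t of the new coordinate the induction hypothesis
  bounds the product of the two inner integrals by exp((s - t)^2 / 4), which is exactly the premise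
  of the one-dimensional inequality.\<close>

lemma nn_integral_gauss_mult_le:
  fixes \<phi> \<psi> :: "('i \<Rightarrow> real) \<Rightarrow> ennreal"
  assumes "finite I"
    and "\<phi> \<in> borel_measurable (gauss I)" "\<psi> \<in> borel_measurable (gauss I)"
    and "\<And>x y. x \<in> space (gauss I) \<Longrightarrow> y \<in> space (gauss I) \<Longrightarrow> \<phi> x * \<psi> y \<le> ennreal (exp ((\<Sum>i\<in>I. (x i - y i)\<^sup>2) / 4))"
  shows "(\<integral>\<^sup>+x. \<phi> x \<partial>gauss I) * (\<integral>\<^sup>+x. \<psi> x \<partial>gauss I) \<le> 1"
  using assms
proof (induction I arbitrary: \<phi> \<psi> rule: finite_induct)
  case empty
  have "\<phi> (\<lambda>_. undefined) * \<psi> (\<lambda>_. undefined) \<le> 1"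
    using empty(3)[of "\<lambda>_. undefined" "\<lambda>_. undefined"] by (simp add: space_gauss)
  then show ?case
    by (simp add: gauss_def PiM_empty nn_integral_count_space_finite)
next
  case (insert i I)
  note [measurable] = insert.prems(1,2)[unfolded gauss_def]
  have upd: "x(i := s) \<in> space (gauss (insert i I))" if "x \<in> space (gauss I)" for x s
    using that by (auto simp: space_gauss PiE_def extensional_def)
  have m: "(\<lambda>x. x(i := s)) \<in> PiM I (\<lambda>_. gauss1) \<rightarrow>\<^sub>M PiM (insert i I) (\<lambda>_. gauss1)" for s
    using insert.hyps by (intro measurable_fun_upd[where J=I]) (simp_all add: insert_Diff_if)
  have m2: "(\<lambda>(s, x). x(i := s)) \<in> gauss1 \<Otimes>\<^sub>M PiM I (\<lambda>_. gauss1) \<rightarrow>\<^sub>M PiM (insert i I) (\<lambda>_. gauss1)"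
    unfolding case_prod_beta' by (intro measurable_fun_upd[where J=I]) simp_all
  have m\<Phi>: "(\<lambda>s. \<integral>\<^sup>+x. \<phi> (x(i := s)) \<partial>gauss I) \<in> borel_measurable borel"
    if that: "\<phi> \<in> borel_measurable (PiM (insert i I) (\<lambda>_. gauss1))" for \<phi> :: "('i \<Rightarrow> real) \<Rightarrow> ennreal"
  proof -
    have "(\<lambda>(s, x). \<phi> (x(i := s))) \<in> borel_measurable (gauss1 \<Otimes>\<^sub>M PiM I (\<lambda>_. gauss1))"
      using measurable_compose[OF m2 that] by (simp add: case_prod_beta')
    then have "(\<lambda>s. \<integral>\<^sup>+x. \<phi> (x(i := s)) \<partial>PiM I (\<lambda>_. gauss1)) \<in> borel_measurable gauss1"
      using gauss.borel_measurable_nn_integral[of "\<lambda>s x. \<phi> (x(i := s))" gauss1 I] by (simp add: gauss_def)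
    then show ?thesis by (simp add: gauss_def cong: measurable_cong_sets)
  qed
  have key: "(\<integral>\<^sup>+x. \<phi> (x(i := s)) \<partial>gauss I) * (\<integral>\<^sup>+x. \<psi> (x(i := t)) \<partial>gauss I) \<le> ennreal (exp ((s - t)\<^sup>2 / 4))" for s t
  proof -
    \<comment> \<open>The share of the new coordinate in the exponent is moved onto \<phi>, leaving
      the premise for the old coordinates only.\<close>
    let ?e = "ennreal (exp (- ((s - t)\<^sup>2 / 4)))"
    have [measurable]: "(\<lambda>x. \<phi> (x(i := s))) \<in> borel_measurable (gauss I)" "(\<lambda>x. \<psi> (x(i := t))) \<in> borel_measurable (gauss I)"
      unfolding gauss_def using m by (auto intro: measurable_compose[OF m])
    have "(\<integral>\<^sup>+x. ?e * \<phi> (x(i := s)) \<partial>gauss I) * (\<integral>\<^sup>+x. \<psi> (x(i := t)) \<partial>gauss I) \<le> 1"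
    proof (rule insert.IH)
      fix x y assume xy: "x \<in> space (gauss I)" "y \<in> space (gauss I)"
      have "\<phi> (x(i := s)) * \<psi> (y(i := t)) \<le> ennreal (exp ((\<Sum>k\<in>insert i I. ((x(i := s)) k - (y(i := t)) k)\<^sup>2) / 4))"
        using xy by (intro insert.prems upd)
      also have "(\<Sum>k\<in>insert i I. ((x(i := s)) k - (y(i := t)) k)\<^sup>2) = (s - t)\<^sup>2 + (\<Sum>k\<in>I. (x k - y k)\<^sup>2)"
        using insert.hyps by (subst sum.insert) (auto intro!: sum.cong)
      finally have "\<phi> (x(i := s)) * \<psi> (y(i := t)) \<le> ennreal (exp (((s - t)\<^sup>2 + (\<Sum>k\<in>I. (x k - y k)\<^sup>2)) / 4))" .
      then have "?e * (\<phi> (x(i := s)) * \<psi> (y(i := t))) \<le> ?e * ennreal (exp (((s - t)\<^sup>2 + (\<Sum>k\<in>I. (x k - y k)\<^sup>2)) / 4))"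
        by (rule mult_left_mono) simp
      also have "\<dots> = ennreal (exp ((\<Sum>k\<in>I. (x k - y k)\<^sup>2) / 4))"
        by (simp add: ennreal_mult'[symmetric] exp_add[symmetric] add_divide_distrib)
      finally show "?e * \<phi> (x(i := s)) * \<psi> (y(i := t)) \<le> ennreal (exp ((\<Sum>k\<in>I. (x k - y k)\<^sup>2) / 4))"
        by (simp add: mult.assoc)
    qed measurable
    then have "?e * ((\<integral>\<^sup>+x. \<phi> (x(i := s)) \<partial>gauss I) * (\<integral>\<^sup>+x. \<psi> (x(i := t)) \<partial>gauss I)) \<le> 1"
      by (subst (asm) nn_integral_cmult) (measurable, simp add: mult.assoc)
    then have "ennreal (exp ((s - t)\<^sup>2 / 4)) * (?e * ((\<integral>\<^sup>+x. \<phi> (x(i := s)) \<partial>gauss I) * (\<integral>\<^sup>+x. \<psi> (x(i := t)) \<partial>gauss I))) \<le> ennreal (exp ((s - t)\<^sup>2 / 4)) * 1"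
      by (intro mult_left_mono) auto
    then show ?thesis
      by (simp add: mult.assoc[symmetric] ennreal_mult'[symmetric] exp_add[symmetric])
  qed
  have "(\<integral>\<^sup>+s. (\<integral>\<^sup>+x. \<phi> (x(i := s)) \<partial>gauss I) \<partial>gauss1) * (\<integral>\<^sup>+s. (\<integral>\<^sup>+x. \<psi> (x(i := s)) \<partial>gauss I) \<partial>gauss1) \<le> 1"
    using insert.prems(1,2) by (intro nn_integral_gauss1_mult_le key m\<Phi>) (simp_all add: gauss_def)
  then show ?case
    using insert by (simp add: gauss_def gauss1_prod.product_nn_integral_insert_rev)
qed

text \<open>Apply the product inequality to exp(F - \<Lambda>^2) and exp(-F), both cut off to G. Its
  premise is \<Lambda> d - \<Lambda>^2 \<le> d^2 / 4, a completed square, and is asked only for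
  pairs of points of G.\<close>

lemma gauss_exp_moment:
  fixes F :: "('i \<Rightarrow> real) \<Rightarrow> real"
  assumes "finite I" and G: "G \<in> sets (gauss I)" and F [measurable]: "F \<in> borel_measurable (gauss I)"
    and lip: "\<And>x y. x \<in> G \<Longrightarrow> y \<in> G \<Longrightarrow> F x - F y \<le> \<Lambda> * sqrt (\<Sum>i\<in>I. (x i - y i)\<^sup>2)"
    and int: "integrable (gauss I) (\<lambda>x. indicator G x * F x)"
    and zero: "(\<integral>x. indicator G x * F x \<partial>gauss I) = 0"
  shows "(\<integral>\<^sup>+x. indicator G x * ennreal (exp (F x)) \<partial>gauss I) * emeasure (gauss I) G \<le> ennreal (exp (\<Lambda>\<^sup>2))"
proof -
  note [measurable] = G
  \<comment> \<open>Jensen's inequality is replaced by \<open>exp (- F) \<ge> 1 - F\<close>, whose integral over \<open>G\<close> is the measure of \<open>G\<close>.\<close>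
  define \<psi> where "\<psi> = (\<lambda>x. indicator G x * exp (- F x))"
  have psi[measurable]: "\<psi> \<in> borel_measurable (gauss I)" by (simp add: \<psi>_def)
  have nn: "0 \<le> \<psi> x" for x by (simp add: \<psi>_def)
  have low: "emeasure (gauss I) G \<le> (\<integral>\<^sup>+x. ennreal (\<psi> x) \<partial>gauss I)"
  proof (cases "(\<integral>\<^sup>+x. ennreal (\<psi> x) \<partial>gauss I) = \<top>")
    case False
    then have i: "integrable (gauss I) \<psi>" using nn by (intro integrableI_nonneg) (auto simp: less_top)
    have iG: "integrable (gauss I) (\<lambda>x. indicator G x :: real)" using G by (simp add: less_top[symmetric])
    have "measure (gauss I) G = (\<integral>x. indicator G x - indicator G x * F x \<partial>gauss I)"
      using int zero iG G by (subst Bochner_Integration.integral_diff) (auto simp: gauss.emeasure_eq_measure)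
    also have "\<dots> \<le> (\<integral>x. \<psi> x \<partial>gauss I)"
      using int i iG
    proof (intro integral_mono)
      fix x show "indicator G x - indicator G x * F x \<le> \<psi> x"
        using exp_ge_add_one_self[of "- F x"] by (simp add: \<psi>_def split: split_indicator)
    qed auto
    finally have "ennreal (measure (gauss I) G) \<le> ennreal (\<integral>x. \<psi> x \<partial>gauss I)" by (rule ennreal_leI)
    then show ?thesis using i nn by (simp add: gauss.emeasure_eq_measure nn_integral_eq_integral)
  qed simp
  have "(\<integral>\<^sup>+x. indicator G x * ennreal (exp (F x - \<Lambda>\<^sup>2)) \<partial>gauss I) * (\<integral>\<^sup>+x. ennreal (\<psi> x) \<partial>gauss I) \<le> 1"
  proof (rule nn_integral_gauss_mult_le)
    fix x y
    define d where "d = sqrt (\<Sum>i\<in>I. (x i - y i)\<^sup>2)"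
    have d2: "d\<^sup>2 = (\<Sum>i\<in>I. (x i - y i)\<^sup>2)" by (simp add: d_def sum_nonneg)
    show "indicator G x * ennreal (exp (F x - \<Lambda>\<^sup>2)) * ennreal (\<psi> y) \<le> ennreal (exp ((\<Sum>i\<in>I. (x i - y i)\<^sup>2) / 4))"
    proof (cases "x \<in> G \<and> y \<in> G")
      case True
      have "F x - F y - \<Lambda>\<^sup>2 \<le> \<Lambda> * d - \<Lambda>\<^sup>2" using lip[of x y] True by (simp add: d_def)
      also have "\<dots> \<le> d\<^sup>2 / 4" using zero_le_power2[of "\<Lambda> - d / 2"] by (simp add: power2_eq_square algebra_simps)
      finally show ?thesis using True d2
        by (simp add: \<psi>_def ennreal_mult'[symmetric] exp_add[symmetric] algebra_simps)
    qed (auto simp: \<psi>_def)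
  qed (use assms in auto)
  then have "(\<integral>\<^sup>+x. ennreal (exp (- \<Lambda>\<^sup>2)) * (indicator G x * ennreal (exp (F x))) \<partial>gauss I) * emeasure (gauss I) G \<le> 1"
    by (intro order_trans[OF mult_left_mono[OF low]])
      (auto simp: exp_diff exp_minus field_simps ennreal_mult'[symmetric] intro!: order_trans[OF eq_refl] mult_right_mono nn_integral_cong split: split_indicator)
  then have "ennreal (exp (- \<Lambda>\<^sup>2)) * ((\<integral>\<^sup>+x. indicator G x * ennreal (exp (F x)) \<partial>gauss I) * emeasure (gauss I) G) \<le> 1"
    by (subst (asm) nn_integral_cmult) (auto simp: mult.assoc)
  then have "ennreal (exp (\<Lambda>\<^sup>2)) * (ennreal (exp (- \<Lambda>\<^sup>2)) * ((\<integral>\<^sup>+x. indicator G x * ennreal (exp (F x)) \<partial>gauss I) * emeasure (gauss I) G)) \<le> ennreal (exp (\<Lambda>\<^sup>2)) * 1"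
    by (rule mult_left_mono) simp
  then show ?thesis by (simp add: mult.assoc[symmetric] ennreal_mult'[symmetric] exp_add[symmetric])
qed

text \<open>Chernoff's method; \<open>c\<close> minimises (c \<Lambda>)^2 - c t. The factor
  \<open>measure (gauss I) G\<close> stays because the integral of exp(-F) over G is bounded below
  only by the mass of G.\<close>

lemma gauss_concentration:
  fixes F :: "('i \<Rightarrow> real) \<Rightarrow> real"
  assumes "finite I" and G: "G \<in> sets (gauss I)" and F [measurable]: "F \<in> borel_measurable (gauss I)"
    and lip: "\<And>x y. x \<in> G \<Longrightarrow> y \<in> G \<Longrightarrow> F x - F y \<le> \<Lambda> * sqrt (\<Sum>i\<in>I. (x i - y i)\<^sup>2)"
    and int: "integrable (gauss I) (\<lambda>x. indicator G x * F x)"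
    and zero: "(\<integral>x. indicator G x * F x \<partial>gauss I) = 0"
    and pos: "0 < \<Lambda>" "0 \<le> t"
  shows "measure (gauss I) {x \<in> G. t \<le> F x} * measure (gauss I) G \<le> exp (- (t\<^sup>2 / (4 * \<Lambda>\<^sup>2)))"
proof -
  note [measurable] = G
  define c where "c = t / (2 * \<Lambda>\<^sup>2)"
  have c: "0 \<le> c" using pos by (simp add: c_def)
  have sub: "{x \<in> G. t \<le> F x} = {x \<in> space (gauss I). x \<in> G \<and> t \<le> F x}"
    using sets.sets_into_space[OF G] by auto
  have ms: "{x \<in> G. t \<le> F x} \<in> sets (gauss I)" unfolding sub by measurable
  have *: "(\<integral>\<^sup>+x. indicator G x * ennreal (exp (c * F x)) \<partial>gauss I) * emeasure (gauss I) G \<le> ennreal (exp ((c * \<Lambda>)\<^sup>2))"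
  proof (rule gauss_exp_moment)
    show "c * F x - c * F y \<le> c * \<Lambda> * sqrt (\<Sum>i\<in>I. (x i - y i)\<^sup>2)" if "x \<in> G" "y \<in> G" for x y
      using mult_left_mono[OF lip[OF that] c] by (simp add: algebra_simps)
    show "integrable (gauss I) (\<lambda>x. indicator G x * (c * F x))"
      using integrable_mult_right[OF int, of c] by (simp add: mult.left_commute)
    show "(\<integral>x. indicator G x * (c * F x) \<partial>gauss I) = 0"
      using zero by (simp add: mult.left_commute)
  qed (use assms in auto)
  have "ennreal (exp (c * t)) * emeasure (gauss I) {x \<in> G. t \<le> F x} = (\<integral>\<^sup>+x. ennreal (exp (c * t)) * indicator {x \<in> G. t \<le> F x} x \<partial>gauss I)"
    using ms by (simp add: nn_integral_cmult)
  also have "\<dots> \<le> (\<integral>\<^sup>+x. indicator G x * ennreal (exp (c * F x)) \<partial>gauss I)"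
    using c by (intro nn_integral_mono) (auto split: split_indicator intro!: ennreal_leI mult_left_mono)
  finally have "ennreal (exp (c * t)) * emeasure (gauss I) {x \<in> G. t \<le> F x} * emeasure (gauss I) G \<le> ennreal (exp ((c * \<Lambda>)\<^sup>2))"
    using * by (meson mult_right_mono order_trans zero_le)
  then have "exp (c * t) * (measure (gauss I) {x \<in> G. t \<le> F x} * measure (gauss I) G) \<le> exp ((c * \<Lambda>)\<^sup>2)"
    by (simp add: gauss.emeasure_eq_measure ennreal_mult'[symmetric] mult.assoc)
  then have "measure (gauss I) {x \<in> G. t \<le> F x} * measure (gauss I) G \<le> exp ((c * \<Lambda>)\<^sup>2) / exp (c * t)"
    by (simp add: field_simps)
  also have "\<dots> = exp ((c * \<Lambda>)\<^sup>2 - c * t)" by (simp add: exp_diff)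
  also have "(c * \<Lambda>)\<^sup>2 - c * t = - (t\<^sup>2 / (4 * \<Lambda>\<^sup>2))"
    using pos by (simp add: c_def power2_eq_square field_simps)
  finally show ?thesis .
qed

section \<open>Lattice nets\<close>

text \<open>The lattice of mesh 1 / (4 sqrt d) in the unit ball, scaled to integers: radius 4 sqrt
  d. The box makes finiteness immediate, and \<open>PiE\<close> gives each vector one
  representative.\<close>

definition net :: "nat \<Rightarrow> (nat \<Rightarrow> int) set" where
  "net d = {z \<in> PiE {..<d} (\<lambda>_. {- 16 * int d..16 * int d}). (\<Sum>i<d. (z i)\<^sup>2) \<le> 16 * int d}"

text \<open>
  Rounding towards zero keeps an approximating lattice vector inside the unit ball and does not enlarge
  any entry.
\<close>

definition net_vec :: "nat \<Rightarrow> (nat \<Rightarrow> int) \<Rightarrow> nat \<Rightarrow> real" where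
  "net_vec d z i = real_of_int (z i) / (4 * sqrt (real d))"

definition bilinear_form :: "nat \<Rightarrow> nat \<Rightarrow> (nat \<Rightarrow> nat \<Rightarrow> real) \<Rightarrow> (nat \<Rightarrow> real) \<Rightarrow> (nat \<Rightarrow> real) \<Rightarrow> real" where
  "bilinear_form p n B u v = (\<Sum>i<p. \<Sum>j<n. u i * B i j * v j)"

lemma finite_net [simp]: "finite (net d)"
  unfolding net_def by (rule finite_subset[of _ "PiE {..<d} (\<lambda>_. {- 16 * int d..16 * int d})"]) (auto intro: finite_PiE)

lemma sum_net_vec_le: "z \<in> net d \<Longrightarrow> (\<Sum>i<d. (net_vec d z i)\<^sup>2) \<le> 1"
proof -
  assume z: "z \<in> net d"
  have "(\<Sum>i<d. (net_vec d z i)\<^sup>2) = real_of_int (\<Sum>i<d. (z i)\<^sup>2) / (16 * real d)"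
    by (simp add: net_vec_def power_divide power_mult_distrib sum_divide_distrib)
  also have "\<dots> \<le> 1"
  proof -
    have "real_of_int (\<Sum>i<d. (z i)\<^sup>2) \<le> real_of_int (16 * int d)"
      using z unfolding of_int_le_iff by (simp add: net_def)
    then show ?thesis by (cases "d = 0") (auto simp: divide_le_eq_1)
  qed
  finally show ?thesis .
qed

text \<open>Each coordinate errs by at most 1 / (4 sqrt d), so the total error has norm at most 1/4
  whatever the dimension.\<close>

lemma ex_net_approx:
  assumes "(\<Sum>i<d. (u i)\<^sup>2) \<le> (1::real)"
  shows "\<exists>z\<in>net d. (\<Sum>i<d. (u i - net_vec d z i)\<^sup>2) \<le> 1 / 16"
proof (cases "d = 0")
  case True
  then show ?thesis by (auto simp: net_def)
next
  case False
  define r where "r = (\<lambda>x::real. if 0 \<le> x then \<lfloor>x\<rfloor> else \<lceil>x\<rceil>)"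
  have r1: "\<bar>real_of_int (r x)\<bar> \<le> \<bar>x\<bar>" for x
  proof (cases "0 \<le> x")
    case True
    then have "0 \<le> real_of_int \<lfloor>x\<rfloor>" by simp
    then show ?thesis using True by (simp add: r_def)
  next
    case False
    then have "real_of_int \<lceil>x\<rceil> \<le> 0" by simp
    then show ?thesis using False le_of_int_ceiling[of x] by (simp add: r_def)
  qed
  have r2: "\<bar>x - real_of_int (r x)\<bar> \<le> 1" for x unfolding r_def by auto linarith+
  define z where "z = (\<lambda>i\<in>{..<d}. r (4 * sqrt d * u i))"
  have "(\<Sum>i<d. (real_of_int (z i))\<^sup>2) \<le> (\<Sum>i<d. (4 * sqrt d * u i)\<^sup>2)"
    using r1 by (intro sum_mono) (auto simp: z_def abs_le_square_iff)
  also have "\<dots> = 16 * d * (\<Sum>i<d. (u i)\<^sup>2)"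
    by (simp add: power_mult_distrib sum_distrib_left)
  also have "\<dots> \<le> 16 * d" using assms by (simp add: mult_left_le)
  finally have "real_of_int (\<Sum>i<d. (z i)\<^sup>2) \<le> real_of_int (16 * int d)" by simp
  then have le: "(\<Sum>i<d. (z i)\<^sup>2) \<le> 16 * int d" by linarith
  have "z i \<in> {- 16 * int d..16 * int d}" if "i < d" for i
  proof -
    have "(z i)\<^sup>2 \<le> (\<Sum>i<d. (z i)\<^sup>2)" using that by (intro member_le_sum) auto
    moreover have "\<bar>z i\<bar> \<le> (z i)\<^sup>2" using self_le_power[of "\<bar>z i\<bar>" 2] by (cases "z i = 0") auto
    ultimately show ?thesis using le by auto
  qed
  then have "z \<in> net d" using le by (auto simp: net_def z_def)
  moreover have "(\<Sum>i<d. (u i - net_vec d z i)\<^sup>2) \<le> (\<Sum>i<d. (1 / (4 * sqrt d))\<^sup>2)"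
  proof (rule sum_mono)
    fix i assume i: "i \<in> {..<d}"
    have "u i - net_vec d z i = (4 * sqrt d * u i - r (4 * sqrt d * u i)) / (4 * sqrt d)"
      using i False by (simp add: net_vec_def z_def field_simps)
    then have "\<bar>u i - net_vec d z i\<bar> \<le> \<bar>1 / (4 * sqrt d)\<bar>"
      using r2[of "4 * sqrt d * u i"] False by (simp add: abs_divide divide_right_mono)
    then show "(u i - net_vec d z i)\<^sup>2 \<le> (1 / (4 * sqrt d))\<^sup>2" by (simp only: abs_le_square_iff)
  qed
  then have "(\<Sum>i<d. (u i - net_vec d z i)\<^sup>2) \<le> 1 / 16" using False by (simp add: power_divide power_mult_distrib)
  ultimately show ?thesis by auto
qed

lemma bilinear_form_simps:
  "bilinear_form p n B (\<lambda>i. u i + u' i) v = bilinear_form p n B u v + bilinear_form p n B u' v"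
  "bilinear_form p n B u (\<lambda>i. v i + v' i) = bilinear_form p n B u v + bilinear_form p n B u v'"
  "bilinear_form p n B (\<lambda>i. c * u i) v = c * bilinear_form p n B u v"
  "bilinear_form p n B u (\<lambda>i. c * v i) = c * bilinear_form p n B u v"
  by (simp_all add: bilinear_form_def sum.distrib algebra_simps sum_distrib_left)

text \<open>Replacing u and then v by net vectors leaves two remainders of norm at most 1/4, so the
  supremum s satisfies s \<le> t + s/4 + s/4.\<close>

lemma bilinear_form_net_le:
  assumes net: "\<And>z w. z \<in> net p \<Longrightarrow> w \<in> net n \<Longrightarrow> bilinear_form p n B (net_vec p z) (net_vec n w) \<le> t"
    and u: "(\<Sum>i<p. (u i)\<^sup>2) \<le> 1" and v: "(\<Sum>i<n. (v i)\<^sup>2) \<le> 1"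
  shows "bilinear_form p n B u v \<le> 2 * t"
proof -
  define S where "S = {bilinear_form p n B u v |u v. (\<Sum>i<p. (u i)\<^sup>2) \<le> 1 \<and> (\<Sum>i<n. (v i)\<^sup>2) \<le> 1}"
  have le1: "\<bar>x i\<bar> \<le> 1" if "(\<Sum>i<d. (x i)\<^sup>2) \<le> 1" "i < d" for x :: "nat \<Rightarrow> real" and d i
  proof -
    have "(x i)\<^sup>2 \<le> (\<Sum>i<d. (x i)\<^sup>2)" using that by (intro member_le_sum) auto
    then show ?thesis using that by (simp add: abs_le_square_iff[of _ 1, simplified])
  qed
  \<comment> \<open>Finiteness of the supremum is what allows it to be absorbed on the left-hand
    side.\<close>
  have "bdd_above S"
  proof (rule bdd_aboveI[of _ "\<Sum>i<p. \<Sum>j<n. \<bar>B i j\<bar>"], clarsimp simp: S_def)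
    fix u v assume uv: "(\<Sum>i<p. (u i)\<^sup>2) \<le> (1::real)" "(\<Sum>i<n. (v i)\<^sup>2) \<le> (1::real)"
    show "bilinear_form p n B u v \<le> (\<Sum>i<p. \<Sum>j<n. \<bar>B i j\<bar>)"
      unfolding bilinear_form_def
    proof (intro sum_mono)
      fix i j assume ij: "i \<in> {..<p}" "j \<in> {..<n}"
      have "u i * B i j * v j \<le> \<bar>u i\<bar> * \<bar>B i j\<bar> * \<bar>v j\<bar>" by (metis abs_ge_self abs_mult)
      also have "\<dots> \<le> 1 * \<bar>B i j\<bar> * 1" using le1[OF uv(1), of i] le1[OF uv(2), of j] ij by (intro mult_mono) auto
      finally show "u i * B i j * v j \<le> \<bar>B i j\<bar>" by simp
    qed
  qed
  then have up: "bilinear_form p n B u v \<le> Sup S" if "(\<Sum>i<p. (u i)\<^sup>2) \<le> 1" "(\<Sum>i<n. (v i)\<^sup>2) \<le> 1" for u v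
    using that by (intro cSup_upper) (auto simp: S_def)
  have quarter: "(\<Sum>i<d. (4 * (x i - y i))\<^sup>2) \<le> 1" if "(\<Sum>i<d. (x i - y i)\<^sup>2) \<le> 1 / 16" for x y :: "nat \<Rightarrow> real" and d
  proof -
    have "(\<Sum>i<d. (4 * (x i - y i))\<^sup>2) = 16 * (\<Sum>i<d. (x i - y i)\<^sup>2)" by (simp only: power_mult_distrib sum_distrib_left) simp
    then show ?thesis using that by simp
  qed
  have "Sup S \<le> t + Sup S / 2"
  proof (rule cSup_least)
    show "S \<noteq> {}" unfolding S_def by (auto intro!: exI[of _ "\<lambda>_. 0"])
  next
    fix s assume "s \<in> S"
    then obtain u v where s: "s = bilinear_form p n B u v" and uv: "(\<Sum>i<p. (u i)\<^sup>2) \<le> 1" "(\<Sum>i<n. (v i)\<^sup>2) \<le> 1"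
      by (auto simp: S_def)
    obtain z where z: "z \<in> net p" "(\<Sum>i<p. (u i - net_vec p z i)\<^sup>2) \<le> 1 / 16" using ex_net_approx[OF uv(1)] by auto
    obtain w where w: "w \<in> net n" "(\<Sum>i<n. (v i - net_vec n w i)\<^sup>2) \<le> 1 / 16" using ex_net_approx[OF uv(2)] by auto
    define a where "a = (\<lambda>i. 4 * (u i - net_vec p z i))"
    define b where "b = (\<lambda>i. 4 * (v i - net_vec n w i))"
    have ue: "u = (\<lambda>i. net_vec p z i + 1/4 * a i)" and ve: "v = (\<lambda>i. net_vec n w i + 1/4 * b i)" by (auto simp: a_def b_def fun_eq_iff field_simps)
    have "s = bilinear_form p n B (net_vec p z) v + 1/4 * bilinear_form p n B a v"
      unfolding s by (subst ue) (simp only: bilinear_form_simps)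
    also have "bilinear_form p n B (net_vec p z) v = bilinear_form p n B (net_vec p z) (net_vec n w) + 1/4 * bilinear_form p n B (net_vec p z) b"
      by (subst ve) (simp only: bilinear_form_simps)
    finally have "s = bilinear_form p n B (net_vec p z) (net_vec n w) + 1/4 * bilinear_form p n B (net_vec p z) b + 1/4 * bilinear_form p n B a v" .
    moreover have "bilinear_form p n B (net_vec p z) b \<le> Sup S"
      using sum_net_vec_le[OF z(1)] quarter[OF w(2)] by (intro up) (auto simp: b_def)
    moreover have "bilinear_form p n B a v \<le> Sup S"
      using uv(2) quarter[OF z(2)] by (intro up) (auto simp: a_def)
    ultimately show "s \<le> t + Sup S / 2" using net[OF z(1) w(1)] by linarith
  qed
  then show ?thesis using up[OF u v] by linarith
qed

text \<open>
  Chernoff's method for counting: each lattice point of the ball has weight at least \<open>1\<close> under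
  \<open>z \<mapsto> exp (s (16 d - (\<Sum>i. z\<^sub>i\<^sup>2)))\<close>, whose sum over the whole lattice is a product.
\<close>

lemma card_net_filter_le:
  assumes s: "0 \<le> s" "0 < c" and P: "\<And>k. P k \<Longrightarrow> k = 0 \<or> int K \<le> \<bar>k\<bar>"
    and K: "0 < K" "\<And>k::nat. K \<le> k \<Longrightarrow> c \<le> s * real k"
  shows "real (card {z \<in> net d. \<forall>i<d. P (z i)}) \<le> exp (16 * s * d) * (1 + 2 * (exp (- c * K) / (1 - exp (- c)))) ^ d"
proof -
  define A where "A = {k \<in> {- 16 * int d..16 * int d}. P k}"
  have fA: "finite A" by (rule finite_subset[of _ "{- 16 * int d..16 * int d}"]) (auto simp: A_def)
  let ?E = "{z \<in> net d. \<forall>i<d. P (z i)}"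
  have geo: "(\<Sum>k\<in>{K..16 * d}. exp (- c * real k)) \<le> exp (- c * K) / (1 - exp (- c))"
  proof -
    have "(\<Sum>k\<in>{K..16 * d}. exp (- c * real k)) = (\<Sum>k\<in>{K..16 * d}. exp (- c) ^ k)"
      by (simp add: exp_of_nat_mult[symmetric] mult.commute)
    also have "\<dots> = (if 16 * d < K then 0 else (exp (- c) ^ K - exp (- c) ^ Suc (16 * d)) / (1 - exp (- c)))"
      using s by (subst sum_gp) auto
    also have "\<dots> \<le> exp (- c) ^ K / (1 - exp (- c))"
      using s by (auto intro!: divide_right_mono)
    finally show ?thesis by (simp add: exp_of_nat_mult[symmetric] mult.commute)
  qed
  have one: "(\<Sum>k\<in>A. exp (- s * (real_of_int k)\<^sup>2)) \<le> 1 + 2 * (exp (- c * K) / (1 - exp (- c)))"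
  proof -
    have sub: "A \<subseteq> {0} \<union> int ` {K..16 * d} \<union> (\<lambda>k. - int k) ` {K..16 * d}"
    proof
      fix k assume "k \<in> A"
      then have k: "- 16 * int d \<le> k" "k \<le> 16 * int d" "k = 0 \<or> int K \<le> \<bar>k\<bar>" using P by (auto simp: A_def)
      show "k \<in> {0} \<union> int ` {K..16 * d} \<union> (\<lambda>k. - int k) ` {K..16 * d}"
      proof (cases "0 \<le> k")
        case True
        then show ?thesis using k by (cases "k = 0") (auto intro!: image_eqI[of _ int "nat k"])
      next
        case False
        then show ?thesis using k by (auto intro!: image_eqI[of _ "\<lambda>k. - int k" "nat (- k)"])
      qed
    qed
    have un: "sum f (X \<union> Y) \<le> sum f X + sum f Y" if "finite X" "finite Y" "\<And>k. 0 \<le> f k" for X Y :: "int set" and f :: "int \<Rightarrow> real"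
      using sum.union_inter[OF that(1,2), of f] sum_nonneg[of "X \<inter> Y" f, OF that(3)] by linarith
    \<comment> \<open>From K on, c \<le> s k replaces the Gaussian weight by a geometric
      one.\<close>
    have summand_le: "exp (- s * (real k)\<^sup>2) \<le> exp (- c * real k)" if "K \<le> k" for k
      using mult_right_mono[OF K(2)[OF that], of "real k"] by (simp add: power2_eq_square mult.assoc)
    have "(\<Sum>k\<in>A. exp (- s * (real_of_int k)\<^sup>2)) \<le> (\<Sum>k\<in>{0} \<union> int ` {K..16 * d} \<union> (\<lambda>k. - int k) ` {K..16 * d}. exp (- s * (real_of_int k)\<^sup>2))"
      using sub by (intro sum_mono2) auto
    also have "\<dots> \<le> (\<Sum>k\<in>{0::int}. exp (- s * (real_of_int k)\<^sup>2)) + (\<Sum>k\<in>int ` {K..16 * d}. exp (- s * (real_of_int k)\<^sup>2))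
        + (\<Sum>k\<in>(\<lambda>k. - int k) ` {K..16 * d}. exp (- s * (real_of_int k)\<^sup>2))"
      by (intro order_trans[OF un] order_refl add_right_mono un) auto
    also have "\<dots> = 1 + 2 * (\<Sum>k\<in>{K..16 * d}. exp (- s * (real k)\<^sup>2))"
      by (subst (1 2) sum.reindex) (auto simp: inj_on_def)
    also have "(\<Sum>k\<in>{K..16 * d}. exp (- s * (real k)\<^sup>2)) \<le> (\<Sum>k\<in>{K..16 * d}. exp (- c * real k))"
      by (intro sum_mono summand_le) auto
    finally show ?thesis using geo by simp
  qed
  have fE: "finite ?E" by auto
  have "real (card ?E) = (\<Sum>z\<in>?E. 1)" by simp
  also have "\<dots> \<le> (\<Sum>z\<in>?E. exp (16 * s * d) * (\<Prod>i<d. exp (- s * (real_of_int (z i))\<^sup>2)))"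
  proof (rule sum_mono)
    fix z assume "z \<in> ?E"
    then have "real_of_int (\<Sum>i<d. (z i)\<^sup>2) \<le> real_of_int (16 * int d)" unfolding of_int_le_iff by (auto simp: net_def)
    then have "s * (\<Sum>i<d. (real_of_int (z i))\<^sup>2) \<le> s * (16 * d)" using s by (intro mult_left_mono) auto
    then show "1 \<le> exp (16 * s * d) * (\<Prod>i<d. exp (- s * (real_of_int (z i))\<^sup>2))"
      by (simp add: exp_sum[symmetric] exp_add[symmetric] sum_negf sum_distrib_left[symmetric] mult_ac)
  qed
  also have "\<dots> \<le> (\<Sum>z\<in>PiE {..<d} (\<lambda>_. A). exp (16 * s * d) * (\<Prod>i<d. exp (- s * (real_of_int (z i))\<^sup>2)))"
  proof (rule sum_mono2)
    show "finite (PiE {..<d} (\<lambda>_. A))" using fA by (intro finite_PiE) auto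
    show "?E \<subseteq> PiE {..<d} (\<lambda>_. A)" by (auto simp: A_def net_def PiE_def Pi_def)
  qed (simp add: prod_nonneg)
  also have "\<dots> = exp (16 * s * d) * (\<Prod>i<d. \<Sum>k\<in>A. exp (- s * (real_of_int k)\<^sup>2))"
    using fA by (subst prod_sum_PiE) (auto simp: sum_distrib_left)
  also have "\<dots> \<le> exp (16 * s * d) * (1 + 2 * (exp (- c * K) / (1 - exp (- c)))) ^ d"
    using one by (auto intro!: mult_left_mono power_mono sum_nonneg)
  finally show ?thesis .
qed

lemma card_net_le: "real (card (net d)) \<le> exp (18 * d)"
proof -
  have "real (card {z \<in> net d. \<forall>i<d. True}) \<le> exp (16 * 1 * real d) * (1 + 2 * (exp (- 1 * real 1) / (1 - exp (- 1)))) ^ d"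
    by (rule card_net_filter_le) auto
  moreover have "1 + 2 * (exp (- 1 * real 1) / (1 - exp (- 1))) \<le> exp (2::real)"
  proof -
    have e: "exp (1::real) \<ge> 2" using exp_ge_add_one_self[of 1] by simp
    then have "exp (2::real) \<ge> 4" using mult_mono[OF e e] by (simp add: exp_add[symmetric])
    have "exp (- 1) \<le> (1 / 2::real)" using e by (simp add: exp_minus field_simps)
    then have "exp (- 1) / (1 - exp (- 1)) \<le> (1::real)" by (simp add: divide_le_eq)
    then show ?thesis using \<open>exp 2 \<ge> 4\<close> unfolding of_nat_1 mult_1_right by linarith
  qed
  then have "(1 + 2 * (exp (- 1 * real 1) / (1 - exp (- 1)))) ^ d \<le> exp (2::real) ^ d"
    by (intro power_mono) auto
  then have "exp (16 * 1 * real d) * (1 + 2 * (exp (- 1 * real 1) / (1 - exp (- 1)))) ^ d \<le> exp (16 * d) * exp (2 * real d)"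
    unfolding exp_of_nat2_mult[of 2] mult_1_right by (intro mult_mono) auto
  ultimately show ?thesis by (simp add: exp_add[symmetric])
qed

text \<open>A vector of the unit ball whose nonzero entries exceed 1 / (\<rho> sqrt d) has at most
  \<rho>^2 d of them, so the entropy is far below d. Taking s = \<rho> and c = 4 in the Chernoff
  count gives at most 1 + \<rho> per coordinate besides exp(16 \<rho> d).\<close>

lemma card_heavy_net_le:
  assumes \<rho>: "0 < \<rho>" "\<rho> \<le> 1"
  shows "real (card {z \<in> net d. \<forall>i<d. z i = 0 \<or> 4 < \<bar>real_of_int (z i)\<bar> * \<rho>}) \<le> exp (17 * \<rho> * d)"
proof -
  define K where "K = nat \<lceil>4 / \<rho>\<rceil>"
  have K4: "4 / \<rho> \<le> real K" using real_nat_ceiling_ge by (simp add: K_def)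
  then have "0 < real K" using \<rho> by (smt (verit) divide_pos_pos)
  then have K: "0 < K" by simp
  have "real (card {z \<in> net d. \<forall>i<d. z i = 0 \<or> 4 < \<bar>real_of_int (z i)\<bar> * \<rho>}) 
      \<le> exp (16 * \<rho> * d) * (1 + 2 * (exp (- 4 * real K) / (1 - exp (- 4)))) ^ d"
  proof (rule card_net_filter_le)
    fix k :: int assume "k = 0 \<or> 4 < \<bar>real_of_int k\<bar> * \<rho>"
    then have "k = 0 \<or> 4 / \<rho> < real_of_int \<bar>k\<bar>" using \<rho> by (auto simp: field_simps)
    then have "k = 0 \<or> \<lceil>4 / \<rho>\<rceil> \<le> \<bar>k\<bar>" by (auto simp: ceiling_le_iff)
    moreover have "0 \<le> \<lceil>4 / \<rho>\<rceil>" using \<rho> by (smt (verit) divide_pos_pos le_of_int_ceiling of_int_0_le_iff)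
    then have "int K = \<lceil>4 / \<rho>\<rceil>" by (simp add: K_def)
    ultimately show "k = 0 \<or> int K \<le> \<bar>k\<bar>" by simp
  next
    fix k :: nat assume "K \<le> k"
    then have "4 / \<rho> \<le> real k" using K4 by linarith
    then show "4 \<le> \<rho> * real k" using \<rho> by (simp add: field_simps)
  qed (use \<rho> K in auto)
  also have "2 * (exp (- 4 * real K) / (1 - exp (- 4))) \<le> \<rho>"
  proof -
    have "exp (4::real) \<ge> 5" using exp_ge_add_one_self[of 4] by simp
    then have "exp (- 4) \<le> (1 / 2::real)" by (simp add: exp_minus field_simps)
    then have "exp (- 4 * real K) / (1 - exp (- 4)) \<le> exp (- 4 * real K) / (1 / 2)" by (intro divide_left_mono) auto
    moreover have "exp (- 4 * real K) \<le> \<rho> / 16"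
    proof -
      \<comment> \<open>The crude bound exp x \<ge> 1 + x suffices here.\<close>
      have "16 / \<rho> \<le> 1 + 4 * real K" using K4 by simp
      also have "\<dots> \<le> exp (4 * real K)" by simp
      finally show ?thesis using \<rho> by (simp add: exp_minus field_simps)
    qed
    ultimately show ?thesis using \<rho> by simp
  qed
  then have "1 + 2 * (exp (- 4 * real K) / (1 - exp (- 4))) \<le> exp \<rho>"
    using exp_ge_add_one_self[of \<rho>] by linarith
  then have "(1 + 2 * (exp (- 4 * real K) / (1 - exp (- 4)))) ^ d \<le> exp \<rho> ^ d"
    by (rule power_mono) simp
  then have "exp (16 * \<rho> * d) * (1 + 2 * (exp (- 4 * real K) / (1 - exp (- 4)))) ^ d \<le> exp (16 * \<rho> * d) * exp (\<rho> * d)"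
    unfolding exp_of_nat2_mult by (rule mult_left_mono) simp
  finally show ?thesis by (simp add: exp_add[symmetric] algebra_simps)
qed

section \<open>Gaussian tails and sign symmetry\<close>

text \<open>Markov's inequality at level 1, with the normalisation of Chernoff's method built into
  f.\<close>

lemma (in prob_space) prob_le_of_nn_integral:
  assumes "Measurable.pred M P" "\<And>x. x \<in> space M \<Longrightarrow> P x \<Longrightarrow> 1 \<le> f x" "(\<integral>\<^sup>+x. f x \<partial>M) \<le> ennreal b" "0 \<le> b"
  shows "measure M {x \<in> space M. P x} \<le> b"
proof -
  have "emeasure M {x \<in> space M. P x} = (\<integral>\<^sup>+x. indicator {x \<in> space M. P x} x \<partial>M)"
    using assms(1) by (intro nn_integral_indicator[symmetric]) measurable
  also have "\<dots> \<le> (\<integral>\<^sup>+x. f x \<partial>M)"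
    using assms(2) by (intro nn_integral_mono) (auto split: split_indicator)
  finally have "ennreal (measure M {x \<in> space M. P x}) \<le> ennreal b" using assms(3) by (simp add: emeasure_eq_measure)
  then show ?thesis using assms(4) by (simp add: ennreal_le_iff)
qed

lemma nn_integral_gauss1_exp: "(\<integral>\<^sup>+x. ennreal (exp (c * x)) \<partial>gauss1) = ennreal (exp (c\<^sup>2 / 2))"
proof -
  have "(\<integral>\<^sup>+x. ennreal (exp (c * x)) \<partial>gauss1) = (\<integral>\<^sup>+x. ennreal (exp (c\<^sup>2 / 2)) * ennreal (normal_density c 1 x) \<partial>lborel)"
    unfolding gauss1_def
  proof (subst nn_integral_density; measurable?; intro nn_integral_cong)
    fix x :: real
    have "std_normal_density x * exp (c * x) = exp (c\<^sup>2 / 2) * normal_density c 1 x"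
      unfolding normal_density_def
      by (simp add: exp_add[symmetric] power2_eq_square field_simps flip: exp_add)
    then show "ennreal (std_normal_density x) * ennreal (exp (c * x)) = ennreal (exp (c\<^sup>2 / 2)) * ennreal (normal_density c 1 x)"
      by (simp add: ennreal_mult'[symmetric])
  qed
  also have "\<dots> = ennreal (exp (c\<^sup>2 / 2)) * (\<integral>\<^sup>+x. ennreal (normal_density c 1 x) \<partial>lborel)"
    by (rule nn_integral_cmult) simp
  also have "(\<integral>\<^sup>+x. ennreal (normal_density c 1 x) \<partial>lborel) = 1"
    using prob_space.emeasure_space_1[OF prob_space_normal_density[of 1 c]] by (simp add: emeasure_density)
  finally show ?thesis by simp
qed

lemma nn_integral_gauss1_exp_square: "(\<integral>\<^sup>+x. ennreal (exp (x\<^sup>2 / 4)) \<partial>gauss1) = ennreal (sqrt 2)"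
proof -
  have "(\<integral>\<^sup>+x. ennreal (exp (x\<^sup>2 / 4)) \<partial>gauss1) = (\<integral>\<^sup>+x. ennreal (sqrt 2) * ennreal (normal_density 0 (sqrt 2) x) \<partial>lborel)"
    unfolding gauss1_def
  proof (subst nn_integral_density; measurable?; intro nn_integral_cong)
    fix x :: real
    have "std_normal_density x * exp (x\<^sup>2 / 4) = sqrt 2 * normal_density 0 (sqrt 2) x"
      unfolding normal_density_def
      by (simp add: real_sqrt_mult exp_add[symmetric] power2_eq_square field_simps flip: exp_add)
    then show "ennreal (std_normal_density x) * ennreal (exp (x\<^sup>2 / 4)) = ennreal (sqrt 2) * ennreal (normal_density 0 (sqrt 2) x)"
      by (simp add: ennreal_mult'[symmetric])
  qed
  also have "\<dots> = ennreal (sqrt 2) * (\<integral>\<^sup>+x. ennreal (normal_density 0 (sqrt 2) x) \<partial>lborel)"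
    by (rule nn_integral_cmult) simp
  also have "(\<integral>\<^sup>+x. ennreal (normal_density 0 (sqrt 2) x) \<partial>lborel) = 1"
    using prob_space.emeasure_space_1[OF prob_space_normal_density[of "sqrt 2" 0]] by (simp add: emeasure_density)
  finally show ?thesis by simp
qed

lemma nn_integral_gauss_exp_linear:
  assumes "finite I"
  shows "(\<integral>\<^sup>+x. ennreal (exp (\<Sum>k\<in>I. c k * x k)) \<partial>gauss I) = ennreal (exp ((\<Sum>k\<in>I. (c k)\<^sup>2) / 2))"
proof -
  have "(\<integral>\<^sup>+x. ennreal (exp (\<Sum>k\<in>I. c k * x k)) \<partial>gauss I) = (\<integral>\<^sup>+x. (\<Prod>k\<in>I. ennreal (exp (c k * x k))) \<partial>PiM I (\<lambda>_. gauss1))"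
    unfolding gauss_def using assms by (intro nn_integral_cong) (simp add: exp_sum prod_ennreal)
  also have "\<dots> = (\<Prod>k\<in>I. ennreal (exp ((c k)\<^sup>2 / 2)))"
    using assms by (subst gauss1_prod.product_nn_integral_prod) (auto simp: nn_integral_gauss1_exp)
  also have "\<dots> = ennreal (exp ((\<Sum>k\<in>I. (c k)\<^sup>2) / 2))"
    using assms by (simp add: prod_ennreal exp_sum[symmetric] sum_divide_distrib)
  finally show ?thesis .
qed

lemma measurable_gauss_component [measurable]: "k \<in> I \<Longrightarrow> (\<lambda>x. x k) \<in> borel_measurable (gauss I)"
  by (simp add: gauss_def cong: measurable_cong_sets)

lemma gauss_linear_tail:
  assumes "finite I" and V: "(\<Sum>k\<in>I. (c k)\<^sup>2) \<le> V" "0 < V" and "0 \<le> t"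
  shows "measure (gauss I) {x \<in> space (gauss I). t \<le> (\<Sum>k\<in>I. c k * x k)} \<le> exp (- (t\<^sup>2 / (2 * V)))"
proof (rule gauss.prob_le_of_nn_integral)
  define s where "s = t / V"
  have s: "0 \<le> s" using assms by (simp add: s_def)
  show "Measurable.pred (gauss I) (\<lambda>x. t \<le> (\<Sum>k\<in>I. c k * x k))" by measurable
  show "1 \<le> ennreal (exp (- s * t)) * ennreal (exp (\<Sum>k\<in>I. s * c k * x k))" if "t \<le> (\<Sum>k\<in>I. c k * x k)" for x
    using mult_left_mono[OF that s]
    by (simp add: ennreal_mult'[symmetric] exp_add[symmetric] sum_distrib_left mult.assoc flip: ennreal_1)
  have "(\<integral>\<^sup>+x. ennreal (exp (- s * t)) * ennreal (exp (\<Sum>k\<in>I. s * c k * x k)) \<partial>gauss I)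
      = ennreal (exp (- s * t)) * ennreal (exp ((\<Sum>k\<in>I. (s * c k)\<^sup>2) / 2))"
    using assms by (subst nn_integral_cmult) (auto simp: nn_integral_gauss_exp_linear)
  also have "\<dots> = ennreal (exp (s\<^sup>2 * (\<Sum>k\<in>I. (c k)\<^sup>2) / 2 - s * t))"
    by (simp add: ennreal_mult'[symmetric] exp_add[symmetric] power_mult_distrib sum_distrib_left)
  also have "\<dots> \<le> ennreal (exp (- (t\<^sup>2 / (2 * V))))"
  proof -
    have "s\<^sup>2 * (\<Sum>k\<in>I. (c k)\<^sup>2) / 2 - s * t \<le> s\<^sup>2 * V / 2 - s * t"
      using V by (simp add: mult_left_mono)
    also have "\<dots> = - (t\<^sup>2 / (2 * V))" using V by (simp add: s_def power2_eq_square field_simps)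
    finally show ?thesis by (simp add: ennreal_leI)
  qed
  finally show "(\<integral>\<^sup>+x. ennreal (exp (- s * t)) * ennreal (exp (\<Sum>k\<in>I. s * c k * x k)) \<partial>gauss I) \<le> ennreal (exp (- (t\<^sup>2 / (2 * V))))" .
qed simp

text \<open>Chernoff with exp(x^2 / 4), whose mean sqrt 2 is at most exp(1/2). The threshold 4
  \<alpha> + 2 is chosen so that a quarter of it minus 1/2 is \<alpha>; it later serves as the bound
  \<open>C\<close> on squared row lengths per column.\<close>

lemma gauss_square_tail:
  fixes \<alpha> :: real
  assumes "finite I" "S \<subseteq> I" "0 \<le> \<alpha>"
  shows "measure (gauss I) {x \<in> space (gauss I). (4 * \<alpha> + 2) * card S < (\<Sum>k\<in>S. (x k)\<^sup>2)} \<le> exp (- \<alpha> * card S)"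
proof (rule gauss.prob_le_of_nn_integral)
  have [measurable]: "k \<in> S \<Longrightarrow> k \<in> I" for k using assms by auto
  show "Measurable.pred (gauss I) (\<lambda>x. (4 * \<alpha> + 2) * card S < (\<Sum>k\<in>S. (x k)\<^sup>2))" by measurable
  \<comment> \<open>The factor 1 off S makes this a product over all of I, as the product integral
    formula expects.\<close>
  let ?f = "\<lambda>x. ennreal (exp (- (\<alpha> + 1 / 2) * card S)) * (\<Prod>k\<in>I. if k \<in> S then ennreal (exp ((x k)\<^sup>2 / 4)) else 1)"
  have f: "?f x = ennreal (exp (- (\<alpha> + 1 / 2) * card S + (\<Sum>k\<in>S. (x k)\<^sup>2 / 4)))" for x
  proof -
    have fS: "finite S" using assms finite_subset by auto
    have "(\<Prod>k\<in>I. if k \<in> S then ennreal (exp ((x k)\<^sup>2 / 4)) else 1) = (\<Prod>k\<in>S. ennreal (exp ((x k)\<^sup>2 / 4)))"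
      using assms by (subst prod.inter_restrict[symmetric]) (auto simp: Int_absorb1)
    also have "\<dots> = ennreal (exp (\<Sum>k\<in>S. (x k)\<^sup>2 / 4))" using fS by (simp add: prod_ennreal exp_sum)
    finally show ?thesis by (simp only: exp_add ennreal_mult')  (simp add: ennreal_mult')
  qed
  show "1 \<le> ?f x" if "(4 * \<alpha> + 2) * card S < (\<Sum>k\<in>S. (x k)\<^sup>2)" for x
  proof -
    have "0 \<le> - (\<alpha> + 1 / 2) * card S + (\<Sum>k\<in>S. (x k)\<^sup>2 / 4)"
      using that by (simp add: sum_divide_distrib[symmetric] algebra_simps)
    then show ?thesis unfolding f by (simp flip: ennreal_1)
  qed
  have "(\<integral>\<^sup>+x. ?f x \<partial>gauss I) = ennreal (exp (- (\<alpha> + 1 / 2) * card S)) * (\<Prod>k\<in>I. if k \<in> S then ennreal (sqrt 2) else 1)"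
  proof (subst nn_integral_cmult)
    have em: "(\<lambda>y. exp (y\<^sup>2 / 4)) \<in> borel_measurable gauss1" by (simp cong: measurable_cong_sets)
    have "(\<integral>\<^sup>+x. (\<Prod>k\<in>I. (if k \<in> S then (\<lambda>y. ennreal (exp (y\<^sup>2 / 4))) else (\<lambda>_. 1)) (x k)) \<partial>PiM I (\<lambda>_. gauss1))
        = (\<Prod>k\<in>I. if k \<in> S then ennreal (sqrt 2) else 1)"
      using assms by (subst gauss1_prod.product_nn_integral_prod)
        (auto intro!: prod.cong simp: nn_integral_gauss1_exp_square em gauss1.emeasure_space_1[simplified])
    then show "ennreal (exp (- (\<alpha> + 1 / 2) * card S)) * (\<integral>\<^sup>+x. (\<Prod>k\<in>I. if k \<in> S then ennreal (exp ((x k)\<^sup>2 / 4)) else 1) \<partial>gauss I) 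
       = ennreal (exp (- (\<alpha> + 1 / 2) * card S)) * (\<Prod>k\<in>I. if k \<in> S then ennreal (sqrt 2) else 1)"
      by (simp add: gauss_def if_distrib[of "\<lambda>f. f _"])
  qed measurable
  also have "(\<Prod>k\<in>I. if k \<in> S then ennreal (sqrt 2) else 1) = ennreal (sqrt 2) ^ card S"
    using assms by (subst prod.inter_restrict[symmetric]) (auto simp: Int_absorb1)
  also have "\<dots> \<le> ennreal (exp (1 / 2)) ^ card S"
  proof (intro power_mono ennreal_leI)
    have "(sqrt 2)\<^sup>2 \<le> (exp (1 / 2))\<^sup>2" using exp_ge_add_one_self[of 1] by (simp add: power2_eq_square exp_add[symmetric])
    then show "sqrt 2 \<le> exp (1 / 2)" by (rule power2_le_imp_le) simp
  qed simp
  also have "ennreal (exp (- (\<alpha> + 1 / 2) * card S)) * ennreal (exp (1 / 2)) ^ card S = ennreal (exp (- \<alpha> * card S))"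
    by (simp add: ennreal_power ennreal_mult'[symmetric] exp_of_nat2_mult[symmetric] exp_add[symmetric] algebra_simps)
  finally show "(\<integral>\<^sup>+x. ?f x \<partial>gauss I) \<le> ennreal (exp (- \<alpha> * card S))" by (simp add: mult_left_mono)
qed simp

lemma uminus_vimage_borel:
  fixes A :: "real set"
  assumes "A \<in> sets borel"
  shows "uminus -` A \<in> sets borel"
proof -
  have "(uminus :: real \<Rightarrow> real) \<in> borel_measurable borel" by measurable
  from measurable_sets[OF this assms] show ?thesis by simp
qed

lemma emeasure_gauss1_uminus:
  assumes A [measurable]: "A \<in> sets borel"
  shows "emeasure gauss1 (uminus -` A) = emeasure gauss1 A"
proof -
  note [measurable] = uminus_vimage_borel[OF A]
  have "emeasure gauss1 (uminus -` A) = (\<integral>\<^sup>+x. ennreal (std_normal_density x) * indicator (uminus -` A) x \<partial>lborel)"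
    unfolding gauss1_def by (rule emeasure_density) auto
  also have "\<dots> = (\<integral>\<^sup>+x. ennreal (std_normal_density (- x)) * indicator A (- x) \<partial>lborel)"
    by (intro nn_integral_cong) (simp add: normal_density_def indicator_def)
  also have "\<dots> = (\<integral>\<^sup>+x. ennreal (std_normal_density x) * indicator A x \<partial>distr lborel borel uminus)"
    by (subst nn_integral_distr) auto
  also have "\<dots> = emeasure gauss1 A"
    unfolding gauss1_def lborel_distr_uminus by (rule emeasure_density[symmetric]) auto
  finally show ?thesis .
qed

text \<open>Restriction to I keeps the result extensional, so it stays in the space of
  \<open>gauss I\<close>.\<close>

definition flip :: "('i \<Rightarrow> bool) \<Rightarrow> 'i set \<Rightarrow> ('i \<Rightarrow> real) \<Rightarrow> 'i \<Rightarrow> real" where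
  "flip Q I x = (\<lambda>k\<in>I. if Q k then - x k else x k)"

lemma measurable_flip [measurable]: "flip Q I \<in> gauss I \<rightarrow>\<^sub>M gauss I"
proof -
  have "flip Q I \<in> gauss I \<rightarrow>\<^sub>M PiM I (\<lambda>_. gauss1)"
    unfolding flip_def[abs_def]
  proof (rule measurable_restrict)
    fix k assume "k \<in> I"
    then have "(\<lambda>x. if Q k then - x k else x k) \<in> borel_measurable (gauss I)" by measurable
    then show "(\<lambda>x. if Q k then - x k else x k) \<in> gauss I \<rightarrow>\<^sub>M gauss1" by (subst measurable_cong_sets[OF refl sets_gauss1])
  qed
  then show ?thesis by (simp only: gauss_def)
qed

lemma distr_gauss_flip:
  assumes "finite I"
  shows "distr (gauss I) (gauss I) (flip Q I) = gauss I"
proof -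
  have "distr (gauss I) (gauss I) (flip Q I) = PiM I (\<lambda>_. gauss1)"
  proof (rule gauss1_prod.PiM_eqI)
    fix A assume A: "\<And>i. i \<in> I \<Longrightarrow> A i \<in> sets gauss1"
    have m: "PiE I A \<in> sets (gauss I)" using A assms by (auto simp: gauss_def intro!: sets_PiM_I_finite)
    have "flip Q I -` PiE I A \<inter> space (gauss I) = PiE I (\<lambda>k. if Q k then uminus -` A k else A k)"
      by (auto simp: flip_def space_gauss PiE_def Pi_def extensional_def split: if_splits)
    then have "emeasure (distr (gauss I) (gauss I) (flip Q I)) (PiE I A) = emeasure (gauss I) (PiE I (\<lambda>k. if Q k then uminus -` A k else A k))"
      using m by (subst emeasure_distr) auto
    also have "\<dots> = (\<Prod>k\<in>I. emeasure gauss1 (if Q k then uminus -` A k else A k))"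
      unfolding gauss_def using A assms 
      by (subst gauss1_prod.emeasure_PiM) (auto simp: uminus_vimage_borel)
    also have "\<dots> = (\<Prod>k\<in>I. emeasure gauss1 (A k))"
    proof (rule prod.cong)
      fix k assume k: "k \<in> I"
      show "emeasure gauss1 (if Q k then uminus -` A k else A k) = emeasure gauss1 (A k)"
        using A[OF k] by (simp add: emeasure_gauss1_uminus)
    qed simp
    finally show "emeasure (distr (gauss I) (gauss I) (flip Q I)) (PiE I A) = (\<Prod>k\<in>I. emeasure gauss1 (A k))" .
  qed (use assms in \<open>auto simp: gauss_def\<close>)
  then show ?thesis by (simp add: gauss_def)
qed

lemma integral_gauss_flip_odd:
  fixes f :: "('i \<Rightarrow> real) \<Rightarrow> real"
  assumes "finite I" and "f \<in> borel_measurable (gauss I)"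
    and odd: "\<And>x. x \<in> space (gauss I) \<Longrightarrow> f (flip Q I x) = - f x"
  shows "(\<integral>x. f x \<partial>gauss I) = 0"
proof -
  have "(\<integral>x. f x \<partial>gauss I) = (\<integral>x. f x \<partial>distr (gauss I) (gauss I) (flip Q I))"
    by (simp add: distr_gauss_flip[OF assms(1)])
  also have "\<dots> = (\<integral>x. f (flip Q I x) \<partial>gauss I)" by (rule integral_distr[OF measurable_flip assms(2)])
  also have "\<dots> = (\<integral>x. - f x \<partial>gauss I)" using odd by (intro Bochner_Integration.integral_cong) auto
  finally show ?thesis by simp
qed

section \<open>Gaussian matrices\<close>

text \<open>This is sqrt n times the sample covariance, hence the argument of the kernel. Matrices
  are now functions of index pairs, the points of a product space.\<close>

definition gram :: "nat \<Rightarrow> (nat \<times> nat \<Rightarrow> real) \<Rightarrow> nat \<Rightarrow> nat \<Rightarrow> real" where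
  "gram n x i i' = (\<Sum>l<n. x (i, l) * x (i', l)) / sqrt (real n)"

definition large_count :: "nat \<Rightarrow> nat \<Rightarrow> real \<Rightarrow> (nat \<times> nat \<Rightarrow> real) \<Rightarrow> nat \<Rightarrow> nat" where
  "large_count p n T x i = card {i' \<in> {..<p} - {i}. T < \<bar>gram n x i i'\<bar>}"

abbreviation gauss_matrix :: "nat \<Rightarrow> nat \<Rightarrow> (nat \<times> nat \<Rightarrow> real) measure" where
  "gauss_matrix p n \<equiv> gauss ({..<p} \<times> {..<n})"

lemma measurable_entry:
  "i < p \<Longrightarrow> j < n \<Longrightarrow> (\<lambda>x. x (i, j)) \<in> borel_measurable (gauss_matrix p n)"
  by (rule measurable_gauss_component) simp

lemma measurable_row_norm:
  assumes "i < p"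
  shows "(\<lambda>x. \<Sum>l<n. (x (i, l))\<^sup>2) \<in> borel_measurable (gauss_matrix p n)"
proof (rule borel_measurable_sum)
  fix l assume "l \<in> {..<n}"
  then have "(\<lambda>x. x (i, l)) \<in> borel_measurable (gauss_matrix p n)" using assms by (intro measurable_entry) auto
  then show "(\<lambda>x. (x (i, l))\<^sup>2) \<in> borel_measurable (gauss_matrix p n)" by (rule borel_measurable_power)
qed

lemma measurable_row_indicator:
  assumes "i < p"
  shows "(\<lambda>x. indicator {x. (\<Sum>l<n. (x (i, l))\<^sup>2) \<le> c} x :: ennreal) \<in> borel_measurable (gauss_matrix p n)"
proof -
  have "(\<lambda>x. if (\<Sum>l<n. (x (i, l))\<^sup>2) \<le> c then 1 else 0 :: ennreal) \<in> borel_measurable (gauss_matrix p n)"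
    using assms by (intro measurable_If borel_measurable_const borel_measurable_le measurable_row_norm)
  then show ?thesis by (simp only: indicator_def of_bool_def mem_Collect_eq)
qed

lemma measurable_gram:
  assumes "i < p" "i' < p"
  shows "(\<lambda>x. gram n x i i') \<in> borel_measurable (gauss_matrix p n)"
  unfolding gram_def
proof (intro borel_measurable_divide borel_measurable_sum borel_measurable_const)
  fix l assume l: "l \<in> {..<n}"
  show "(\<lambda>x. x (i, l) * x (i', l)) \<in> borel_measurable (gauss_matrix p n)"
    using assms l by (intro borel_measurable_times measurable_entry) auto
qed

lemma gram_commute: "gram n x i i' = gram n x i' i"
  by (simp add: gram_def mult.commute)

lemma large_count_eq_sum:
  "real (large_count p n T x i) = (\<Sum>i'\<in>{..<p} - {i}. if T < \<bar>gram n x i i'\<bar> then 1 else 0)"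
proof -
  have "{i' \<in> {..<p} - {i}. T < \<bar>gram n x i i'\<bar>} = ({..<p} - {i}) \<inter> {i'. T < \<bar>gram n x i i'\<bar>}" by auto
  then show ?thesis by (simp add: large_count_def sum.If_cases)
qed

lemma measurable_large_count:
  "i < p \<Longrightarrow> (\<lambda>x. real (large_count p n T x i)) \<in> borel_measurable (gauss_matrix p n)"
  unfolding large_count_eq_sum
proof (intro borel_measurable_sum measurable_If borel_measurable_const)
  fix i' assume "i < p" "i' \<in> {..<p} - {i}"
  then show "{x \<in> space (gauss_matrix p n). T < \<bar>gram n x i i'\<bar>} \<in> sets (gauss_matrix p n)"
    by (intro borel_measurable_less borel_measurable_abs borel_measurable_const measurable_gram) auto
qed

lemma measurable_bilinear_form_entries:
  "(\<lambda>x. bilinear_form p n (\<lambda>i j. x (i, j)) u v) \<in> borel_measurable (gauss_matrix p n)"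
  unfolding bilinear_form_def
proof (intro borel_measurable_sum)
  fix i j assume "i \<in> {..<p}" "j \<in> {..<n}"
  then have "(\<lambda>x. x (i, j)) \<in> borel_measurable (gauss_matrix p n)" by (intro measurable_entry) auto
  then show "(\<lambda>x. u i * x (i, j) * v j) \<in> borel_measurable (gauss_matrix p n)"
    by (intro borel_measurable_times borel_measurable_const)
qed

text \<open>On a fixed pair of net vectors the form is a centred Gaussian of variance at most 1. The
  constant 7 is the least integer whose half square, 49/2, exceeds the entropy rate 18 of the
  nets.\<close>

lemma op_norm_tail:
  assumes "0 < p"
  shows "measure (gauss_matrix p n) {x \<in> space (gauss_matrix p n). \<exists>z\<in>net p. \<exists>w\<in>net n.
      7 * sqrt (p + n) < bilinear_form p n (\<lambda>i j. x (i, j)) (net_vec p z) (net_vec n w)} \<le> exp (- real p)"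
proof -
  let ?M = "gauss_matrix p n"
  let ?E = "\<lambda>z w. {x \<in> space ?M. 7 * sqrt (p + n) \<le> bilinear_form p n (\<lambda>i j. x (i, j)) (net_vec p z) (net_vec n w)}"
  have one: "measure ?M (?E z w) \<le> exp (- 49 / 2 * (p + n))" if zw: "z \<in> net p" "w \<in> net n" for z w
  proof -
    define c where "c = (\<lambda>k. net_vec p z (fst k) * net_vec n w (snd k))"
    have lin: "bilinear_form p n (\<lambda>i j. x (i, j)) (net_vec p z) (net_vec n w) = (\<Sum>k\<in>{..<p} \<times> {..<n}. c k * x k)" for x :: "nat \<times> nat \<Rightarrow> real"
      unfolding bilinear_form_def by (simp add: sum.cartesian_product c_def case_prod_beta' mult_ac)
    have "(\<Sum>k\<in>{..<p} \<times> {..<n}. (c k)\<^sup>2) = (\<Sum>i<p. (net_vec p z i)\<^sup>2) * (\<Sum>j<n. (net_vec n w j)\<^sup>2)"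
      unfolding sum_product sum.cartesian_product by (simp add: c_def case_prod_beta' power_mult_distrib)
    also have "\<dots> \<le> 1 * 1" using zw by (intro mult_mono sum_net_vec_le sum_nonneg) auto
    finally have "measure ?M {x \<in> space ?M. 7 * sqrt (p + n) \<le> (\<Sum>k\<in>{..<p} \<times> {..<n}. c k * x k)} \<le> exp (- ((7 * sqrt (p + n))\<^sup>2 / (2 * 1)))"
      by (intro gauss_linear_tail) auto
    also have "- ((7 * sqrt (p + n))\<^sup>2 / (2 * 1)) = - 49 / 2 * real (p + n)" by (simp add: power_mult_distrib)
    finally show ?thesis unfolding lin .
  qed
  have ms: "?E z w \<in> sets ?M" for z w
    using measurable_bilinear_form_entries by (rule borel_measurable_le[OF borel_measurable_const])
  have "measure ?M {x \<in> space ?M. \<exists>z\<in>net p. \<exists>w\<in>net n. 7 * sqrt (p + n) < bilinear_form p n (\<lambda>i j. x (i, j)) (net_vec p z) (net_vec n w)}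
     \<le> measure ?M (\<Union>k\<in>net p \<times> net n. ?E (fst k) (snd k))"
  proof (rule gauss.finite_measure_mono)
    show "(\<Union>k\<in>net p \<times> net n. ?E (fst k) (snd k)) \<in> sets ?M"
      by (intro sets.finite_UN finite_cartesian_product finite_net ms)
  qed force
  also have "\<dots> \<le> (\<Sum>k\<in>net p \<times> net n. measure ?M (?E (fst k) (snd k)))"
    by (intro gauss.finite_measure_subadditive_finite finite_cartesian_product finite_net image_subsetI ms)
  also have "\<dots> \<le> (\<Sum>k\<in>net p \<times> net n. exp (- 49 / 2 * (p + n)))"
    by (intro sum_mono one) auto
  also have "\<dots> = real (card (net p)) * real (card (net n)) * exp (- 49 / 2 * (p + n))"
    by (simp add: card_cartesian_product)
  also have "\<dots> \<le> exp (18 * p) * exp (18 * n) * exp (- 49 / 2 * (p + n))"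
    using card_net_le[of p] card_net_le[of n] by (intro mult_mono) auto
  also have "\<dots> = exp (- 13 / 2 * p + - 13 / 2 * n)" by (simp add: exp_add[symmetric] algebra_simps)
  also have "\<dots> \<le> exp (- real p)" by simp
  finally show ?thesis .
qed

text \<open>Test the form on d and its image B d, both normalised; the degenerate cases are those in
  which one of them vanishes.\<close>

lemma op_norm_le:
  assumes net: "\<And>z w. z \<in> net p \<Longrightarrow> w \<in> net n \<Longrightarrow> bilinear_form p n B (net_vec p z) (net_vec n w) \<le> t" and "0 \<le> t"
  shows "(\<Sum>i<p. (\<Sum>j<n. B i j * d j)\<^sup>2) \<le> (2 * t)\<^sup>2 * (\<Sum>j<n. (d j)\<^sup>2)"
proof -
  define D where "D = (\<Sum>j<n. (d j)\<^sup>2)"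
  define y where "y = (\<lambda>i. \<Sum>j<n. B i j * d j)"
  define Y where "Y = (\<Sum>i<p. (y i)\<^sup>2)"
  have nn: "0 \<le> D" "0 \<le> Y" by (auto simp: D_def Y_def sum_nonneg)
  show ?thesis
  proof (cases "D = 0 \<or> Y = 0")
    case True
    then show ?thesis
    proof
      assume "D = 0"
      then have "d j = 0" if "j < n" for j using that by (simp add: D_def sum_nonneg_eq_0_iff)
      then show ?thesis by simp
    next
      assume "Y = 0"
      then show ?thesis by (simp add: Y_def y_def sum_nonneg)
    qed
  next
    case False
    then have pos: "0 < D" "0 < Y" using nn by auto
    have "bilinear_form p n B (\<lambda>i. 1 / sqrt Y * y i) (\<lambda>j. 1 / sqrt D * d j) \<le> 2 * t"
    proof (rule bilinear_form_net_le[OF net])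
      show "(\<Sum>i<p. (1 / sqrt Y * y i)\<^sup>2) \<le> 1" "(\<Sum>j<n. (1 / sqrt D * d j)\<^sup>2) \<le> 1"
        using pos unfolding power_mult_distrib sum_distrib_left[symmetric] Y_def[symmetric] D_def[symmetric]
        by (auto simp: power_divide)
    qed
    moreover have "bilinear_form p n B y d = Y"
      by (simp add: bilinear_form_def Y_def y_def sum_distrib_left power2_eq_square mult_ac)
    ultimately have "Y / (sqrt Y * sqrt D) \<le> 2 * t" unfolding bilinear_form_simps by (simp add: mult_ac)
    then have "Y \<le> 2 * t * (sqrt Y * sqrt D)" using pos by (simp add: field_simps)
    then have "sqrt Y * sqrt Y \<le> (2 * t * sqrt D) * sqrt Y" using pos by (simp add: mult_ac)
    then have "sqrt Y \<le> 2 * t * sqrt D" using pos by (subst (asm) mult_le_cancel_right) auto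
    then have "(sqrt Y)\<^sup>2 \<le> (2 * t * sqrt D)\<^sup>2" using pos by (intro power_mono) auto
    then show ?thesis using pos by (simp add: power_mult_distrib Y_def[symmetric] D_def[symmetric] y_def[symmetric])
      (simp add: Y_def D_def y_def)
  qed
qed

text \<open>With row i frozen, the exponent is linear in the other rows, and its variance is the sum
  of the squared coefficients times the squared length of row i over n. The indicator bounds that
  ratio by C.\<close>

lemma nn_integral_row_exp_le:
  fixes C :: real
  assumes i: "i < p" and n: "0 < n" and C: "0 \<le> C"
  shows "(\<integral>\<^sup>+x. indicator {x. (\<Sum>l<n. (x (i, l))\<^sup>2) \<le> C * n} x
      * ennreal (exp (\<Sum>i'\<in>{..<p} - {i}. \<sigma> i' * gram n x i i')) \<partial>gauss_matrix p n)
    \<le> ennreal (exp (C * (\<Sum>i'\<in>{..<p} - {i}. (\<sigma> i')\<^sup>2) / 2))"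
proof -
  define A where "A = {i} \<times> {..<n}"
  define B where "B = ({..<p} - {i}) \<times> {..<n}"
  have AB: "A \<inter> B = {}" "finite A" "finite B" "{..<p} \<times> {..<n} = A \<union> B"
    using i by (auto simp: A_def B_def)
  define f where "f = (\<lambda>x. indicator {x. (\<Sum>l<n. (x (i, l))\<^sup>2) \<le> C * n} x
      * ennreal (exp (\<Sum>i'\<in>{..<p} - {i}. \<sigma> i' * gram n x i i')))"
  have f: "f \<in> borel_measurable (gauss_matrix p n)"
  proof -
    note measurable_row_indicator[OF i]
    moreover have "(\<lambda>x. \<Sum>i'\<in>{..<p} - {i}. \<sigma> i' * gram n x i i') \<in> borel_measurable (gauss_matrix p n)"
      using i by (intro borel_measurable_sum borel_measurable_times measurable_gram borel_measurable_const) auto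
    ultimately show ?thesis unfolding f_def by measurable
  qed
  have "(\<integral>\<^sup>+x. f x \<partial>gauss_matrix p n) = (\<integral>\<^sup>+x. (\<integral>\<^sup>+y. f (merge A B (x, y)) \<partial>gauss B) \<partial>gauss A)"
    using gauss1_prod.product_nn_integral_fold[OF AB(1-3), of f] f unfolding gauss_def AB(4) by simp
  also have "\<dots> \<le> (\<integral>\<^sup>+x. ennreal (exp (C * (\<Sum>i'\<in>{..<p} - {i}. (\<sigma> i')\<^sup>2) / 2)) \<partial>gauss A)"
  proof (intro nn_integral_mono)
    fix x :: "nat \<times> nat \<Rightarrow> real"
    have mA: "merge A B (x, y) (i, l) = x (i, l)" if "l < n" for y l using that by (simp add: merge_def A_def)
    have mB: "merge A B (x, y) (i', l) = y (i', l)" if "l < n" "i' \<in> {..<p} - {i}" for y l i' using that by (auto simp: merge_def A_def B_def)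
    show "(\<integral>\<^sup>+y. f (merge A B (x, y)) \<partial>gauss B) \<le> ennreal (exp (C * (\<Sum>i'\<in>{..<p} - {i}. (\<sigma> i')\<^sup>2) / 2))"
    proof (cases "(\<Sum>l<n. (x (i, l))\<^sup>2) \<le> C * n")
      case False
      then show ?thesis by (simp add: f_def mA)
    next
      case True
      define c where "c = (\<lambda>k. \<sigma> (fst k) * x (i, snd k) / sqrt (real n))"
      have "f (merge A B (x, y)) = ennreal (exp (\<Sum>k\<in>B. c k * y k))" for y
      proof -
        have "(\<Sum>i'\<in>{..<p} - {i}. \<sigma> i' * gram n (merge A B (x, y)) i i') = (\<Sum>i'\<in>{..<p} - {i}. \<Sum>l<n. c (i', l) * y (i', l))"
          unfolding gram_def c_def by (intro sum.cong refl) (simp add: mA mB sum_distrib_left sum_divide_distrib mult_ac)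
        also have "\<dots> = (\<Sum>k\<in>B. c k * y k)" unfolding B_def sum.cartesian_product by (simp add: case_prod_beta')
        finally show ?thesis using True by (simp add: f_def mA)
      qed
      then have "(\<integral>\<^sup>+y. f (merge A B (x, y)) \<partial>gauss B) = ennreal (exp ((\<Sum>k\<in>B. (c k)\<^sup>2) / 2))"
        using AB by (simp add: nn_integral_gauss_exp_linear)
      also have "(\<Sum>k\<in>B. (c k)\<^sup>2) = (\<Sum>i'\<in>{..<p} - {i}. (\<sigma> i')\<^sup>2) * ((\<Sum>l<n. (x (i, l))\<^sup>2) / n)"
        unfolding sum_divide_distrib sum_product sum.cartesian_product B_def
        using n by (simp add: c_def case_prod_beta' power_mult_distrib power_divide)
      also have "ennreal (exp ((\<Sum>i'\<in>{..<p} - {i}. (\<sigma> i')\<^sup>2) * ((\<Sum>l<n. (x (i, l))\<^sup>2) / n) / 2))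
          \<le> ennreal (exp ((\<Sum>i'\<in>{..<p} - {i}. (\<sigma> i')\<^sup>2) * C / 2))"
      proof -
        have "(\<Sum>l<n. (x (i, l))\<^sup>2) / n \<le> C" using True n by (simp add: divide_le_eq)
        then have "(\<Sum>i'\<in>{..<p} - {i}. (\<sigma> i')\<^sup>2) * ((\<Sum>l<n. (x (i, l))\<^sup>2) / n) \<le> (\<Sum>i'\<in>{..<p} - {i}. (\<sigma> i')\<^sup>2) * C"
          by (intro mult_left_mono sum_nonneg) auto
        then show ?thesis by (intro ennreal_leI) simp
      qed
      finally show ?thesis by (simp add: mult.commute)
    qed
  qed
  also have "\<dots> = ennreal (exp (C * (\<Sum>i'\<in>{..<p} - {i}. (\<sigma> i')\<^sup>2) / 2))"
    by (simp add: gauss.emeasure_space_1)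
  finally show ?thesis unfolding f_def .
qed

text \<open>
  Given row \<open>i\<close>, the other entries of row \<open>i\<close> of the Gram matrix are independent; instead of using this, expand
  \<open>\<Prod>i'. 1 + e [T < \<bar>gram i i'\<bar>]\<close> into exponentials of signed sums, which are again linear in the remaining rows.
\<close>

lemma large_count_tail:
  fixes C T m :: real
  assumes i: "i < p" and n: "0 < n" and C: "0 < C" and T: "0 \<le> T"
  shows "measure (gauss_matrix p n) {x \<in> space (gauss_matrix p n). (\<Sum>l<n. (x (i, l))\<^sup>2) \<le> C * n \<and> m < real (large_count p n T x i)}
    \<le> exp (6 * p * exp (- (T\<^sup>2 / (2 * C))) - m)"
proof -
  \<comment> \<open>The minimiser of C s^2 / 2 - s T.\<close>
  define s where "s = T / C"
  define S where "S = {..<p} - {i}"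
  define w where "w = (\<lambda>\<sigma>::real. if \<sigma> = 0 then 1 else exp (1 - s * T))"
  define ok :: "(nat \<times> nat \<Rightarrow> real) set" where "ok = {x. (\<Sum>l<n. (x (i, l))\<^sup>2) \<le> C * n}"
  define \<Sigma> where "\<Sigma> = PiE S (\<lambda>_. {-1, 0, 1 :: real})"
  have s: "0 \<le> s" using C T by (simp add: s_def)
  have fS: "finite S" by (simp add: S_def)
  have w0: "0 \<le> w \<sigma>" for \<sigma> by (simp add: w_def)
  have meas: "Measurable.pred (gauss_matrix p n) (\<lambda>x. (\<Sum>l<n. (x (i, l))\<^sup>2) \<le> C * n \<and> m < real (large_count p n T x i))"
    unfolding pred_def using i
    by (intro sets.sets_Collect_conj borel_measurable_le borel_measurable_less borel_measurable_const measurable_row_norm measurable_large_count)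
  let ?f = "\<lambda>x. ennreal (exp (- m)) * (\<Sum>\<sigma>\<in>\<Sigma>. ennreal (\<Prod>i'\<in>S. w (\<sigma> i')) * (indicator ok x * ennreal (exp (\<Sum>i'\<in>S. s * \<sigma> i' * gram n x i i'))))"
  have one: "1 \<le> ?f x" if "(\<Sum>l<n. (x (i, l))\<^sup>2) \<le> C * n \<and> m < real (large_count p n T x i)" for x :: "nat \<times> nat \<Rightarrow> real"
  proof -
    have ok: "x \<in> ok" using that by (simp add: ok_def)
    \<comment> \<open>If T < \<bar>a\<bar>, the sign with \<sigma> a > 0 alone contributes at least
      exp 1; otherwise the term \<sigma> = 0 already gives 1.\<close>
    have fac: "exp (if T < \<bar>a\<bar> then 1 else 0) \<le> (\<Sum>\<sigma>\<in>{-1, 0, 1}. w \<sigma> * exp (s * \<sigma> * a))" for a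
    proof -
      have "exp 1 \<le> exp (1 - s * T) * exp (s * \<bar>a\<bar>)" if "T < \<bar>a\<bar>"
        using that s by (simp add: exp_add[symmetric] mult_left_mono)
      moreover have "exp (1 - s * T) * exp (s * \<bar>a\<bar>) \<le> exp (1 - s * T) * exp (s * a) + exp (1 - s * T) * exp (- (s * a))"
        by (auto simp: abs_if)
      ultimately show ?thesis by (auto simp: w_def add_nonneg_nonneg)
    qed
    have "1 \<le> exp (- m) * exp (real (large_count p n T x i))" using that by (simp add: exp_add[symmetric])
    also have "exp (real (large_count p n T x i)) = (\<Prod>i'\<in>S. exp (if T < \<bar>gram n x i i'\<bar> then 1 else 0))"
      unfolding large_count_eq_sum S_def by (simp add: exp_sum)
    also have "\<dots> \<le> (\<Prod>i'\<in>S. \<Sum>\<sigma>\<in>{-1, 0, 1}. w \<sigma> * exp (s * \<sigma> * gram n x i i'))"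
      by (intro prod_mono) (use fac in auto)
    also have "\<dots> = (\<Sum>\<sigma>\<in>\<Sigma>. \<Prod>i'\<in>S. w (\<sigma> i') * exp (s * \<sigma> i' * gram n x i i'))"
      unfolding \<Sigma>_def using fS by (subst prod_sum_PiE) auto
    finally have "1 \<le> exp (- m) * (\<Sum>\<sigma>\<in>\<Sigma>. (\<Prod>i'\<in>S. w (\<sigma> i')) * exp (\<Sum>i'\<in>S. s * \<sigma> i' * gram n x i i'))"
      using fS by (simp add: prod.distrib exp_sum mult_left_mono)
    then have "ennreal 1 \<le> ennreal (exp (- m) * (\<Sum>\<sigma>\<in>\<Sigma>. (\<Prod>i'\<in>S. w (\<sigma> i')) * exp (\<Sum>i'\<in>S. s * \<sigma> i' * gram n x i i')))"
      by (rule ennreal_leI)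
    also have "\<dots> = ?f x" using ok w0
      by (simp add: ennreal_mult' sum_nonneg prod_nonneg sum_ennreal[symmetric])
    finally show ?thesis by simp
  qed
  have row: "(\<integral>\<^sup>+x. indicator ok x * ennreal (exp (\<Sum>i'\<in>S. s * \<sigma> i' * gram n x i i')) \<partial>gauss_matrix p n)
      \<le> ennreal (exp (C * (\<Sum>i'\<in>S. (s * \<sigma> i')\<^sup>2) / 2))" for \<sigma>
    unfolding ok_def S_def using nn_integral_row_exp_le[OF i n, of C "\<lambda>i'. s * \<sigma> i'"] C by simp
  have okm: "(\<lambda>x. indicator ok x :: ennreal) \<in> borel_measurable (gauss_matrix p n)"
    unfolding ok_def using i by (intro measurable_row_indicator)
  have Em: "(\<lambda>x. ennreal (exp (\<Sum>i'\<in>S. s * \<sigma> i' * gram n x i i'))) \<in> borel_measurable (gauss_matrix p n)" for \<sigma>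
  proof -
    have m: "(\<lambda>x. \<Sum>i'\<in>S. s * \<sigma> i' * gram n x i i') \<in> borel_measurable (gauss_matrix p n)"
      unfolding S_def using i by (intro borel_measurable_sum borel_measurable_times measurable_gram borel_measurable_const) auto
    have "(\<lambda>y. ennreal (exp y)) \<in> borel_measurable borel" by measurable
    from measurable_compose[OF m this] show ?thesis .
  qed
  have "(\<integral>\<^sup>+x. ?f x \<partial>gauss_matrix p n) = ennreal (exp (- m)) * (\<Sum>\<sigma>\<in>\<Sigma>. ennreal (\<Prod>i'\<in>S. w (\<sigma> i')) *
      (\<integral>\<^sup>+x. indicator ok x * ennreal (exp (\<Sum>i'\<in>S. s * \<sigma> i' * gram n x i i')) \<partial>gauss_matrix p n))"
  proof -
    define g where "g = (\<lambda>\<sigma> x. indicator ok x * ennreal (exp (\<Sum>i'\<in>S. s * \<sigma> i' * gram n x i i')))"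
    have g [measurable]: "g \<sigma> \<in> borel_measurable (gauss_matrix p n)" for \<sigma>
      unfolding g_def by (rule borel_measurable_times_ennreal[OF okm Em])
    have g_app: "g \<sigma> x = indicator ok x * ennreal (exp (\<Sum>i'\<in>S. s * \<sigma> i' * gram n x i i'))" for \<sigma> x
      by (simp add: g_def)
    show ?thesis
      by (fold g_app) (simp add: nn_integral_cmult nn_integral_sum)
  qed
  also have "\<dots> \<le> ennreal (exp (- m)) * (\<Sum>\<sigma>\<in>\<Sigma>. ennreal (\<Prod>i'\<in>S. w (\<sigma> i')) * ennreal (exp (C * (\<Sum>i'\<in>S. (s * \<sigma> i')\<^sup>2) / 2)))"
    by (intro mult_left_mono sum_mono row) auto
  also have "\<dots> = ennreal (exp (- m) * (\<Sum>\<sigma>\<in>\<Sigma>. \<Prod>i'\<in>S. w (\<sigma> i') * exp (C * (s * \<sigma> i')\<^sup>2 / 2)))"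
    using fS w0 by (simp add: ennreal_mult' sum_nonneg prod_nonneg sum_ennreal[symmetric] prod.distrib exp_sum[symmetric] sum_distrib_left sum_divide_distrib)
  also have "(\<Sum>\<sigma>\<in>\<Sigma>. \<Prod>i'\<in>S. w (\<sigma> i') * exp (C * (s * \<sigma> i')\<^sup>2 / 2)) = (\<Prod>i'\<in>S. \<Sum>\<sigma>\<in>{-1, 0, 1}. w \<sigma> * exp (C * (s * \<sigma>)\<^sup>2 / 2))"
    unfolding \<Sigma>_def using fS by (subst prod_sum_PiE) auto
  \<comment> \<open>Each nonzero sign contributes exp(1 - s T + C s^2 / 2), which the choice of s
    makes e times the Gaussian tail.\<close>
  also have "(\<Sum>\<sigma>\<in>{-1, 0, 1}. w \<sigma> * exp (C * (s * \<sigma>)\<^sup>2 / 2)) = 1 + 2 * exp 1 * exp (- (T\<^sup>2 / (2 * C)))"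
  proof -
    have "1 - s * T + C * s\<^sup>2 / 2 = 1 + - (T\<^sup>2 / (2 * C))" using C by (simp add: s_def power2_eq_square field_simps)
    then have "exp (1 - s * T) * exp (C * s\<^sup>2 / 2) = exp 1 * exp (- (T\<^sup>2 / (2 * C)))" by (simp only: exp_add[symmetric])
    then show ?thesis by (simp add: w_def)
  qed
  also have "exp (- m) * (\<Prod>i'\<in>S. 1 + 2 * exp 1 * exp (- (T\<^sup>2 / (2 * C)))) \<le> exp (6 * p * exp (- (T\<^sup>2 / (2 * C))) - m)"
  proof -
    have "1 + 2 * exp 1 * exp (- (T\<^sup>2 / (2 * C))) \<le> 1 + 6 * exp (- (T\<^sup>2 / (2 * C)))"
      using exp_le by simp
    also have "\<dots> \<le> exp (6 * exp (- (T\<^sup>2 / (2 * C))))" by simp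
    finally have "(1 + 2 * exp 1 * exp (- (T\<^sup>2 / (2 * C)))) ^ card S \<le> exp (6 * exp (- (T\<^sup>2 / (2 * C)))) ^ card S"
      by (intro power_mono) (auto simp: add_nonneg_nonneg)
    also have "\<dots> = exp (6 * exp (- (T\<^sup>2 / (2 * C))) * card S)" by (simp add: exp_of_nat2_mult)
    also have "\<dots> \<le> exp (6 * exp (- (T\<^sup>2 / (2 * C))) * p)"
      using card_mono[of "{..<p}" S] by (simp add: S_def)
    finally have "exp (- m) * (1 + 2 * exp 1 * exp (- (T\<^sup>2 / (2 * C)))) ^ card S \<le> exp (- m) * exp (6 * exp (- (T\<^sup>2 / (2 * C))) * p)"
      by (rule mult_left_mono) simp
    also have "\<dots> = exp (6 * p * exp (- (T\<^sup>2 / (2 * C))) - m)" unfolding exp_add[symmetric] by (simp add: mult_ac)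
    finally show ?thesis by simp
  qed
  finally have int: "(\<integral>\<^sup>+x. ?f x \<partial>gauss_matrix p n) \<le> ennreal (exp (6 * p * exp (- (T\<^sup>2 / (2 * C))) - m))"
    by (simp add: ennreal_leI)
  show ?thesis
    using gauss.prob_le_of_nn_integral[OF meas one int] by simp
qed

text \<open>Two-sided Chernoff from \<open>nn_integral_row_exp_le\<close>, with a single nonzero
  coefficient, at i'.\<close>

lemma gram_tail:
  fixes C T :: real
  assumes i: "i < p" "i' < p" "i \<noteq> i'" and n: "0 < n" and C: "0 < C" and T: "0 \<le> T"
  shows "measure (gauss_matrix p n) {x \<in> space (gauss_matrix p n). (\<Sum>l<n. (x (i, l))\<^sup>2) \<le> C * n \<and> T < \<bar>gram n x i i'\<bar>}
    \<le> 2 * exp (- (T\<^sup>2 / (2 * C)))"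
proof (rule gauss.prob_le_of_nn_integral)
  define s where "s = T / C"
  define ok :: "(nat \<times> nat \<Rightarrow> real) set" where "ok = {x. (\<Sum>l<n. (x (i, l))\<^sup>2) \<le> C * n}"
  have s: "0 \<le> s" using C T by (simp add: s_def)
  show "Measurable.pred (gauss_matrix p n) (\<lambda>x. (\<Sum>l<n. (x (i, l))\<^sup>2) \<le> C * n \<and> T < \<bar>gram n x i i'\<bar>)"
    unfolding pred_def using i
    by (intro sets.sets_Collect_conj borel_measurable_le borel_measurable_less borel_measurable_const measurable_row_norm borel_measurable_abs measurable_gram)
  have okm: "(\<lambda>x. indicator ok x :: ennreal) \<in> borel_measurable (gauss_matrix p n)"
    unfolding ok_def using i by (intro measurable_row_indicator)
  let ?e = "\<lambda>c x. indicator ok x * ennreal (exp (c * gram n x i i'))"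
  let ?f = "\<lambda>x. ennreal (exp (- s * T)) * (?e s x + ?e (- s) x)"
  show "1 \<le> ?f x" if "(\<Sum>l<n. (x (i, l))\<^sup>2) \<le> C * n \<and> T < \<bar>gram n x i i'\<bar>" for x :: "nat \<times> nat \<Rightarrow> real"
  proof -
    define a where "a = gram n x i i'"
    have "1 \<le> exp (- s * T) * exp (s * \<bar>a\<bar>)" using that s by (simp add: a_def exp_add[symmetric] mult_left_mono)
    also have "\<dots> \<le> exp (- s * T) * (exp (s * a) + exp (- s * a))" by (intro mult_left_mono) (auto simp: abs_if)
    finally have "ennreal 1 \<le> ennreal (exp (- s * T) * (exp (s * a) + exp (- s * a)))" by (rule ennreal_leI)
    then show ?thesis using that by (simp add: ok_def a_def ennreal_mult' ennreal_plus)
  qed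
  have e: "(\<integral>\<^sup>+x. ?e c x \<partial>gauss_matrix p n) \<le> ennreal (exp (C * c\<^sup>2 / 2))" for c :: real
  proof -
    have "(\<Sum>k\<in>{..<p} - {i}. (if k = i' then c else 0) * g k) = c * g i'" for g :: "nat \<Rightarrow> real"
      using i by (subst sum.remove[of _ i']) (auto intro!: sum.neutral)
    moreover have "(\<Sum>k\<in>{..<p} - {i}. (if k = i' then c else 0)\<^sup>2) = c\<^sup>2"
      using i by (subst sum.remove[of _ i']) (auto intro!: sum.neutral)
    ultimately show ?thesis
      using nn_integral_row_exp_le[OF i(1) n, of C "\<lambda>k. if k = i' then c else 0"] C by (simp add: ok_def)
  qed
  note gm = measurable_gram[OF i(1,2)]
  have "(\<integral>\<^sup>+x. ?f x \<partial>gauss_matrix p n) = ennreal (exp (- s * T)) * ((\<integral>\<^sup>+x. ?e s x \<partial>gauss_matrix p n) + (\<integral>\<^sup>+x. ?e (- s) x \<partial>gauss_matrix p n))"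
    using okm gm by (simp add: nn_integral_cmult nn_integral_add)
  also have "\<dots> \<le> ennreal (exp (- s * T)) * (ennreal (exp (C * s\<^sup>2 / 2)) + ennreal (exp (C * (- s)\<^sup>2 / 2)))"
    by (intro mult_left_mono add_mono e) auto
  also have "\<dots> = ennreal (2 * (exp (- s * T) * exp (C * s\<^sup>2 / 2)))"
    by (simp add: ennreal_mult'[symmetric] ennreal_plus[symmetric] algebra_simps del: ennreal_plus)
  also have "exp (- s * T) * exp (C * s\<^sup>2 / 2) = exp (- (T\<^sup>2 / (2 * C)))"
    using C by (simp add: exp_add[symmetric] s_def power2_eq_square field_simps flip: exp_add)
  finally show "(\<integral>\<^sup>+x. ?f x \<partial>gauss_matrix p n) \<le> ennreal (2 * exp (- (T\<^sup>2 / (2 * C))))" .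
qed simp

section \<open>Bands of the kernel\<close>

lemma admissible_kernel_increment:
  assumes k: "admissible_kernel A \<beta> k" and pos: "0 \<le> A" "0 \<le> \<beta>" and ab: "a \<le> b" and c: "\<And>x. x \<in> {a..b} \<Longrightarrow> \<bar>x\<bar> \<le> c"
  shows "\<bar>k b - k a\<bar> \<le> A * exp (\<beta> * c) * (b - a)"
proof -
  \<comment> \<open>The derivative bound speaks only of points of differentiability, so the
    integrand is set to 0 on the remaining null set; this leaves the integral unchanged.\<close>
  define D where "D = (\<lambda>x. if k differentiable (at x) then deriv k x else 0)"
  have int: "(deriv k has_integral (k b - k a)) {a..b}" using k ab by (simp add: admissible_kernel_def)
  have "AE x in lborel. k differentiable (at x)" using k by (simp add: admissible_kernel_def)
  then obtain N where N: "{x. \<not> k differentiable (at x)} \<subseteq> N" "N \<in> null_sets lborel"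
    by (auto elim!: AE_E simp: null_sets_def)
  then have "negligible N" by (metis negligible_iff_null_sets null_sets_completionI)
  then have neg: "negligible {x. \<not> k differentiable (at x)}" using N(1) negligible_subset by blast
  have "(D has_integral (k b - k a)) {a..b}"
    by (rule has_integral_spike[OF neg _ int]) (auto simp: D_def)
  moreover have "\<bar>D x\<bar> \<le> A * exp (\<beta> * c)" if "x \<in> {a..b}" for x
  proof -
    have "A * exp (\<beta> * \<bar>x\<bar>) \<le> A * exp (\<beta> * c)" using c[OF that] pos by (intro mult_left_mono) (auto intro: mult_left_mono)
    moreover have "k differentiable (at x) \<Longrightarrow> \<bar>deriv k x\<bar> \<le> A * exp (\<beta> * \<bar>x\<bar>)" using k by (simp add: admissible_kernel_def)
    ultimately show ?thesis using pos by (auto simp: D_def)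
  qed
  ultimately have "norm (k b - k a) \<le> A * exp (\<beta> * c) * measure lborel {a..b}"
    using pos by (intro has_integral_bound_real[where f = D]) auto
  then show ?thesis using ab by simp
qed

text \<open>The increment of \<open>k\<close> across the part of [j, j + 1] below x, plus its mirror
  image. The clamps freeze the function beyond j + 1, so only the growth of \<open>k\<close> up to
  there enters its constants.\<close>

definition band :: "(real \<Rightarrow> real) \<Rightarrow> nat \<Rightarrow> real \<Rightarrow> real" where
  "band k j x = (k (max (real j) (min x (real j + 1))) - k (real j)) + (k (min (- real j) (max x (- real j - 1))) - k (- real j))"

lemma band_eq_0: "\<bar>x\<bar> \<le> real j \<Longrightarrow> band k j x = 0"
  by (auto simp: band_def max_def min_def abs_le_iff)

lemma band_minus:
  assumes "\<And>x. k (- x) = - k x"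
  shows "band k j (- x) = - band k j x"
proof -
  have "k (max (real j) (min (- x) (real j + 1))) = - k (min (- real j) (max x (- real j - 1)))"
    by (subst assms[symmetric]) (auto simp: max_def min_def intro!: arg_cong[where f=k])
  moreover have "k (min (- real j) (max (- x) (- real j - 1))) = - k (max (real j) (min x (real j + 1)))"
    by (subst assms[symmetric]) (auto simp: max_def min_def intro!: arg_cong[where f=k])
  ultimately show ?thesis using assms[of "real j"] by (simp add: band_def)
qed

text \<open>Clamping is 1-Lipschitz; the factor 2 comes from adding the estimates for the two
  clamped arguments.\<close>

lemma band_lipschitz:
  assumes k: "admissible_kernel A \<beta> k" and pos: "0 \<le> A" "0 \<le> \<beta>"
  shows "\<bar>band k j x - band k j y\<bar> \<le> 2 * A * exp (\<beta> * (real j + 1)) * \<bar>x - y\<bar>"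
proof -
  define L where "L = A * exp (\<beta> * (real j + 1))"
  have L: "0 \<le> L" using pos by (simp add: L_def)
  have inc: "\<bar>k b - k a\<bar> \<le> L * \<bar>b - a\<bar>" if "(a \<in> {real j..real j + 1} \<and> b \<in> {real j..real j + 1}) \<or> (a \<in> {- real j - 1..- real j} \<and> b \<in> {- real j - 1..- real j})" for a b
  proof (cases "a \<le> b")
    case True
    then show ?thesis using admissible_kernel_increment[OF k pos True, of "real j + 1"] that by (auto simp: L_def)
  next
    case False
    then show ?thesis using admissible_kernel_increment[OF k pos, of b a "real j + 1"] that by (auto simp: L_def abs_minus_commute)
  qed
  define r where "r = (\<lambda>x. max (real j) (min x (real j + 1)))"
  define l where "l = (\<lambda>x. min (- real j) (max x (- real j - 1)))"
  have "\<bar>k (r x) - k (r y)\<bar> \<le> L * \<bar>r x - r y\<bar>" by (intro inc) (auto simp: r_def)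
  moreover have "\<bar>k (l x) - k (l y)\<bar> \<le> L * \<bar>l x - l y\<bar>" by (intro inc) (auto simp: l_def)
  moreover have "L * \<bar>r x - r y\<bar> \<le> L * \<bar>x - y\<bar>" using L by (intro mult_left_mono) (auto simp: r_def max_def min_def)
  moreover have "L * \<bar>l x - l y\<bar> \<le> L * \<bar>x - y\<bar>" using L by (intro mult_left_mono) (auto simp: l_def max_def min_def)
  moreover have "band k j x - band k j y = (k (r x) - k (r y)) + (k (l x) - k (l y))" by (simp add: band_def r_def l_def)
  ultimately have "\<bar>band k j x - band k j y\<bar> \<le> 2 * (L * \<bar>x - y\<bar>)" by linarith
  then show ?thesis by (simp add: L_def mult.assoc)
qed

text \<open>Serves integrability over the good set. Only x clamped to [-j - 1, j + 1] matters, and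
  that point is within distance 1 of a zero of the band.\<close>

lemma band_bounded:
  assumes "admissible_kernel A \<beta> k" "0 \<le> A" "0 \<le> \<beta>"
  shows "\<bar>band k j x\<bar> \<le> 2 * A * exp (\<beta> * (real j + 1))"
proof -
  define y where "y = max (- real j - 1) (min x (real j + 1))"
  have eq: "band k j x = band k j y" by (auto simp: band_def y_def max_def min_def)
  define z where "z = max (- real j) (min y (real j))"
  have "band k j z = 0" by (rule band_eq_0) (auto simp: z_def abs_le_iff)
  then have "\<bar>band k j x\<bar> \<le> 2 * A * exp (\<beta> * (real j + 1)) * \<bar>y - z\<bar>"
    using band_lipschitz[OF assms, of j y z] eq by simp
  also have "\<dots> \<le> 2 * A * exp (\<beta> * (real j + 1)) * 1"
    using assms by (intro mult_left_mono) (auto simp: y_def z_def max_def min_def)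
  finally show ?thesis by simp
qed

lemma sum_band:
  assumes k: "\<And>x. k (- x) = - k x" and x: "\<bar>x\<bar> \<le> real J"
  shows "(\<Sum>j<J. band k j x) = k x"
proof -
  have 0: "k 0 = 0" using k[of 0] by simp
  \<comment> \<open>The telescoping claim is stated for all x, with x clamped to [-J, J], so that
    the induction goes through.\<close>
  have *: "(\<Sum>j<J. band k j x) = k (max 0 (min x (real J))) + k (min 0 (max x (- real J)))" for J
  proof (induction J)
    case 0
    then show ?case using \<open>k 0 = 0\<close> by (auto simp: max_def min_def)
  next
    case (Suc J)
    consider "x < - real J" | "\<bar>x\<bar> \<le> real J" | "real J < x" by linarith
    then show ?case
    proof cases
      case 1
      then have "band k J x = k (max x (- real (Suc J))) - k (- real J)" by (auto simp: band_def max_def min_def intro: arg_cong[where f=k])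
      then show ?thesis using 1 Suc 0 by (simp add: max_def min_def)
    next
      case 2
      then have "max 0 (min x (real (Suc J))) = max 0 (min x (real J))" "min 0 (max x (- real (Suc J))) = min 0 (max x (- real J))"
        by (auto simp: max_def min_def abs_le_iff)
      then show ?thesis using Suc band_eq_0[of x J k] 2 by simp
    next
      case 3
      then have "band k J x = k (min x (real (Suc J))) - k (real J)" by (auto simp: band_def max_def min_def intro: arg_cong[where f=k])
      then show ?thesis using 3 Suc 0 by (simp add: max_def min_def)
    qed
  qed
  have "max 0 (min x (real J)) = max 0 x" "min 0 (max x (- real J)) = min 0 x"
    using x by (auto simp: max_def min_def abs_le_iff)
  then show ?thesis using 0 unfolding * by (simp add: max_def min_def)
qed

lemma continuous_on_band:
  assumes "continuous_on UNIV k"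
  shows "continuous_on UNIV (band k j)"
proof -
  have c: "continuous_on UNIV (\<lambda>x. k (g x))" if "continuous_on UNIV g" for g :: "real \<Rightarrow> real"
    using continuous_on_compose2[OF assms that] by simp
  show ?thesis unfolding band_def[abs_def] by (intro continuous_intros c continuous_on_max continuous_on_min)
qed

section \<open>Concentration of bilinear forms\<close>

definition odd_kernel_matrix :: "(real \<Rightarrow> real) \<Rightarrow> nat \<Rightarrow> (nat \<times> nat \<Rightarrow> real) \<Rightarrow> nat \<Rightarrow> nat \<Rightarrow> real" where
  "odd_kernel_matrix h n x i i' = (if i = i' then 0 else h (gram n x i i') / sqrt (real n))"

text \<open>An operator norm bound tested on the finite nets: this keeps it measurable and invariant
  under row flips, and it yields norm at most 14 sqrt(p + n).\<close>

definition well_conditioned :: "nat \<Rightarrow> nat \<Rightarrow> (nat \<times> nat \<Rightarrow> real) \<Rightarrow> bool" where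
  "well_conditioned p n x \<longleftrightarrow> (\<forall>z\<in>net p. \<forall>w\<in>net n.
     bilinear_form p n (\<lambda>i j. x (i, j)) (net_vec p z) (net_vec n w) \<le> 7 * sqrt (p + n))"

text \<open>One set serves all bands, so its complement is paid for once and not per band.\<close>

definition good_set :: "nat \<Rightarrow> nat \<Rightarrow> nat \<Rightarrow> (nat \<Rightarrow> real) \<Rightarrow> (nat \<times> nat \<Rightarrow> real) set" where
  "good_set p n J m = {x \<in> space (gauss_matrix p n). well_conditioned p n x \<and>
     (\<forall>j<J. \<forall>i<p. real (large_count p n (real j) x i) \<le> m j)}"

lemma well_conditioned_op_norm_le:
  assumes "well_conditioned p n x"
  shows "(\<Sum>i<p. (\<Sum>j<n. x (i, j) * d j)\<^sup>2) \<le> (14 * sqrt (p + n))\<^sup>2 * (\<Sum>j<n. (d j)\<^sup>2)"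
  using op_norm_le[of p n "\<lambda>i j. x (i, j)" "7 * sqrt (p + n)" d] assms by (simp add: well_conditioned_def)

text \<open>Write x x^T - y y^T = (x - y) x^T + y (x - y)^T. The Hilbert-Schmidt norm of each
  product is at most R times that of x - y. Only the endpoints are used, never a segment between
  them.\<close>

lemma sum_gram_diff_le:
  assumes x: "\<And>d. (\<Sum>i<p. (\<Sum>j<n. x (i, j) * d j)\<^sup>2) \<le> R\<^sup>2 * (\<Sum>j<n. (d j)\<^sup>2)"
    and y: "\<And>d. (\<Sum>i<p. (\<Sum>j<n. y (i, j) * d j)\<^sup>2) \<le> R\<^sup>2 * (\<Sum>j<n. (d j)\<^sup>2)"
  shows "(\<Sum>i<p. \<Sum>i'<p. (gram n x i i' - gram n y i i')\<^sup>2) \<le> 4 * R\<^sup>2 * (\<Sum>k\<in>{..<p} \<times> {..<n}. (x k - y k)\<^sup>2) / n"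
proof -
  define D where "D = (\<Sum>k\<in>{..<p} \<times> {..<n}. (x k - y k)\<^sup>2)"
  define a where "a = (\<lambda>i i'. \<Sum>l<n. x (i', l) * (x (i, l) - y (i, l)))"
  define b where "b = (\<lambda>i i'. \<Sum>l<n. y (i, l) * (x (i', l) - y (i', l)))"
  have D: "D = (\<Sum>i<p. \<Sum>l<n. (x (i, l) - y (i, l))\<^sup>2)" by (simp add: D_def sum.cartesian_product case_prod_beta')
  have "(gram n x i i' - gram n y i i')\<^sup>2 \<le> (2 * (a i i')\<^sup>2 + 2 * (b i i')\<^sup>2) / n" for i i'
  proof -
    have "gram n x i i' - gram n y i i' = (a i i' + b i i') / sqrt n"
      by (simp add: gram_def a_def b_def diff_divide_distrib[symmetric] sum_subtractf[symmetric] sum.distrib[symmetric] algebra_simps)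
    then have "(gram n x i i' - gram n y i i')\<^sup>2 = (a i i' + b i i')\<^sup>2 / n" by (simp add: power_divide)
    also have "(a i i' + b i i')\<^sup>2 \<le> 2 * (a i i')\<^sup>2 + 2 * (b i i')\<^sup>2"
      using zero_le_power2[of "a i i' - b i i'"] by (simp add: power2_eq_square algebra_simps)
    finally show ?thesis by (simp add: divide_right_mono)
  qed
  then have "(\<Sum>i<p. \<Sum>i'<p. (gram n x i i' - gram n y i i')\<^sup>2) \<le> (\<Sum>i<p. \<Sum>i'<p. (2 * (a i i')\<^sup>2 + 2 * (b i i')\<^sup>2) / n)"
    by (intro sum_mono)
  also have "\<dots> = (2 * (\<Sum>i<p. \<Sum>i'<p. (a i i')\<^sup>2) + 2 * (\<Sum>i'<p. \<Sum>i<p. (b i i')\<^sup>2)) / n"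
    by (subst (2) sum.swap) (simp add: sum_divide_distrib[symmetric] sum.distrib sum_distrib_left)
  also have "\<dots> \<le> (2 * (R\<^sup>2 * D) + 2 * (R\<^sup>2 * D)) / n"
  proof (intro divide_right_mono add_mono mult_left_mono)
    show "(\<Sum>i<p. \<Sum>i'<p. (a i i')\<^sup>2) \<le> R\<^sup>2 * D"
      unfolding D sum_distrib_left[of "R\<^sup>2" _ "{..<p}"] a_def by (intro sum_mono x)
    show "(\<Sum>i'<p. \<Sum>i<p. (b i i')\<^sup>2) \<le> R\<^sup>2 * D"
      unfolding D sum_distrib_left[of "R\<^sup>2" _ "{..<p}"] b_def by (intro sum_mono y)
  qed auto
  finally show ?thesis by (simp add: D_def)
qed

text \<open>Entries whose Gram values are at most T in modulus for both matrices vanish for both.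
  Cauchy-Schwarz over the remaining pairs separates the mass \<open>S\<close> of the products u v
  from the change of the Gram matrix.\<close>

lemma bilinear_form_diff_le:
  fixes h :: "real \<Rightarrow> real"
  assumes x: "\<And>d. (\<Sum>i<p. (\<Sum>j<n. x (i, j) * d j)\<^sup>2) \<le> R\<^sup>2 * (\<Sum>j<n. (d j)\<^sup>2)"
    and y: "\<And>d. (\<Sum>i<p. (\<Sum>j<n. y (i, j) * d j)\<^sup>2) \<le> R\<^sup>2 * (\<Sum>j<n. (d j)\<^sup>2)"
    and h: "\<And>s t. \<bar>h s - h t\<bar> \<le> L * \<bar>s - t\<bar>" "\<And>s. \<bar>s\<bar> \<le> T \<Longrightarrow> h s = 0" and pos: "0 \<le> L" "0 \<le> R"
    and S: "(\<Sum>i<p. \<Sum>i'<p. if i \<noteq> i' \<and> (T < \<bar>gram n x i i'\<bar> \<or> T < \<bar>gram n y i i'\<bar>) then (u i * v i')\<^sup>2 else 0) \<le> S"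
  shows "bilinear_form p p (odd_kernel_matrix h n x) u v - bilinear_form p p (odd_kernel_matrix h n y) u v
     \<le> (2 * R * L * sqrt S / n) * sqrt (\<Sum>k\<in>{..<p} \<times> {..<n}. (x k - y k)\<^sup>2)"
proof -
  define P where "P = {..<p} \<times> {..<p}"
  define f where "f = (\<lambda>(i, i'). if i \<noteq> i' \<and> (T < \<bar>gram n x i i'\<bar> \<or> T < \<bar>gram n y i i'\<bar>) then u i * v i' else 0)"
  define g where "g = (\<lambda>(i, i'). gram n x i i' - gram n y i i')"
  define D where "D = (\<Sum>k\<in>{..<p} \<times> {..<n}. (x k - y k)\<^sup>2)"
  have "bilinear_form p p (odd_kernel_matrix h n x) u v - bilinear_form p p (odd_kernel_matrix h n y) u v
      = (\<Sum>i<p. \<Sum>i'<p. u i * v i' * (odd_kernel_matrix h n x i i' - odd_kernel_matrix h n y i i'))"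
    by (simp add: bilinear_form_def sum_subtractf[symmetric] algebra_simps)
  also have "\<dots> \<le> (\<Sum>i<p. \<Sum>i'<p. L / sqrt n * (\<bar>f (i, i')\<bar> * \<bar>g (i, i')\<bar>))"
  proof (intro sum_mono)
    fix i i'
    define s t where "s = gram n x i i'" and "t = gram n y i i'"
    show "u i * v i' * (odd_kernel_matrix h n x i i' - odd_kernel_matrix h n y i i') \<le> L / sqrt n * (\<bar>f (i, i')\<bar> * \<bar>g (i, i')\<bar>)"
    proof (cases "i \<noteq> i' \<and> (T < \<bar>s\<bar> \<or> T < \<bar>t\<bar>)")
      case True
      have "u i * v i' * (odd_kernel_matrix h n x i i' - odd_kernel_matrix h n y i i') = (u i * v i') * (h s - h t) / sqrt n"
        using True by (simp add: odd_kernel_matrix_def s_def t_def diff_divide_distrib right_diff_distrib mult.assoc)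
      also have "\<dots> \<le> \<bar>u i * v i'\<bar> * \<bar>h s - h t\<bar> / sqrt n"
        by (intro divide_right_mono) (auto simp: abs_mult[symmetric])
      also have "\<dots> \<le> \<bar>u i * v i'\<bar> * (L * \<bar>s - t\<bar>) / sqrt n"
        using h(1) by (intro divide_right_mono mult_left_mono) auto
      finally show ?thesis using True by (simp add: f_def g_def s_def t_def mult_ac)
    next
      case False
      then have "odd_kernel_matrix h n x i i' = odd_kernel_matrix h n y i i'"
        using h(2)[of s] h(2)[of t] by (auto simp: odd_kernel_matrix_def s_def t_def not_less)
      then show ?thesis using pos by simp
    qed
  qed
  also have "\<dots> = L / sqrt n * (\<Sum>k\<in>P. \<bar>f k\<bar> * \<bar>g k\<bar>)"
    unfolding P_def sum_distrib_left sum.cartesian_product by (intro sum.cong refl) auto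
  also have "\<dots> \<le> L / sqrt n * (L2_set f P * L2_set g P)"
    using pos by (intro mult_left_mono L2_set_mult_ineq) auto
  also have "\<dots> \<le> L / sqrt n * (sqrt S * sqrt (4 * R\<^sup>2 * D / n))"
  proof (intro mult_left_mono mult_mono)
    have "(\<Sum>k\<in>P. (f k)\<^sup>2) = (\<Sum>i<p. \<Sum>i'<p. if i \<noteq> i' \<and> (T < \<bar>gram n x i i'\<bar> \<or> T < \<bar>gram n y i i'\<bar>) then (u i * v i')\<^sup>2 else 0)"
      unfolding P_def sum.cartesian_product by (intro sum.cong refl) (auto simp: f_def)
    then show "L2_set f P \<le> sqrt S" using S by (simp add: L2_set_def)
    have "(\<Sum>k\<in>P. (g k)\<^sup>2) = (\<Sum>i<p. \<Sum>i'<p. (gram n x i i' - gram n y i i')\<^sup>2)"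
      unfolding P_def sum.cartesian_product by (intro sum.cong refl) (auto simp: g_def)
    then show "L2_set g P \<le> sqrt (4 * R\<^sup>2 * D / n)" using sum_gram_diff_le[OF x y] by (simp add: L2_set_def D_def)
    have "0 \<le> (\<Sum>i<p. \<Sum>i'<p. if i \<noteq> i' \<and> (T < \<bar>gram n x i i'\<bar> \<or> T < \<bar>gram n y i i'\<bar>) then (u i * v i')\<^sup>2 else 0)"
      by (intro sum_nonneg) auto
    then show "0 \<le> sqrt S" using S by simp
  qed (use pos in auto)
  also have "\<dots> = (2 * R * L * sqrt S / n) * sqrt D"
    using pos by (simp add: real_sqrt_mult real_sqrt_divide)
  finally show ?thesis unfolding D_def .
qed

section \<open>Row flips, and measurability of the good set\<close>

lemma flip_row_entry:
  assumes "i < p" "l < n"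
  shows "flip (\<lambda>k. fst k = a) ({..<p} \<times> {..<n}) x (i, l) = (if i = a then - x (i, l) else x (i, l))"
  using assms by (simp add: flip_def)

lemma gram_flip_row:
  assumes "i < p" "i' < p"
  shows "gram n (flip (\<lambda>k. fst k = a) ({..<p} \<times> {..<n}) x) i i'
    = (if i \<noteq> i' \<and> (i = a \<or> i' = a) then - gram n x i i' else gram n x i i')"
proof -
  have "(\<Sum>l<n. flip (\<lambda>k. fst k = a) ({..<p} \<times> {..<n}) x (i, l) * flip (\<lambda>k. fst k = a) ({..<p} \<times> {..<n}) x (i', l))
      = (\<Sum>l<n. if i \<noteq> i' \<and> (i = a \<or> i' = a) then - (x (i, l) * x (i', l)) else x (i, l) * x (i', l))"
    using assms by (intro sum.cong refl) (auto simp: flip_row_entry)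
  then show ?thesis by (simp add: gram_def sum_negf)
qed

lemma flip_in_space: "flip Q I x \<in> space (gauss I)"
  by (simp add: flip_def space_gauss)

lemma flip_flip: "x \<in> space (gauss I) \<Longrightarrow> flip Q I (flip Q I x) = x"
  by (auto simp: flip_def space_gauss PiE_def extensional_def)

text \<open>The sign moves from row a of the matrix to entry a of the left net vector, and the net
  is closed under this change.\<close>

lemma well_conditioned_flip_row:
  assumes "well_conditioned p n x" "a < p"
  shows "well_conditioned p n (flip (\<lambda>k. fst k = a) ({..<p} \<times> {..<n}) x)"
  unfolding well_conditioned_def
proof (intro ballI)
  fix z w assume z: "z \<in> net p" and w: "w \<in> net n"
  define z' where "z' = z(a := - z a)"
  have "(\<Sum>i<p. (z' i)\<^sup>2) = (\<Sum>i<p. (z i)\<^sup>2)" by (rule sum.cong) (auto simp: z'_def)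
  then have "z' \<in> net p" using z assms(2) by (auto simp: z'_def net_def PiE_def Pi_def extensional_def)
  have "bilinear_form p n (\<lambda>i j. flip (\<lambda>k. fst k = a) ({..<p} \<times> {..<n}) x (i, j)) (net_vec p z) (net_vec n w)
      = bilinear_form p n (\<lambda>i j. x (i, j)) (net_vec p z') (net_vec n w)"
    unfolding bilinear_form_def by (intro sum.cong refl) (auto simp: flip_row_entry net_vec_def z'_def)
  then show "bilinear_form p n (\<lambda>i j. flip (\<lambda>k. fst k = a) ({..<p} \<times> {..<n}) x (i, j)) (net_vec p z) (net_vec n w) \<le> 7 * sqrt (p + n)"
    using assms(1) \<open>z' \<in> net p\<close> w by (simp add: well_conditioned_def)
qed

lemma large_count_flip_row:
  assumes "i < p"
  shows "large_count p n T (flip (\<lambda>k. fst k = a) ({..<p} \<times> {..<n}) x) i = large_count p n T x i"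
  unfolding large_count_def using assms
  by (intro arg_cong[where f = card] Collect_cong) (auto simp: gram_flip_row split: if_splits)

lemma good_set_flip_row:
  assumes a: "a < p" and x: "x \<in> space (gauss_matrix p n)"
  shows "flip (\<lambda>k. fst k = a) ({..<p} \<times> {..<n}) x \<in> good_set p n J m \<longleftrightarrow> x \<in> good_set p n J m"
proof -
  have "flip (\<lambda>k. fst k = a) ({..<p} \<times> {..<n}) x \<in> good_set p n J m" if "x \<in> good_set p n J m" for x
    using that well_conditioned_flip_row[OF _ a] by (auto simp: good_set_def flip_in_space large_count_flip_row)
  from this this[of "flip (\<lambda>k. fst k = a) ({..<p} \<times> {..<n}) x"] show ?thesis by (auto simp: flip_flip[OF x])
qed

lemma sets_good_set: "good_set p n J m \<in> sets (gauss_matrix p n)"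
proof -
  have "{x \<in> space (gauss_matrix p n). well_conditioned p n x} \<in> sets (gauss_matrix p n)"
    unfolding well_conditioned_def
    by (intro sets.sets_Collect_finite_All finite_net borel_measurable_le measurable_bilinear_form_entries borel_measurable_const)
  moreover have "{x \<in> space (gauss_matrix p n). \<forall>j<J. \<forall>i<p. real (large_count p n (real j) x i) \<le> m j} \<in> sets (gauss_matrix p n)"
  proof -
    have "{x \<in> space (gauss_matrix p n). \<forall>j\<in>{..<J}. \<forall>i\<in>{..<p}. real (large_count p n (real j) x i) \<le> m j} \<in> sets (gauss_matrix p n)"
      by (intro sets.sets_Collect_finite_All finite_lessThan borel_measurable_le measurable_large_count borel_measurable_const) auto
    then show ?thesis by (simp only: Ball_def lessThan_iff)
  qed
  ultimately show ?thesis unfolding good_set_def by - (rule sets.sets_Collect_conj)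
qed

lemma measurable_odd_kernel_matrix:
  assumes h: "h \<in> borel_measurable borel" and i: "i < p" "i' < p"
  shows "(\<lambda>x. odd_kernel_matrix h n x i i') \<in> borel_measurable (gauss_matrix p n)"
proof (cases "i = i'")
  case True
  then show ?thesis unfolding odd_kernel_matrix_def by (simp only: refl if_True borel_measurable_const)
next
  case False
  have "(\<lambda>x. h (gram n x i i')) \<in> borel_measurable (gauss_matrix p n)"
    using measurable_compose[OF measurable_gram[OF i] h] .
  then show ?thesis
    unfolding odd_kernel_matrix_def by (simp only: False if_False borel_measurable_divide borel_measurable_const)
qed

lemma measurable_odd_kernel_form:
  assumes "h \<in> borel_measurable borel"
  shows "(\<lambda>x. bilinear_form p p (odd_kernel_matrix h n x) u v) \<in> borel_measurable (gauss_matrix p n)"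
  unfolding bilinear_form_def
  by (intro borel_measurable_sum borel_measurable_times borel_measurable_const measurable_odd_kernel_matrix assms) auto

text \<open>On the good set the form has Lipschitz constant 2 R L sqrt S / n with R = 14 sqrt(p +
  n), by \<open>bilinear_form_diff_le\<close>, and mean zero by flipping rows. The deviation is
  measured in half that constant, whence the exponent t^2 / 16.\<close>

lemma good_set_concentration:
  fixes h :: "real \<Rightarrow> real"
  assumes h: "\<And>s t. \<bar>h s - h t\<bar> \<le> L * \<bar>s - t\<bar>" "\<And>s. \<bar>s\<bar> \<le> T \<Longrightarrow> h s = 0" "\<And>s. h (- s) = - h s"
      "\<And>s. \<bar>h s\<bar> \<le> B" "continuous_on UNIV h"
    and pos: "0 < L" "0 < p" "0 < n" "0 < S" "0 \<le> t"
    and S: "\<And>x y. x \<in> good_set p n J m \<Longrightarrow> y \<in> good_set p n J m \<Longrightarrow>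
      (\<Sum>i<p. \<Sum>i'<p. if i \<noteq> i' \<and> (T < \<bar>gram n x i i'\<bar> \<or> T < \<bar>gram n y i i'\<bar>) then (u i * v i')\<^sup>2 else 0) \<le> S"
  shows "measure (gauss_matrix p n) {x \<in> good_set p n J m. t * L * sqrt S * (14 * sqrt (p + n)) / n \<le> bilinear_form p p (odd_kernel_matrix h n x) u v}
     * measure (gauss_matrix p n) (good_set p n J m) \<le> exp (- (t\<^sup>2 / 16))"
proof -
  let ?M = "gauss_matrix p n"
  let ?G = "good_set p n J m"
  define R where "R = 14 * sqrt (p + n)"
  define F where "F = (\<lambda>x. bilinear_form p p (odd_kernel_matrix h n x) u v)"
  define \<Lambda> where "\<Lambda> = 2 * R * L * sqrt S / n"
  have R: "0 < R" using pos by (simp add: R_def)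
  have \<Lambda>: "0 < \<Lambda>" using R pos by (simp add: \<Lambda>_def)
  have hm: "h \<in> borel_measurable borel" using h(5) by (rule borel_measurable_continuous_onI)
  have Gs: "?G \<subseteq> space ?M" by (auto simp: good_set_def)
  note Km = measurable_odd_kernel_matrix[OF hm]
  have Bpos: "0 \<le> B" using h(4)[of 0] by simp
  have Kb: "\<bar>odd_kernel_matrix h n x i i'\<bar> \<le> B" for x i i'
  proof (cases "i = i'")
    case False
    have "\<bar>h (gram n x i i')\<bar> / sqrt n \<le> \<bar>h (gram n x i i')\<bar> / 1" using pos by (intro divide_left_mono) auto
    then show ?thesis using False h(4)[of "gram n x i i'"] by (simp add: odd_kernel_matrix_def)
  qed (simp add: odd_kernel_matrix_def Bpos)
  have Gm: "(\<lambda>x. indicator ?G x :: real) \<in> borel_measurable ?M" using sets_good_set by (rule borel_measurable_indicator)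
  have Gi: "integrable ?M (\<lambda>x. indicator ?G x * odd_kernel_matrix h n x i i')" if "i < p" "i' < p" for i i'
  proof (rule gauss.integrable_const_bound[where B = B])
    show "AE x in ?M. norm (indicator ?G x * odd_kernel_matrix h n x i i') \<le> B"
      using Kb Bpos by (auto simp: indicator_def)
    show "(\<lambda>x. indicator ?G x * odd_kernel_matrix h n x i i') \<in> borel_measurable ?M"
      using Gm Km[OF that] by (rule borel_measurable_times)
  qed
  \<comment> \<open>Flipping row i negates the off-diagonal Gram entry (i, i') and preserves the
    good set, so the integrand is odd; on the diagonal it is 0.\<close>
  have Gz: "(\<integral>x. indicator ?G x * odd_kernel_matrix h n x i i' \<partial>?M) = 0" if "i < p" "i' < p" for i i'
  proof (rule integral_gauss_flip_odd[where Q = "\<lambda>k. fst k = i"])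
    show "(\<lambda>x. indicator ?G x * odd_kernel_matrix h n x i i') \<in> borel_measurable ?M"
      using Gm Km[OF that] by (rule borel_measurable_times)
    show "indicator ?G (flip (\<lambda>k. fst k = i) ({..<p} \<times> {..<n}) x) * odd_kernel_matrix h n (flip (\<lambda>k. fst k = i) ({..<p} \<times> {..<n}) x) i i'
        = - (indicator ?G x * odd_kernel_matrix h n x i i')" if "x \<in> space ?M" for x
      using good_set_flip_row[OF \<open>i < p\<close> that, of J m] \<open>i < p\<close> \<open>i' < p\<close>
      by (auto simp: odd_kernel_matrix_def gram_flip_row h(3) indicator_def)
  qed simp
  have GF: "indicator ?G x * F x = (\<Sum>i<p. \<Sum>i'<p. (u i * v i') * (indicator ?G x * odd_kernel_matrix h n x i i'))" for x
    by (simp add: F_def bilinear_form_def sum_distrib_left mult_ac)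
  have "measure ?M {x \<in> ?G. t / 2 * \<Lambda> \<le> F x} * measure ?M ?G \<le> exp (- ((t / 2 * \<Lambda>)\<^sup>2 / (4 * \<Lambda>\<^sup>2)))"
  proof (rule gauss_concentration)
    show "F \<in> borel_measurable ?M"
      unfolding F_def by (rule measurable_odd_kernel_form[OF hm])
    show "integrable ?M (\<lambda>x. indicator ?G x * F x)"
      unfolding GF by (intro Bochner_Integration.integrable_sum integrable_mult_right Gi) auto
    show "(\<integral>x. indicator ?G x * F x \<partial>?M) = 0"
    proof -
      have "(\<integral>x. indicator ?G x * F x \<partial>?M)
          = (\<Sum>i<p. \<integral>x. (\<Sum>i'<p. (u i * v i') * (indicator ?G x * odd_kernel_matrix h n x i i')) \<partial>?M)"
        unfolding GF by (intro Bochner_Integration.integral_sum Bochner_Integration.integrable_sum integrable_mult_right Gi) auto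
      also have "\<dots> = (\<Sum>i<p. \<Sum>i'<p. \<integral>x. (u i * v i') * (indicator ?G x * odd_kernel_matrix h n x i i') \<partial>?M)"
        by (intro sum.cong refl Bochner_Integration.integral_sum integrable_mult_right Gi) auto
      also have "\<dots> = (\<Sum>i<p. \<Sum>i'<p. 0)"
        by (intro sum.cong refl) (simp only: integral_mult_right_zero Gz lessThan_iff mult_zero_right)
      finally show ?thesis by simp
    qed
    show "F x - F y \<le> \<Lambda> * sqrt (\<Sum>i\<in>{..<p} \<times> {..<n}. (x i - y i)\<^sup>2)" if "x \<in> ?G" "y \<in> ?G" for x y
      unfolding F_def \<Lambda>_def
    proof (rule bilinear_form_diff_le[OF _ _ h(1,2) _ _ S[OF that]])
      show "(\<Sum>i<p. (\<Sum>j<n. x (i, j) * d j)\<^sup>2) \<le> R\<^sup>2 * (\<Sum>j<n. (d j)\<^sup>2)" for d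
        using that unfolding R_def by (intro well_conditioned_op_norm_le) (simp add: good_set_def)
      show "(\<Sum>i<p. (\<Sum>j<n. y (i, j) * d j)\<^sup>2) \<le> R\<^sup>2 * (\<Sum>j<n. (d j)\<^sup>2)" for d
        using that unfolding R_def by (intro well_conditioned_op_norm_le) (simp add: good_set_def)
    qed (use pos R in auto)
  qed (use sets_good_set \<Lambda> pos in auto)
  also have "(t / 2 * \<Lambda>)\<^sup>2 / (4 * \<Lambda>\<^sup>2) = t\<^sup>2 / 16" using \<Lambda> by (simp add: power_mult_distrib power_divide)
  also have "t / 2 * \<Lambda> = t * L * sqrt S * (14 * sqrt (p + n)) / n" by (simp add: \<Lambda>_def R_def)
  finally show ?thesis unfolding F_def .
qed

lemma (in finite_measure) measure_UN_UN_le: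
  assumes fin: "finite Z" "finite W"
    and meas: "\<And>z w. z \<in> Z \<Longrightarrow> w \<in> W \<Longrightarrow> E z w \<in> sets M"
    and le: "\<And>z w. z \<in> Z \<Longrightarrow> w \<in> W \<Longrightarrow> measure M (E z w) * c \<le> b" and "0 \<le> c"
  shows "measure M (\<Union>z\<in>Z. \<Union>w\<in>W. E z w) * c \<le> real (card Z) * real (card W) * b"
proof -
  have "(\<Union>z\<in>Z. \<Union>w\<in>W. E z w) = (\<Union>k\<in>Z \<times> W. E (fst k) (snd k))" by force
  then have "measure M (\<Union>z\<in>Z. \<Union>w\<in>W. E z w) \<le> (\<Sum>k\<in>Z \<times> W. measure M (E (fst k) (snd k)))"
    using fin meas by (auto intro!: finite_measure_subadditive_finite)
  then have "measure M (\<Union>z\<in>Z. \<Union>w\<in>W. E z w) * c \<le> (\<Sum>k\<in>Z \<times> W. measure M (E (fst k) (snd k)) * c)"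
    using \<open>0 \<le> c\<close> by (simp add: sum_distrib_right[symmetric] mult_right_mono)
  also have "\<dots> \<le> (\<Sum>k\<in>Z \<times> W. b)" using le by (intro sum_mono) auto
  finally show ?thesis by (simp add: card_cartesian_product mult.assoc)
qed

section \<open>Light and heavy net vectors, and the bound for one band\<close>

lemma bilinear_form_cong:
  assumes "\<And>i. i < p \<Longrightarrow> u i = u' i" "\<And>j. j < n \<Longrightarrow> v j = v' j"
  shows "bilinear_form p n B u v = bilinear_form p n B u' v'"
  unfolding bilinear_form_def using assms by (intro sum.cong refl) auto

lemma large_pair_count_le:
  assumes "i < p" "real (large_count p n T x i) \<le> M" "real (large_count p n T y i) \<le> M"
  shows "(\<Sum>i'<p. if i \<noteq> i' \<and> (T < \<bar>gram n x i i'\<bar> \<or> T < \<bar>gram n y i i'\<bar>) then 1 else 0 :: real) \<le> 2 * M"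
proof -
  have "(\<Sum>i'<p. if i \<noteq> i' \<and> (T < \<bar>gram n x i i'\<bar> \<or> T < \<bar>gram n y i i'\<bar>) then 1 else 0 :: real)
      = (\<Sum>i'\<in>{..<p} - {i}. if T < \<bar>gram n x i i'\<bar> \<or> T < \<bar>gram n y i i'\<bar> then 1 else 0)"
    using assms(1) by (subst sum.remove[of _ i]) (auto intro!: sum.cong)
  also have "\<dots> \<le> (\<Sum>i'\<in>{..<p} - {i}. (if T < \<bar>gram n x i i'\<bar> then 1 else 0) + (if T < \<bar>gram n y i i'\<bar> then 1 else 0))"
    by (intro sum_mono) auto
  also have "\<dots> = real (large_count p n T x i) + real (large_count p n T y i)"
    by (simp add: large_count_eq_sum sum.distrib)
  finally show ?thesis using assms by simp
qed

text \<open>Row i meets at most 2 M active pairs, M for each of the two matrices, and each of them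
  weighs at most \<delta> times the square of u i.\<close>

lemma light_pair_sum_le:
  assumes M: "\<And>i. i < p \<Longrightarrow> real (large_count p n T x i) \<le> M" "\<And>i. i < p \<Longrightarrow> real (large_count p n T y i) \<le> M"
    and v: "\<And>i. i < p \<Longrightarrow> (v i)\<^sup>2 \<le> \<delta>" and u: "(\<Sum>i<p. (u i)\<^sup>2) \<le> 1" and \<delta>: "0 \<le> \<delta>" "0 \<le> M"
  shows "(\<Sum>i<p. \<Sum>i'<p. if i \<noteq> i' \<and> (T < \<bar>gram n x i i'\<bar> \<or> T < \<bar>gram n y i i'\<bar>) then (u i * v i')\<^sup>2 else 0) \<le> 2 * M * \<delta>"
proof -
  have "(\<Sum>i'<p. if i \<noteq> i' \<and> (T < \<bar>gram n x i i'\<bar> \<or> T < \<bar>gram n y i i'\<bar>) then (u i * v i')\<^sup>2 else 0) \<le> (u i)\<^sup>2 * (2 * M * \<delta>)"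
    if i: "i < p" for i
  proof -
    have "(\<Sum>i'<p. if i \<noteq> i' \<and> (T < \<bar>gram n x i i'\<bar> \<or> T < \<bar>gram n y i i'\<bar>) then (u i * v i')\<^sup>2 else 0)
       \<le> (\<Sum>i'<p. (u i)\<^sup>2 * \<delta> * (if i \<noteq> i' \<and> (T < \<bar>gram n x i i'\<bar> \<or> T < \<bar>gram n y i i'\<bar>) then 1 else 0))"
      using v by (intro sum_mono) (auto simp: power_mult_distrib intro!: mult_left_mono)
    also have "\<dots> = (u i)\<^sup>2 * \<delta> * (\<Sum>i'<p. (if i \<noteq> i' \<and> (T < \<bar>gram n x i i'\<bar> \<or> T < \<bar>gram n y i i'\<bar>) then 1 else 0))"
      by (simp only: sum_distrib_left)
    also have "\<dots> \<le> (u i)\<^sup>2 * \<delta> * (2 * M)"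
      using large_pair_count_le[OF i M(1)[OF i] M(2)[OF i]] \<delta> by (intro mult_left_mono) auto
    finally show ?thesis by (simp add: mult_ac)
  qed
  then have "(\<Sum>i<p. \<Sum>i'<p. if i \<noteq> i' \<and> (T < \<bar>gram n x i i'\<bar> \<or> T < \<bar>gram n y i i'\<bar>) then (u i * v i')\<^sup>2 else 0) \<le> (\<Sum>i<p. (u i)\<^sup>2 * (2 * M * \<delta>))"
    by (intro sum_mono) auto
  also have "\<dots> = (\<Sum>i<p. (u i)\<^sup>2) * (2 * M * \<delta>)" by (simp only: sum_distrib_right)
  also have "\<dots> \<le> 1 * (2 * M * \<delta>)" using u \<delta> by (intro mult_right_mono) auto
  finally show ?thesis by simp
qed

text \<open>Symmetry of the Gram matrix exchanges the roles of u and v, so it does not matter which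
  of them is light.\<close>

lemma pair_sum_swap:
  fixes u v :: "nat \<Rightarrow> real"
  shows
  "(\<Sum>i<p. \<Sum>i'<p. if i \<noteq> i' \<and> (T < \<bar>gram n x i i'\<bar> \<or> T < \<bar>gram n y i i'\<bar>) then (u i * v i')\<^sup>2 else 0)
    = (\<Sum>i<p. \<Sum>i'<p. if i \<noteq> i' \<and> (T < \<bar>gram n x i i'\<bar> \<or> T < \<bar>gram n y i i'\<bar>) then (v i * u i')\<^sup>2 else 0)"
  by (subst sum.swap) (auto intro!: sum.cong simp: gram_commute mult.commute)

lemma pair_sum_le_1:
  fixes u v :: "nat \<Rightarrow> real"
  assumes "(\<Sum>i<p. (u i)\<^sup>2) \<le> 1" "(\<Sum>i<p. (v i)\<^sup>2) \<le> 1"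
  shows "(\<Sum>i<p. \<Sum>i'<p. if Q i i' then (u i * v i')\<^sup>2 else 0) \<le> 1"
proof -
  have "(\<Sum>i<p. \<Sum>i'<p. if Q i i' then (u i * v i')\<^sup>2 else 0) \<le> (\<Sum>i<p. \<Sum>i'<p. (u i)\<^sup>2 * (v i')\<^sup>2)"
    by (intro sum_mono) (auto simp: power_mult_distrib)
  also have "\<dots> = (\<Sum>i<p. (u i)\<^sup>2) * (\<Sum>i<p. (v i)\<^sup>2)" by (simp add: sum_product)
  also have "\<dots> \<le> 1 * 1" using assms by (intro mult_mono) (auto simp: sum_nonneg)
  finally show ?thesis by simp
qed

text \<open>Since \<open>net_vec\<close> divides by 4 sqrt p, the integer threshold 4 / \<rho> is
  the entry size 1 / (\<rho> sqrt p).\<close>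

definition heavy_net :: "nat \<Rightarrow> real \<Rightarrow> (nat \<Rightarrow> int) set" where
  "heavy_net p \<rho> = {z \<in> net p. \<forall>i<p. z i = 0 \<or> 4 < \<bar>real_of_int (z i)\<bar> * \<rho>}"

definition light_net :: "nat \<Rightarrow> real \<Rightarrow> (nat \<Rightarrow> int) set" where
  "light_net p \<rho> = {z \<in> net p. \<forall>i<p. \<bar>real_of_int (z i)\<bar> * \<rho> \<le> 4}"

text \<open>The guard i < p leaves the default value outside the index range untouched, as
  \<open>PiE\<close> demands.\<close>

lemma net_zero_out:
  assumes "z \<in> net p"
  shows "(\<lambda>i. if i < p \<and> Q i then 0 else z i) \<in> net p"
proof -
  have "(\<Sum>i<p. (if i < p \<and> Q i then 0 else z i)\<^sup>2) \<le> (\<Sum>i<p. (z i)\<^sup>2)" by (intro sum_mono) auto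
  then show ?thesis using assms by (auto simp: net_def PiE_def Pi_def extensional_def)
qed

lemma net_split:
  assumes "z \<in> net p" "0 \<le> \<rho>"
  obtains y y' where "y \<in> heavy_net p \<rho>" "y' \<in> light_net p \<rho>" "\<And>i. i < p \<Longrightarrow> net_vec p z i = net_vec p y i + net_vec p y' i"
proof
  show "(\<lambda>i. if i < p \<and> \<not> 4 < \<bar>real_of_int (z i)\<bar> * \<rho> then 0 else z i) \<in> heavy_net p \<rho>"
    unfolding heavy_net_def using net_zero_out[OF assms(1)] by auto
  show "(\<lambda>i. if i < p \<and> 4 < \<bar>real_of_int (z i)\<bar> * \<rho> then 0 else z i) \<in> light_net p \<rho>"
    unfolding light_net_def using net_zero_out[OF assms(1)] by auto
qed (auto simp: net_vec_def)

lemma light_net_vec: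
  assumes "z \<in> light_net p \<rho>" "0 < \<rho>" "i < p"
  shows "(net_vec p z i)\<^sup>2 \<le> 1 / (\<rho>\<^sup>2 * p)"
proof -
  have "(\<bar>real_of_int (z i)\<bar> * \<rho>)\<^sup>2 \<le> 4\<^sup>2" using assms by (intro power_mono) (auto simp: light_net_def)
  then have "(real_of_int (z i))\<^sup>2 \<le> 16 / \<rho>\<^sup>2" using assms by (simp add: power_mult_distrib field_simps)
  then have "(real_of_int (z i))\<^sup>2 / (16 * p) \<le> 16 / \<rho>\<^sup>2 / (16 * p)" by (rule divide_right_mono) simp
  then show ?thesis by (simp add: net_vec_def power_divide power_mult_distrib)
qed

text \<open>Splitting z and then w leaves three forms: light with arbitrary, heavy with light, heavy
  with heavy; one of them must reach a third of the threshold. With a light vector the tail exp(-44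
  p) beats the pair count exp(36 p); for heavy pairs exp(-625 \<rho> p) beats exp(34 \<rho>
  p).\<close>

lemma kernel_level_bound:
  fixes h :: "real \<Rightarrow> real"
  assumes h: "\<And>s t. \<bar>h s - h t\<bar> \<le> L * \<bar>s - t\<bar>" "\<And>s. \<bar>s\<bar> \<le> real j \<Longrightarrow> h s = 0" "\<And>s. h (- s) = - h s"
      "\<And>s. \<bar>h s\<bar> \<le> B" "continuous_on UNIV h"
    and pos: "0 < L" "0 < p" "0 < n" and j: "j < J" and \<rho>: "0 < \<rho>" "\<rho> \<le> 1" and m: "m j = 7 * p * \<rho> ^ 3"
  shows "measure (gauss_matrix p n) {x \<in> good_set p n J m. \<exists>z\<in>net p. \<exists>w\<in>net p.
        300 * L * sqrt \<rho> * sqrt p * (14 * sqrt (p + n)) / n < bilinear_form p p (odd_kernel_matrix h n x) (net_vec p z) (net_vec p w)}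
     * measure (gauss_matrix p n) (good_set p n J m) \<le> 3 * exp (- \<rho> * p)"
proof -
  let ?M = "gauss_matrix p n"
  let ?G = "good_set p n J m"
  define c where "c = 100 * L * sqrt \<rho> * sqrt p * (14 * sqrt (p + n)) / n"
  define f where "f = (\<lambda>z w x. bilinear_form p p (odd_kernel_matrix h n x) (net_vec p z) (net_vec p w))"
  define E where "E = (\<lambda>z w. {x \<in> ?G. c \<le> f z w x})"
  have fm: "f z w \<in> borel_measurable ?M" for z w
  proof -
    have hm: "h \<in> borel_measurable borel" using h(5) by (rule borel_measurable_continuous_onI)
    show ?thesis unfolding f_def by (rule measurable_odd_kernel_form[OF hm])
  qed
  have Em: "E z w \<in> sets ?M" for z w
  proof -
    have "E z w = ?G \<inter> {x \<in> space ?M. c \<le> f z w x}" by (auto simp: E_def good_set_def)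
    then show ?thesis using sets.Int[OF sets_good_set borel_measurable_le[OF borel_measurable_const fm]] by (simp only:)
  qed
  have count: "real (large_count p n (real j) x i) \<le> m j" if "x \<in> ?G" "i < p" for x i
    using that j by (auto simp: good_set_def)
  have light: "measure ?M (E z w) * measure ?M ?G \<le> exp (- 44 * p)"
    if zw: "z \<in> net p" "w \<in> net p" "z \<in> light_net p \<rho> \<or> w \<in> light_net p \<rho>" for z w
  proof -
    define t where "t = 100 * sqrt p / sqrt 14"
    have tS: "t * L * sqrt (14 * \<rho>) * (14 * sqrt (p + n)) / n = c"
      by (simp add: t_def c_def real_sqrt_mult)
    \<comment> \<open>The row count 7 p \<rho>^3 meets the light entry bound 1 / (\<rho>^2 p),
      leaving one power of \<rho>.\<close>
    have eq: "2 * m j * (1 / (\<rho>\<^sup>2 * p)) = 14 * \<rho>"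
      using \<rho> pos by (simp add: m power2_eq_square power3_eq_cube)
    have S: "(\<Sum>i<p. \<Sum>i'<p. if i \<noteq> i' \<and> (real j < \<bar>gram n x i i'\<bar> \<or> real j < \<bar>gram n y i i'\<bar>) then (net_vec p z i * net_vec p w i')\<^sup>2 else 0) \<le> 14 * \<rho>"
      if xy: "x \<in> ?G" "y \<in> ?G" for x y
    proof (cases "w \<in> light_net p \<rho>")
      case True
      show ?thesis unfolding eq[symmetric]
        using \<rho> zw sum_net_vec_le[OF zw(1)] by (intro light_pair_sum_le count xy light_net_vec[OF True]) (auto simp: m)
    next
      case False
      then have l: "z \<in> light_net p \<rho>" using zw by auto
      show ?thesis unfolding eq[symmetric] pair_sum_swap[where u = "net_vec p z" and v = "net_vec p w"]
        using \<rho> zw sum_net_vec_le[OF zw(2)] by (intro light_pair_sum_le count xy light_net_vec[OF l]) (auto simp: m)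
    qed
    have "measure ?M (E z w) * measure ?M ?G \<le> exp (- (t\<^sup>2 / 16))"
      unfolding E_def f_def tS[symmetric]
      by (rule good_set_concentration[OF h pos _ _ S]) (use \<rho> in \<open>auto simp: t_def\<close>)
    also have "t\<^sup>2 / 16 = 10000 / 224 * p" by (simp add: t_def power_divide power_mult_distrib)
    also have "exp (- (10000 / 224 * real p)) \<le> exp (- 44 * p)" by simp
    finally show ?thesis .
  qed
  have heavy: "measure ?M (E z w) * measure ?M ?G \<le> exp (- 625 * \<rho> * p)" if zw: "z \<in> net p" "w \<in> net p" for z w
  proof -
    define t where "t = 100 * sqrt (\<rho> * p)"
    have tS: "t * L * sqrt 1 * (14 * sqrt (p + n)) / n = c"
      by (simp add: t_def c_def real_sqrt_mult)
    have "measure ?M (E z w) * measure ?M ?G \<le> exp (- (t\<^sup>2 / 16))"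
      unfolding E_def f_def tS[symmetric]
      by (rule good_set_concentration[OF h pos _ _ pair_sum_le_1]) (use \<rho> sum_net_vec_le zw in \<open>auto simp: t_def\<close>)
    also have "t\<^sup>2 / 16 = 625 * \<rho> * p" using \<rho> by (simp add: t_def power_mult_distrib)
    finally show ?thesis by simp
  qed
  have nets: "light_net p \<rho> \<subseteq> net p" "heavy_net p \<rho> \<subseteq> net p" by (auto simp: light_net_def heavy_net_def)
  then have fin: "finite (light_net p \<rho>)" "finite (heavy_net p \<rho>)" by (auto intro: finite_subset[OF _ finite_net])
  have cl: "real (card (light_net p \<rho>)) \<le> exp (18 * p)"
    using of_nat_mono[OF card_mono[OF finite_net nets(1)], where 'a = real] card_net_le[of p] by simp
  have ch: "real (card (heavy_net p \<rho>)) \<le> exp (17 * \<rho> * p)"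
    using card_heavy_net_le[OF \<rho>] by (simp add: heavy_net_def)
  define U1 where "U1 = (\<Union>z\<in>light_net p \<rho>. \<Union>w\<in>net p. E z w)"
  define U2 where "U2 = (\<Union>z\<in>net p. \<Union>w\<in>light_net p \<rho>. E z w)"
  define U3 where "U3 = (\<Union>z\<in>heavy_net p \<rho>. \<Union>w\<in>heavy_net p \<rho>. E z w)"
  have "exp (- \<rho> * p) \<ge> exp (- real p)" using \<rho> by (simp add: mult_left_le_one_le)
  have U1: "measure ?M U1 * measure ?M ?G \<le> exp (- \<rho> * p)"
  proof -
    have "measure ?M U1 * measure ?M ?G \<le> real (card (light_net p \<rho>)) * real (card (net p)) * exp (- 44 * p)"
      unfolding U1_def using nets by (intro gauss.measure_UN_UN_le fin finite_net Em light) auto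
    also have "\<dots> \<le> exp (18 * p) * exp (18 * p) * exp (- 44 * p)"
      using cl card_net_le[of p] by (intro mult_mono) auto
    also have "\<dots> \<le> exp (- real p)" by (simp add: exp_add[symmetric])
    finally show ?thesis using \<open>exp (- \<rho> * p) \<ge> exp (- real p)\<close> by (rule order_trans)
  qed
  have U2: "measure ?M U2 * measure ?M ?G \<le> exp (- \<rho> * p)"
  proof -
    have "measure ?M U2 * measure ?M ?G \<le> real (card (net p)) * real (card (light_net p \<rho>)) * exp (- 44 * p)"
      unfolding U2_def using nets by (intro gauss.measure_UN_UN_le fin finite_net Em light) auto
    also have "\<dots> \<le> exp (18 * p) * exp (18 * p) * exp (- 44 * p)"
      using cl card_net_le[of p] by (intro mult_mono) auto
    also have "\<dots> \<le> exp (- real p)" by (simp add: exp_add[symmetric])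
    finally show ?thesis using \<open>exp (- \<rho> * p) \<ge> exp (- real p)\<close> by (rule order_trans)
  qed
  have U3: "measure ?M U3 * measure ?M ?G \<le> exp (- \<rho> * p)"
  proof -
    have "measure ?M U3 * measure ?M ?G \<le> real (card (heavy_net p \<rho>)) * real (card (heavy_net p \<rho>)) * exp (- 625 * \<rho> * p)"
      unfolding U3_def using nets by (intro gauss.measure_UN_UN_le fin Em heavy) auto
    also have "\<dots> \<le> exp (17 * \<rho> * p) * exp (17 * \<rho> * p) * exp (- 625 * \<rho> * p)"
      using ch by (intro mult_mono) auto
    also have "\<dots> = exp (- 591 * (\<rho> * p))" by (simp add: exp_add[symmetric] algebra_simps)
    also have "\<dots> \<le> exp (- \<rho> * p)" using \<rho> by simp
    finally show ?thesis .
  qed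
  have Us: "U1 \<in> sets ?M" "U2 \<in> sets ?M" "U3 \<in> sets ?M"
    unfolding U1_def U2_def U3_def by (intro sets.finite_UN fin finite_net Em)+
  have sub: "{x \<in> ?G. \<exists>z\<in>net p. \<exists>w\<in>net p. 3 * c < f z w x} \<subseteq> U1 \<union> U2 \<union> U3"
  proof
    fix x assume "x \<in> {x \<in> ?G. \<exists>z\<in>net p. \<exists>w\<in>net p. 3 * c < f z w x}"
    then obtain z w where x: "x \<in> ?G" and z: "z \<in> net p" and w: "w \<in> net p" and lt: "3 * c < f z w x" by auto
    obtain y y' where y: "y \<in> heavy_net p \<rho>" "y' \<in> light_net p \<rho>" "\<And>i. i < p \<Longrightarrow> net_vec p z i = net_vec p y i + net_vec p y' i"
      using net_split[OF z, of \<rho>] \<rho> by auto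
    obtain q q' where q: "q \<in> heavy_net p \<rho>" "q' \<in> light_net p \<rho>" "\<And>i. i < p \<Longrightarrow> net_vec p w i = net_vec p q i + net_vec p q' i"
      using net_split[OF w, of \<rho>] \<rho> by auto
    have "f z w x = f y w x + f y' w x"
      unfolding f_def by (subst bilinear_form_cong[OF y(3) refl]) (auto simp: bilinear_form_simps)
    moreover have "f y w x = f y q x + f y q' x"
      unfolding f_def by (subst bilinear_form_cong[OF refl q(3)]) (auto simp: bilinear_form_simps)
    ultimately have "c \<le> f y' w x \<or> c \<le> f y q' x \<or> c \<le> f y q x" using lt by linarith
    then show "x \<in> U1 \<union> U2 \<union> U3"
      using x y q w nets by (auto simp: U1_def U2_def U3_def E_def)
  qed
  have "measure ?M {x \<in> ?G. \<exists>z\<in>net p. \<exists>w\<in>net p. 3 * c < f z w x} \<le> measure ?M (U1 \<union> U2 \<union> U3)"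
    using Us by (intro gauss.finite_measure_mono sub) auto
  also have "\<dots> \<le> measure ?M U1 + measure ?M U2 + measure ?M U3"
    using Us by (intro order_trans[OF measure_Un_le] add_right_mono measure_Un_le) auto
  finally have "measure ?M {x \<in> ?G. \<exists>z\<in>net p. \<exists>w\<in>net p. 3 * c < f z w x} * measure ?M ?G
      \<le> (measure ?M U1 + measure ?M U2 + measure ?M U3) * measure ?M ?G"
    by (rule mult_right_mono) simp
  also have "\<dots> \<le> 3 * exp (- \<rho> * p)" using U1 U2 U3 by (simp add: distrib_right)
  finally show ?thesis unfolding f_def c_def by simp
qed

section \<open>Summation over the bands\<close>

text \<open>Compare exp with a single term of its power series; this converts failure probabilities
  exp(-sqrt p) into powers of p.\<close>

lemma powr_mult_exp_sqrt_bounded: "\<exists>M>0. \<forall>p::nat. 1 \<le> p \<longrightarrow> real p powr a * exp (- sqrt p) \<le> M"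
proof (intro exI conjI allI impI)
  define N where "N = nat \<lceil>2 * a\<rceil>"
  show "0 < (fact N :: real)" by simp
  fix p :: nat assume p: "1 \<le> p"
  define y where "y = sqrt p"
  have y: "1 \<le> y" using p by (simp add: y_def)
  have "real p = y powr 2" using p by (simp add: y_def powr_numeral)
  then have "real p powr a = y powr (2 * a)" by (simp add: powr_powr)
  also have "\<dots> \<le> y powr N" using y by (intro powr_mono) (auto simp: N_def real_nat_ceiling_ge)
  also have "\<dots> = y ^ N" using y by (simp add: powr_realpow)
  also have "\<dots> \<le> fact N * exp y"
  proof -
    have "y ^ N / fact N \<le> (\<Sum>k<Suc N. y ^ k / fact k)"
      using y by (intro member_le_sum) auto
    also have "\<dots> \<le> exp y"
    proof -
      have "(\<lambda>k. y ^ k / fact k) sums exp y" using exp_converges[of y] by (simp add: divide_inverse mult.commute)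
      then show ?thesis using y by (intro sum_le_suminf[of _ "{..<Suc N}", THEN order_trans[OF _ eq_refl]]) (auto simp: sums_iff)
    qed
    finally show ?thesis by (simp add: field_simps)
  qed
  finally show "real p powr a * exp (- sqrt p) \<le> fact N" by (simp add: y_def exp_minus field_simps)
qed

definition level_rho :: "real \<Rightarrow> nat \<Rightarrow> nat \<Rightarrow> real" where
  "level_rho C p j = max (exp (- ((real j)\<^sup>2 / (6 * C)))) (real p powr (- (1 / 6)))"

text \<open>Chosen so that a Gram entry exceeds it with probability O(p powr (-(\<alpha> + 2))),
  which leaves p powr (-\<alpha>) after a union over at most p^2 pairs.\<close>

definition top_level :: "real \<Rightarrow> real \<Rightarrow> nat \<Rightarrow> nat" where
  "top_level C \<alpha> p = nat \<lceil>sqrt (2 * C * (\<alpha> + 2) * ln p)\<rceil>"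

lemma level_rho_bounds:
  assumes C: "0 < C" and p: "1 \<le> p"
  shows "0 < level_rho C p j" "level_rho C p j \<le> 1"
    and "exp (- ((real j)\<^sup>2 / (2 * C))) \<le> level_rho C p j ^ 3"
    and "sqrt p \<le> p * level_rho C p j ^ 3"
    and "sqrt p \<le> level_rho C p j * p"
    and "sqrt (level_rho C p j) \<le> exp (- ((real j)\<^sup>2 / (12 * C))) + real p powr (- (1 / 12))"
proof -
  let ?r = "level_rho C p j"
  show r: "0 < ?r" using p by (simp add: level_rho_def less_max_iff_disj)
  show r1: "?r \<le> 1" using p C by (simp add: level_rho_def powr_minus inverse_le_1_iff ge_one_powr_ge_zero)
  have "exp (- ((real j)\<^sup>2 / (6 * C))) ^ 3 \<le> ?r ^ 3" by (intro power_mono) (auto simp: level_rho_def)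
  also have "exp (- ((real j)\<^sup>2 / (6 * C))) ^ 3 = exp (- ((real j)\<^sup>2 / (2 * C)))"
    using C by (simp add: exp_of_nat_mult[symmetric] field_simps)
  finally show "exp (- ((real j)\<^sup>2 / (2 * C))) \<le> ?r ^ 3" .
  have "(real p powr (- (1 / 6))) ^ 3 \<le> ?r ^ 3" by (intro power_mono) (auto simp: level_rho_def)
  also have "(real p powr (- (1 / 6))) ^ 3 = real p powr (- (1 / 2))"
    using p by (simp add: powr_realpow[symmetric] powr_powr)
  finally have "real p * real p powr (- (1 / 2)) \<le> p * ?r ^ 3" by (intro mult_left_mono) auto
  moreover have "real p * real p powr (- (1 / 2)) = sqrt p"
    using p by (simp add: powr_half_sqrt[symmetric] powr_mult_base)
  ultimately show sp: "sqrt p \<le> p * ?r ^ 3" by simp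
  have "?r ^ 3 \<le> ?r ^ 1" using r r1 by (intro power_decreasing) auto
  then have "p * ?r ^ 3 \<le> p * ?r" by (intro mult_left_mono) auto
  then show "sqrt p \<le> ?r * p" using sp by (simp add: mult.commute)
  have "sqrt ?r = max (sqrt (exp (- ((real j)\<^sup>2 / (6 * C))))) (sqrt (real p powr (- (1 / 6))))"
    unfolding level_rho_def by (simp add: max_def)
  also have "sqrt (exp (- ((real j)\<^sup>2 / (6 * C)))) = exp (- ((real j)\<^sup>2 / (12 * C)))"
    by (rule real_sqrt_unique) (use C in \<open>auto simp: exp_of_nat_mult[symmetric] field_simps\<close>)
  also have "sqrt (real p powr (- (1 / 6))) = real p powr (- (1 / 12))"
    by (simp add: powr_half_sqrt[symmetric] powr_powr)
  finally show "sqrt ?r \<le> exp (- ((real j)\<^sup>2 / (12 * C))) + real p powr (- (1 / 12))"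
    by (simp add: max_def add_increasing add_increasing2)
qed

lemma top_level_ge:
  assumes "0 < C" "0 < \<alpha>" "1 \<le> p"
  shows "exp (- ((real (top_level C \<alpha> p))\<^sup>2 / (2 * C))) \<le> real p powr (- (\<alpha> + 2))"
proof -
  define Y where "Y = 2 * C * (\<alpha> + 2) * ln p"
  have Y: "0 \<le> Y" using assms by (simp add: Y_def)
  have "sqrt Y \<le> real (top_level C \<alpha> p)" unfolding top_level_def Y_def by (rule real_nat_ceiling_ge)
  then have "(sqrt Y)\<^sup>2 \<le> (real (top_level C \<alpha> p))\<^sup>2" using Y by (intro power_mono) auto
  then have "(\<alpha> + 2) * ln p \<le> (real (top_level C \<alpha> p))\<^sup>2 / (2 * C)" using Y assms by (simp add: Y_def field_simps)
  then have "exp (- ((real (top_level C \<alpha> p))\<^sup>2 / (2 * C))) \<le> exp (- ((\<alpha> + 2) * ln p))" by simp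
  also have "\<dots> = real p powr (- (\<alpha> + 2))" using assms by (simp add: powr_def algebra_simps)
  finally show ?thesis .
qed

lemma top_level_le:
  assumes "0 < C" "0 < \<alpha>" "1 \<le> p"
  shows "real (top_level C \<alpha> p) \<le> 1 + sqrt (2 * C * (\<alpha> + 2) * ln p)"
proof -
  define y where "y = sqrt (2 * C * (\<alpha> + 2) * ln p)"
  have "0 \<le> y" using assms by (simp add: y_def)
  then have "0 \<le> \<lceil>y\<rceil>" by (simp add: less_le_trans[of "-1" 0])
  then have "real (nat \<lceil>y\<rceil>) = real_of_int \<lceil>y\<rceil>" by simp
  also have "\<dots> \<le> 1 + y" by linarith
  finally show ?thesis by (simp add: top_level_def y_def)
qed

text \<open>A crude bound, sufficient where the number of bands is multiplied by exp(-sqrt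
  p).\<close>

lemma top_level_le_linear:
  assumes "0 < C" "0 < \<alpha>" "1 \<le> p"
  shows "real (top_level C \<alpha> p) \<le> (2 + 2 * C * (\<alpha> + 2)) * p"
proof -
  define Y where "Y = 2 * C * (\<alpha> + 2) * ln p"
  have Y: "0 \<le> Y" using assms by (simp add: Y_def)
  have "sqrt Y \<le> 1 + Y" using Y by (intro real_le_lsqrt) (auto simp: power2_eq_square algebra_simps)
  also have "Y \<le> 2 * C * (\<alpha> + 2) * p" unfolding Y_def using assms ln_bound[of "real p"] by (intro mult_left_mono) auto
  finally have "1 + sqrt Y \<le> 2 + 2 * C * (\<alpha> + 2) * p" by simp
  also have "\<dots> \<le> (2 + 2 * C * (\<alpha> + 2)) * p" using assms by (simp add: algebra_simps)
  finally show ?thesis using top_level_le[OF assms] by (simp add: Y_def)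
qed

lemma mult_le_square_add:
  fixes x y e :: real
  assumes "0 < e"
  shows "x * y \<le> y\<^sup>2 / (4 * e) + e * x\<^sup>2"
proof -
  have "0 \<le> (y - 2 * e * x)\<^sup>2 / (4 * e)" using assms by simp
  also have "\<dots> = y\<^sup>2 / (4 * e) + e * x\<^sup>2 - x * y" using assms by (simp add: power2_eq_square field_simps)
  finally show ?thesis by simp
qed

text \<open>Young's inequality absorbs the linear exponent into the Gaussian one for the first part
  of sqrt \<rho>. For the cutoff part, the number of bands is O(sqrt(ln p)), and Young's inequality
  trades it for (ln p) / 12, which the cutoff cancels exactly.\<close>

lemma level_sum_bounded:
  assumes C: "0 < C" and \<alpha>: "0 < \<alpha>" and \<beta>: "0 < \<beta>"
  shows "\<exists>K>0. \<forall>p\<ge>1. (\<Sum>j<top_level C \<alpha> p. exp (\<beta> * (real j + 1)) * sqrt (level_rho C p j)) \<le> K"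
proof (intro exI conjI allI impI)
  \<comment> \<open>Here \<beta> + 1 instead of \<beta> leaves a factor exp(-j) for a geometric
    series.\<close>
  define K1 where "K1 = 2 * exp (\<beta> + 3 * C * (\<beta> + 1)\<^sup>2)"
  \<comment> \<open>Here the extra 1 pays for the number J of summands, through J \<le> exp
    J.\<close>
  define K2 where "K2 = exp (\<beta> + 1 + 6 * C * (\<alpha> + 2) * (\<beta> + 1)\<^sup>2)"
  show "0 < K1 + K2" by (simp add: K1_def K2_def add_pos_pos)
  fix p :: nat assume p: "1 \<le> p"
  define J where "J = top_level C \<alpha> p"
  have "(\<Sum>j<J. exp (\<beta> * (real j + 1)) * sqrt (level_rho C p j))
      \<le> (\<Sum>j<J. exp (\<beta> * (real j + 1)) * exp (- ((real j)\<^sup>2 / (12 * C))) + exp (\<beta> * (real j + 1)) * real p powr (- (1 / 12)))"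
    unfolding distrib_left[symmetric] by (intro sum_mono mult_left_mono level_rho_bounds C p) auto
  also have "\<dots> = (\<Sum>j<J. exp (\<beta> * (real j + 1)) * exp (- ((real j)\<^sup>2 / (12 * C)))) + (\<Sum>j<J. exp (\<beta> * (real j + 1)) * real p powr (- (1 / 12)))"
    by (rule sum.distrib)
  also have "\<dots> \<le> K1 + K2"
  proof (rule add_mono)
    have "exp (\<beta> * (real j + 1)) * exp (- ((real j)\<^sup>2 / (12 * C))) \<le> exp (\<beta> + 3 * C * (\<beta> + 1)\<^sup>2) * (1 / 2) ^ j" for j
    proof -
      have "(\<beta> + 1) * real j \<le> (real j)\<^sup>2 / (12 * C) + 3 * C * (\<beta> + 1)\<^sup>2"
        using mult_le_square_add[of "3 * C" "\<beta> + 1" "real j"] C by (simp add: mult_ac)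
      then have "\<beta> * (real j + 1) - (real j)\<^sup>2 / (12 * C) \<le> \<beta> + 3 * C * (\<beta> + 1)\<^sup>2 + - real j" by (simp add: algebra_simps)
      then have "exp (\<beta> * (real j + 1) + - ((real j)\<^sup>2 / (12 * C))) \<le> exp (\<beta> + 3 * C * (\<beta> + 1)\<^sup>2 + - real j)" by simp
      also have "\<dots> = exp (\<beta> + 3 * C * (\<beta> + 1)\<^sup>2) * exp (- real j)" by (rule exp_add)
      also have "\<dots> \<le> exp (\<beta> + 3 * C * (\<beta> + 1)\<^sup>2) * (1 / 2) ^ j"
      proof (intro mult_left_mono)
        have "exp (- real j) = exp (- 1) ^ j" by (simp add: exp_of_nat_mult[symmetric])
        also have "\<dots> \<le> (1 / 2 :: real) ^ j"
          using exp_ge_add_one_self[of 1] by (intro power_mono) (auto simp: exp_minus field_simps)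
        finally show "exp (- real j) \<le> (1 / 2) ^ j" .
      qed simp
      finally show ?thesis unfolding exp_add[of "\<beta> * (real j + 1)"] .
    qed
    then have "(\<Sum>j<J. exp (\<beta> * (real j + 1)) * exp (- ((real j)\<^sup>2 / (12 * C)))) \<le> (\<Sum>j<J. exp (\<beta> + 3 * C * (\<beta> + 1)\<^sup>2) * (1 / 2) ^ j)"
      by (intro sum_mono)
    also have "\<dots> = exp (\<beta> + 3 * C * (\<beta> + 1)\<^sup>2) * (\<Sum>j<J. (1 / 2) ^ j)" by (simp only: sum_distrib_left)
    also have "\<dots> \<le> exp (\<beta> + 3 * C * (\<beta> + 1)\<^sup>2) * 2" by (intro mult_left_mono) (auto simp: sum_gp_strict)
    finally show "(\<Sum>j<J. exp (\<beta> * (real j + 1)) * exp (- ((real j)\<^sup>2 / (12 * C)))) \<le> K1" by (simp add: K1_def)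
    define l where "l = ln (real p)"
    have l: "0 \<le> l" using p by (simp add: l_def)
    have "(\<Sum>j<J. exp (\<beta> * (real j + 1)) * real p powr (- (1 / 12))) \<le> (\<Sum>j<J. exp (\<beta> * J) * real p powr (- (1 / 12)))"
      using \<beta> by (intro sum_mono mult_right_mono) auto
    also have "\<dots> = real J * exp (\<beta> * J) * real p powr (- (1 / 12))" by simp
    also have "\<dots> \<le> exp (real J) * exp (\<beta> * J) * real p powr (- (1 / 12))"
    proof -
      have "real J \<le> exp (real J)" using exp_ge_add_one_self[of "real J"] by linarith
      then show ?thesis by (intro mult_right_mono) auto
    qed
    also have "\<dots> = exp ((\<beta> + 1) * J - l / 12)"
      using p by (simp add: powr_def l_def exp_add[symmetric] algebra_simps)
    also have "\<dots> \<le> K2"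
    proof -
      have "(\<beta> + 1) * J \<le> (\<beta> + 1) * (1 + sqrt (2 * C * (\<alpha> + 2) * l))"
        using top_level_le[OF C \<alpha> p] \<beta> by (intro mult_left_mono) (auto simp: J_def l_def)
      also have "\<dots> = \<beta> + 1 + ((\<beta> + 1) * sqrt (2 * C * (\<alpha> + 2))) * sqrt l"
        unfolding real_sqrt_mult[of "2 * C * (\<alpha> + 2)" l] by (simp add: distrib_left distrib_right mult.assoc)
      also have "\<dots> \<le> \<beta> + 1 + ((sqrt l)\<^sup>2 / (4 * 3) + 3 * ((\<beta> + 1) * sqrt (2 * C * (\<alpha> + 2)))\<^sup>2)"
        by (intro add_left_mono mult_le_square_add) simp
      also have "\<dots> = \<beta> + 1 + l / 12 + 6 * C * (\<alpha> + 2) * (\<beta> + 1)\<^sup>2"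
        using l C \<alpha> by (simp add: power_mult_distrib)
      finally show ?thesis by (simp add: K2_def)
    qed
    finally show "(\<Sum>j<J. exp (\<beta> * (real j + 1)) * real p powr (- (1 / 12))) \<le> K2" .
  qed
  finally show "(\<Sum>j<top_level C \<alpha> p. exp (\<beta> * (real j + 1)) * sqrt (level_rho C p j)) \<le> K1 + K2"
    by (simp add: J_def)
qed

text \<open>Subadditivity of the square root gives p / n + sqrt(p / n), the origin of the maximum in
  the theorem.\<close>

lemma sqrt_ratio_le_max:
  fixes p n :: nat
  assumes "1 \<le> n"
  shows "sqrt p * sqrt (p + n) / n \<le> 2 * max (real p / n) (sqrt (real p / n))"
proof -
  have "sqrt (real p + n) \<le> sqrt p + sqrt n" by (rule sqrt_add_le_add_sqrt) auto
  then have "sqrt p * sqrt (p + n) / n \<le> sqrt p * (sqrt p + sqrt n) / n"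
    by (intro divide_right_mono mult_left_mono) auto
  also have "\<dots> = real p / n + sqrt (real p / n)"
    using assms by (simp add: distrib_left add_divide_distrib real_sqrt_divide) (simp add: field_simps)
  finally show ?thesis by linarith
qed

section \<open>From bilinear forms on nets to the spectral norm\<close>

lemma kernel_matrix_eq:
  assumes "\<And>i j. i < p \<Longrightarrow> j < n \<Longrightarrow> x (i, j) = y i j" "i < p" "i' < p" "1 \<le> n"
  shows "kernel_matrix k n y i i' = odd_kernel_matrix k n x i i'"
proof -
  have "sqrt (real n) * sample_cov n y i i' = gram n x i i'"
  proof -
    have "(\<Sum>j<n. y i j * y i' j) = (\<Sum>l<n. x (i, l) * x (i', l))" using assms by (intro sum.cong) auto
    then show ?thesis using assms(4) by (simp add: sample_cov_def gram_def field_simps)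
  qed
  then show ?thesis by (simp add: kernel_matrix_def odd_kernel_matrix_def)
qed

lemma spectral_norm_le:
  assumes "\<And>z w. z \<in> net p \<Longrightarrow> w \<in> net p \<Longrightarrow> bilinear_form p p B (net_vec p z) (net_vec p w) \<le> t" "0 \<le> t"
  shows "spectral_norm p B \<le> 2 * t"
  unfolding spectral_norm_def
proof (rule cSUP_least)
  show "{v. L2_set v {..<p} \<le> 1} \<noteq> {}" by (auto simp: L2_set_def intro: exI[of _ "\<lambda>_. 0"])
  fix v :: "nat \<Rightarrow> real" assume "v \<in> {v. L2_set v {..<p} \<le> 1}"
  then have v: "(\<Sum>i<p. (v i)\<^sup>2) \<le> 1" by (simp add: L2_set_def)
  have "(\<Sum>i<p. (\<Sum>j<p. B i j * v j)\<^sup>2) \<le> (2 * t)\<^sup>2 * (\<Sum>j<p. (v j)\<^sup>2)"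
    by (rule op_norm_le[OF assms])
  also have "\<dots> \<le> (2 * t)\<^sup>2 * 1" using v by (intro mult_left_mono) auto
  finally show "L2_set (\<lambda>i. \<Sum>i'<p. B i i' * v i') {..<p} \<le> 2 * t"
    using assms(2) unfolding L2_set_def by (intro real_le_lsqrt) (auto simp: sum_nonneg)
qed

lemma spectral_norm_cong:
  assumes "\<And>i i'. i < p \<Longrightarrow> i' < p \<Longrightarrow> B i i' = B' i i'"
  shows "spectral_norm p B = spectral_norm p B'"
  unfolding spectral_norm_def
  by (intro arg_cong[where f = Sup] image_cong refl L2_set_cong sum.cong) (use assms in auto)

lemma bilinear_form_sum:
  "bilinear_form p n (\<lambda>i j. \<Sum>l\<in>S. B l i j) u v = (\<Sum>l\<in>S. bilinear_form p n (B l) u v)"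
proof -
  have "bilinear_form p n (\<lambda>i j. \<Sum>l\<in>S. B l i j) u v = (\<Sum>i<p. \<Sum>l\<in>S. \<Sum>j<n. u i * B l i j * v j)"
    unfolding bilinear_form_def by (intro sum.cong refl) (subst sum.swap, simp add: sum_distrib_left sum_distrib_right)
  also have "\<dots> = (\<Sum>l\<in>S. bilinear_form p n (B l) u v)" unfolding bilinear_form_def by (rule sum.swap)
  finally show ?thesis .
qed

text \<open>The bands are summed inside the form on net vectors, so the factor 2 for passing from
  the net to the ball occurs once. Beyond the top band no off-diagonal Gram value is left.\<close>

lemma spectral_norm_levels_le:
  assumes k: "\<And>x. k (- x) = - k x" and J: "\<And>i i'. i < p \<Longrightarrow> i' < p \<Longrightarrow> i \<noteq> i' \<Longrightarrow> \<bar>gram n x i i'\<bar> \<le> real J"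
    and t: "\<And>j z w. j < J \<Longrightarrow> z \<in> net p \<Longrightarrow> w \<in> net p \<Longrightarrow>
      bilinear_form p p (odd_kernel_matrix (band k j) n x) (net_vec p z) (net_vec p w) \<le> t j" "\<And>j. 0 \<le> t j"
  shows "spectral_norm p (odd_kernel_matrix k n x) \<le> 2 * (\<Sum>j<J. t j)"
proof -
  have "spectral_norm p (odd_kernel_matrix k n x) = spectral_norm p (\<lambda>i i'. \<Sum>j<J. odd_kernel_matrix (band k j) n x i i')"
  proof (rule spectral_norm_cong)
    fix i i' assume "i < p" "i' < p"
    then show "odd_kernel_matrix k n x i i' = (\<Sum>j<J. odd_kernel_matrix (band k j) n x i i')"
      using sum_band[of k, OF k J[of i i']] by (simp add: odd_kernel_matrix_def sum_divide_distrib[symmetric])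
  qed
  also have "\<dots> \<le> 2 * (\<Sum>j<J. t j)"
    unfolding bilinear_form_sum by (intro spectral_norm_le sum_nonneg t) (auto simp: bilinear_form_sum intro!: sum_mono t)
  finally show ?thesis .
qed

text \<open>The Chernoff bound for counts has exponent 6 p \<rho>^3 - m; with 7 in place of 6 a
  margin of -p \<rho>^3 remains.\<close>

definition level_count :: "real \<Rightarrow> nat \<Rightarrow> nat \<Rightarrow> real" where
  "level_count C p j = 7 * p * level_rho C p j ^ 3"

lemma (in finite_measure) measure_UN_le:
  assumes "finite S" "\<And>i. i \<in> S \<Longrightarrow> E i \<in> sets M" "\<And>i. i \<in> S \<Longrightarrow> measure M (E i) \<le> b"
  shows "measure M (\<Union>i\<in>S. E i) \<le> real (card S) * b"
proof -
  have "measure M (\<Union>i\<in>S. E i) \<le> (\<Sum>i\<in>S. measure M (E i))"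
    using assms by (intro finite_measure_subadditive_finite) auto
  also have "\<dots> \<le> (\<Sum>i\<in>S. b)" using assms by (intro sum_mono) auto
  finally show ?thesis by simp
qed

text \<open>Removes the mass of G left over by concentration: either G has mass at least 1/2, or its
  complement does and the bound is trivial. Small dimensions need no separate treatment.\<close>

lemma (in prob_space) prob_le_of_mult_prob_le:
  assumes "G \<in> sets M" "measure M F * measure M G \<le> b" "0 \<le> b"
  shows "measure M F \<le> 2 * b + 2 * measure M (space M - G)"
proof (cases "1 / 2 \<le> measure M G")
  case True
  then have "measure M F * (1 / 2) \<le> measure M F * measure M G" by (intro mult_left_mono) auto
  then show ?thesis using assms(2) measure_nonneg[of M "space M - G"] by linarith
next
  case False
  then have "1 / 2 \<le> measure M (space M - G)" using prob_compl[OF assms(1)] by simp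
  then show ?thesis using prob_le_1[of F] assms(3) by linarith
qed

definition norm_scale :: "nat \<Rightarrow> nat \<Rightarrow> real" where
  "norm_scale p n = sqrt p * (14 * sqrt (p + n)) / n"

text \<open>The factor 600 A is 300 from \<open>kernel_level_bound\<close> times the 2 A of the
  Lipschitz constant of a band.\<close>

definition level_bound :: "real \<Rightarrow> real \<Rightarrow> real \<Rightarrow> nat \<Rightarrow> nat \<Rightarrow> nat \<Rightarrow> real" where
  "level_bound A \<beta> C p n j = 600 * A * exp (\<beta> * (real j + 1)) * sqrt (level_rho C p j) * norm_scale p n"

text \<open>The third event carries the row length condition because \<open>gram_tail\<close> works
  under it; rows that are too long form the second event.\<close>

definition failure_set :: "real \<Rightarrow> real \<Rightarrow> real \<Rightarrow> real \<Rightarrow> (real \<Rightarrow> real) \<Rightarrow> nat \<Rightarrow> nat \<Rightarrow> (nat \<times> nat \<Rightarrow> real) set" where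
  "failure_set A \<beta> C \<alpha> k p n =
     (space (gauss_matrix p n) - good_set p n (top_level C \<alpha> p) (level_count C p)) \<union>
     (\<Union>i<p. {x \<in> space (gauss_matrix p n). C * n < (\<Sum>l<n. (x (i, l))\<^sup>2)}) \<union>
     (\<Union>(i, i')\<in>{(i, i'). i < p \<and> i' < p \<and> i \<noteq> i'}.
        {x \<in> space (gauss_matrix p n). (\<Sum>l<n. (x (i, l))\<^sup>2) \<le> C * n \<and> real (top_level C \<alpha> p) < \<bar>gram n x i i'\<bar>}) \<union>
     (\<Union>j<top_level C \<alpha> p. {x \<in> good_set p n (top_level C \<alpha> p) (level_count C p). \<exists>z\<in>net p. \<exists>w\<in>net p.
        level_bound A \<beta> C p n j < bilinear_form p p (odd_kernel_matrix (band k j) n x) (net_vec p z) (net_vec p w)})"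

lemma spectral_norm_le_of_not_failure:
  assumes k: "admissible_kernel A \<beta> k" and A: "0 < A" and p: "1 \<le> p" and n: "1 \<le> n" and C: "0 < C"
    and x: "x \<in> space (gauss_matrix p n)" "x \<notin> failure_set A \<beta> C \<alpha> k p n"
    and K: "(\<Sum>j<top_level C \<alpha> p. exp (\<beta> * (real j + 1)) * sqrt (level_rho C p j)) \<le> K"
    and y: "\<And>i j. i < p \<Longrightarrow> j < n \<Longrightarrow> x (i, j) = y i j"
  shows "spectral_norm p (kernel_matrix k n y) \<le> 33600 * A * K * max (real p / n) (sqrt (real p / n))"
proof -
  let ?J = "top_level C \<alpha> p"
  have good: "x \<in> good_set p n ?J (level_count C p)" using x by (auto simp: failure_set_def)
  have odd: "k (- t) = - k t" for t using k by (simp add: admissible_kernel_def)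
  have ns: "0 \<le> norm_scale p n" by (simp add: norm_scale_def)
  have "spectral_norm p (kernel_matrix k n y) = spectral_norm p (odd_kernel_matrix k n x)"
    using y n by (intro spectral_norm_cong kernel_matrix_eq) auto
  also have "\<dots> \<le> 2 * (\<Sum>j<?J. level_bound A \<beta> C p n j)"
  proof (rule spectral_norm_levels_le[of k, OF odd])
    fix i i' assume i: "i < p" "i' < p" "i \<noteq> i'"
    have "(\<Sum>l<n. (x (i, l))\<^sup>2) \<le> C * n" using x i by (auto simp: failure_set_def not_less)
    then have "real ?J < \<bar>gram n x i i'\<bar> \<Longrightarrow> x \<in> failure_set A \<beta> C \<alpha> k p n"
      using x(1) i unfolding failure_set_def by blast
    then show "\<bar>gram n x i i'\<bar> \<le> real ?J" using x(2) by linarith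
  next
    fix j z w assume "j < ?J" "z \<in> net p" "w \<in> net p"
    then show "bilinear_form p p (odd_kernel_matrix (band k j) n x) (net_vec p z) (net_vec p w) \<le> level_bound A \<beta> C p n j"
      using x good by (auto simp: failure_set_def not_less)
  next
    show "0 \<le> level_bound A \<beta> C p n j" for j
      using A ns level_rho_bounds(1)[OF C p, of j] by (simp add: level_bound_def)
  qed
  also have "(\<Sum>j<?J. level_bound A \<beta> C p n j) = 600 * A * norm_scale p n * (\<Sum>j<?J. exp (\<beta> * (real j + 1)) * sqrt (level_rho C p j))"
    by (simp add: level_bound_def sum_distrib_left mult_ac)
  also have "2 * (600 * A * norm_scale p n * (\<Sum>j<?J. exp (\<beta> * (real j + 1)) * sqrt (level_rho C p j))) \<le> 2 * (600 * A * norm_scale p n * K)"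
    using A ns by (intro mult_left_mono K) auto
  \<comment> \<open>The constant is 2 * 600 * 14; the final doubling to 33600 comes from
    \<open>sqrt_ratio_le_max\<close>.\<close>
  also have "\<dots> = 16800 * A * K * (sqrt p * sqrt (p + n) / n)" by (simp add: norm_scale_def)
  also have "\<dots> \<le> 16800 * A * K * (2 * max (real p / n) (sqrt (real p / n)))"
  proof (intro mult_left_mono sqrt_ratio_le_max n)
    have "0 \<le> (\<Sum>j<?J. exp (\<beta> * (real j + 1)) * sqrt (level_rho C p j))"
      by (intro sum_nonneg mult_nonneg_nonneg) (auto simp: less_imp_le[OF level_rho_bounds(1)[OF C p]])
    then show "0 \<le> 16800 * A * K" using K A by simp
  qed
  finally show ?thesis by simp
qed

section \<open>Probabilities of the failure events\<close>

lemma sets_row_norm: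
  "i < p \<Longrightarrow> {x \<in> space (gauss_matrix p n). c < (\<Sum>l<n. (x (i, l))\<^sup>2)} \<in> sets (gauss_matrix p n)"
  by (intro borel_measurable_less borel_measurable_const measurable_row_norm)

lemma sets_row_norm_gram:
  "i < p \<Longrightarrow> i' < p \<Longrightarrow> {x \<in> space (gauss_matrix p n). (\<Sum>l<n. (x (i, l))\<^sup>2) \<le> c \<and> T < \<bar>gram n x i i'\<bar>} \<in> sets (gauss_matrix p n)"
  by (intro sets.sets_Collect_conj borel_measurable_le borel_measurable_less borel_measurable_const measurable_row_norm
      borel_measurable_abs measurable_gram)

lemma sets_row_norm_large_count:
  "i < p \<Longrightarrow> {x \<in> space (gauss_matrix p n). (\<Sum>l<n. (x (i, l))\<^sup>2) \<le> c \<and> m < real (large_count p n T x i)} \<in> sets (gauss_matrix p n)"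
  by (intro sets.sets_Collect_conj borel_measurable_le borel_measurable_less borel_measurable_const measurable_row_norm
      measurable_large_count)

lemma row_norm_failure:
  fixes C \<alpha> :: real
  assumes \<alpha>: "0 < \<alpha>" and C: "C = 4 * \<alpha> + 2"
  shows "measure (gauss_matrix p n) (\<Union>i<p. {x \<in> space (gauss_matrix p n). C * n < (\<Sum>l<n. (x (i, l))\<^sup>2)}) \<le> p * exp (- \<alpha> * n)"
proof -
  have "measure (gauss_matrix p n) {x \<in> space (gauss_matrix p n). C * n < (\<Sum>l<n. (x (i, l))\<^sup>2)} \<le> exp (- \<alpha> * n)" if i: "i < p" for i
  proof -
    have "(\<Sum>k\<in>{i} \<times> {..<n}. (x k)\<^sup>2) = (\<Sum>l<n. (x (i, l))\<^sup>2)" for x :: "nat \<times> nat \<Rightarrow> real"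
      using sum.cartesian_product[of "\<lambda>i l. (x (i, l))\<^sup>2" "{..<n}" "{i}"] by (simp add: case_prod_beta')
    then show ?thesis
      using gauss_square_tail[of "{..<p} \<times> {..<n}" "{i} \<times> {..<n}" \<alpha>] i \<alpha> by (auto simp: C)
  qed
  then show ?thesis
    using gauss.measure_UN_le[of "{..<p}" "\<lambda>i. {x \<in> space (gauss_matrix p n). C * n < (\<Sum>l<n. (x (i, l))\<^sup>2)}" _ "exp (- \<alpha> * n)"] sets_row_norm
    by (simp only: finite_lessThan lessThan_iff card_lessThan)
qed

lemma gram_failure:
  fixes C \<alpha> :: real
  assumes \<alpha>: "0 < \<alpha>" and C: "0 < C" and p: "1 \<le> p" and n: "1 \<le> n"
  shows "measure (gauss_matrix p n) (\<Union>(i, i')\<in>{(i, i'). i < p \<and> i' < p \<and> i \<noteq> i'}.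
     {x \<in> space (gauss_matrix p n). (\<Sum>l<n. (x (i, l))\<^sup>2) \<le> C * n \<and> real (top_level C \<alpha> p) < \<bar>gram n x i i'\<bar>}) \<le> 2 * real p powr (- \<alpha>)"
proof -
  define S where "S = {(i, i'). i < p \<and> i' < p \<and> i \<noteq> i'}"
  define E where "E = (\<lambda>(i, i'). {x \<in> space (gauss_matrix p n). (\<Sum>l<n. (x (i, l))\<^sup>2) \<le> C * n \<and> real (top_level C \<alpha> p) < \<bar>gram n x i i'\<bar>})"
  have sub: "S \<subseteq> {..<p} \<times> {..<p}" by (auto simp: S_def)
  then have fin: "finite S" by (rule finite_subset) simp
  have card: "real (card S) \<le> (real p)\<^sup>2"
    using card_mono[OF _ sub] by (simp add: card_cartesian_product power2_eq_square flip: of_nat_mult)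
  have "measure (gauss_matrix p n) (\<Union>s\<in>S. E s) \<le> real (card S) * (2 * real p powr (- (\<alpha> + 2)))"
  proof (rule gauss.measure_UN_le[OF fin])
    fix s assume "s \<in> S"
    then obtain i i' where s: "s = (i, i')" "i < p" "i' < p" "i \<noteq> i'" by (auto simp: S_def)
    show "E s \<in> sets (gauss_matrix p n)" unfolding s(1) E_def prod.case by (intro sets_row_norm_gram s)
    have "measure (gauss_matrix p n) (E s) \<le> 2 * exp (- ((real (top_level C \<alpha> p))\<^sup>2 / (2 * C)))"
      unfolding s(1) E_def prod.case using n by (intro gram_tail s C) auto
    then show "measure (gauss_matrix p n) (E s) \<le> 2 * real p powr (- (\<alpha> + 2))"
      using top_level_ge[OF C \<alpha> p] by linarith
  qed
  also have "\<dots> \<le> (real p)\<^sup>2 * (2 * real p powr (- (\<alpha> + 2)))" using card by (intro mult_right_mono) auto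
  also have "\<dots> = 2 * real p powr (- \<alpha>)"
    using p by (simp add: powr_numeral[symmetric] powr_add[symmetric] del: powr_numeral)
  finally show ?thesis by (simp add: S_def E_def case_prod_beta')
qed

text \<open>A count can be too large on a short row, which \<open>large_count_tail\<close> controls,
  or on a long row; the latter are collected in V independently of the band.\<close>

lemma good_set_failure:
  fixes C \<alpha> :: real
  assumes \<alpha>: "0 < \<alpha>" and C: "C = 4 * \<alpha> + 2" and p: "1 \<le> p" and n: "1 \<le> n"
  shows "measure (gauss_matrix p n) (space (gauss_matrix p n) - good_set p n (top_level C \<alpha> p) (level_count C p))
    \<le> exp (- sqrt p) + p * exp (- \<alpha> * n) + real (top_level C \<alpha> p) * real p * exp (- sqrt p)"
proof -
  let ?M = "gauss_matrix p n"
  let ?J = "top_level C \<alpha> p"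
  have C0: "0 < C" using \<alpha> C by simp
  define W where "W = {x \<in> space ?M. \<exists>z\<in>net p. \<exists>w\<in>net n. 7 * sqrt (p + n) < bilinear_form p n (\<lambda>i j. x (i, j)) (net_vec p z) (net_vec n w)}"
  define V where "V = (\<Union>i<p. {x \<in> space ?M. C * n < (\<Sum>l<n. (x (i, l))\<^sup>2)})"
  define E where "E = (\<lambda>(j, i). {x \<in> space ?M. (\<Sum>l<n. (x (i, l))\<^sup>2) \<le> C * n \<and> level_count C p j < real (large_count p n (real j) x i)})"
  define U where "U = (\<Union>s\<in>{..<?J} \<times> {..<p}. E s)"
  have Ws: "W \<in> sets ?M"
    unfolding W_def by (intro sets.sets_Collect_finite_Ex finite_net borel_measurable_less measurable_bilinear_form_entries borel_measurable_const)
  have Vs: "V \<in> sets ?M" unfolding V_def by (intro sets.finite_UN sets_row_norm) auto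
  have Es: "E s \<in> sets ?M" if "s \<in> {..<?J} \<times> {..<p}" for s
    using that unfolding E_def by (cases s) (simp only: prod.case, intro sets_row_norm_large_count, simp)
  have Us: "U \<in> sets ?M" unfolding U_def by (intro sets.finite_UN Es) auto
  have "space ?M - good_set p n ?J (level_count C p) \<subseteq> W \<union> V \<union> U"
    by (force simp: good_set_def well_conditioned_def W_def V_def U_def E_def not_le not_less)
  then have "measure ?M (space ?M - good_set p n ?J (level_count C p)) \<le> measure ?M (W \<union> V \<union> U)"
    using Ws Vs Us by (intro gauss.finite_measure_mono sets.Un)
  also have "\<dots> \<le> measure ?M W + measure ?M V + measure ?M U"
    using Ws Vs Us by (intro order_trans[OF measure_Un_le] add_right_mono measure_Un_le sets.Un)
  also have "measure ?M W \<le> exp (- sqrt p)"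
  proof -
    have "measure ?M W \<le> exp (- real p)" unfolding W_def using p by (intro op_norm_tail) simp
    also have "\<dots> \<le> exp (- sqrt p)" using p real_sqrt_le_mono[of 1 "real p"] 
      by (simp add: real_le_lsqrt power2_eq_square)
    finally show ?thesis .
  qed
  also have "measure ?M V \<le> p * exp (- \<alpha> * n)" unfolding V_def by (rule row_norm_failure[OF \<alpha> C])
  also have "measure ?M U \<le> real (card ({..<?J} \<times> {..<p})) * exp (- sqrt p)"
    unfolding U_def
  proof (rule gauss.measure_UN_le[OF _ Es])
    fix s assume "s \<in> {..<?J} \<times> {..<p}"
    then obtain j i where s: "s = (j, i)" "i < p" by auto
    have "measure ?M (E s) \<le> exp (6 * real p * exp (- ((real j)\<^sup>2 / (2 * C))) - level_count C p j)"
      unfolding s(1) E_def prod.case using n by (intro large_count_tail s C0) auto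
    also have "\<dots> \<le> exp (- sqrt p)"
    proof -
      have "6 * real p * exp (- ((real j)\<^sup>2 / (2 * C))) \<le> 6 * real p * level_rho C p j ^ 3"
        by (intro mult_left_mono level_rho_bounds C0 p) auto
      then show ?thesis using level_rho_bounds(4)[OF C0 p, of j] by (simp add: level_count_def)
    qed
    finally show "measure ?M (E s) \<le> exp (- sqrt p)" .
  qed auto
  finally show ?thesis by (simp add: card_cartesian_product)
qed

lemma level_failure:
  assumes k: "admissible_kernel A \<beta> k" and A: "0 < A" "0 < \<beta>" and C: "0 < C" and p: "1 \<le> p" and n: "1 \<le> n"
    and j: "j < J"
  shows "measure (gauss_matrix p n) {x \<in> good_set p n J (level_count C p). \<exists>z\<in>net p. \<exists>w\<in>net p.
        level_bound A \<beta> C p n j < bilinear_form p p (odd_kernel_matrix (band k j) n x) (net_vec p z) (net_vec p w)}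
     * measure (gauss_matrix p n) (good_set p n J (level_count C p)) \<le> 3 * exp (- sqrt p)"
proof -
  have A0: "0 \<le> A" "0 \<le> \<beta>" using A by auto
  have odd: "k (- t) = - k t" for t using k by (simp add: admissible_kernel_def)
  have cont: "continuous_on UNIV (band k j)" using k by (intro continuous_on_band) (simp add: admissible_kernel_def)
  note r = level_rho_bounds[OF C p, of j]
  have "measure (gauss_matrix p n) {x \<in> good_set p n J (level_count C p). \<exists>z\<in>net p. \<exists>w\<in>net p.
        300 * (2 * A * exp (\<beta> * (real j + 1))) * sqrt (level_rho C p j) * sqrt p * (14 * sqrt (real p + real n)) / n < bilinear_form p p (odd_kernel_matrix (band k j) n x) (net_vec p z) (net_vec p w)}
     * measure (gauss_matrix p n) (good_set p n J (level_count C p)) \<le> 3 * exp (- level_rho C p j * p)"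
  proof (rule kernel_level_bound[where h = "band k j", OF band_lipschitz[OF k A0]])
    show "level_count C p j = 7 * p * level_rho C p j ^ 3" by (simp add: level_count_def)
  qed (use A p n r j cont band_minus[of k, OF odd] band_bounded[OF k A0] in \<open>auto intro: band_eq_0\<close>)
  also have "\<dots> \<le> 3 * exp (- sqrt p)" using r(5) by simp
  finally show ?thesis by (simp add: level_bound_def norm_scale_def mult_ac)
qed

lemma sets_level_failure:
  assumes "h \<in> borel_measurable borel"
  shows "{x \<in> good_set p n J m. \<exists>z\<in>net p. \<exists>w\<in>net p.
     c < bilinear_form p p (odd_kernel_matrix h n x) (net_vec p z) (net_vec p w)} \<in> sets (gauss_matrix p n)"
proof -
  have "{x \<in> space (gauss_matrix p n). \<exists>z\<in>net p. \<exists>w\<in>net p.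
     c < bilinear_form p p (odd_kernel_matrix h n x) (net_vec p z) (net_vec p w)} \<in> sets (gauss_matrix p n)"
    by (intro sets.sets_Collect_finite_Ex finite_net borel_measurable_less measurable_odd_kernel_form borel_measurable_const assms)
  from sets.Int[OF sets_good_set this, of J m] show ?thesis
    by (rule back_subst[where P = "\<lambda>S. S \<in> sets (gauss_matrix p n)"]) (auto simp: good_set_def)
qed

lemma failure_set_bound:
  assumes k: "admissible_kernel A \<beta> k" and A: "0 < A" "0 < \<beta>" and \<alpha>: "0 < \<alpha>" and C: "C = 4 * \<alpha> + 2"
    and p: "1 \<le> p" and n: "1 \<le> n"
  shows "failure_set A \<beta> C \<alpha> k p n \<in> sets (gauss_matrix p n)"
    and "measure (gauss_matrix p n) (failure_set A \<beta> C \<alpha> k p n)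
      \<le> (3 + 3 * (top_level C \<alpha> p * real p) + 6 * top_level C \<alpha> p) * exp (- sqrt p) + 4 * (p * exp (- \<alpha> * n)) + 2 * real p powr (- \<alpha>)"
proof -
  let ?M = "gauss_matrix p n"
  let ?J = "top_level C \<alpha> p"
  have C0: "0 < C" using \<alpha> C by simp
  define G where "G = good_set p n ?J (level_count C p)"
  define V where "V = (\<Union>i<p. {x \<in> space ?M. C * n < (\<Sum>l<n. (x (i, l))\<^sup>2)})"
  define U where "U = (\<Union>(i, i')\<in>{(i, i'). i < p \<and> i' < p \<and> i \<noteq> i'}.
        {x \<in> space ?M. (\<Sum>l<n. (x (i, l))\<^sup>2) \<le> C * n \<and> real ?J < \<bar>gram n x i i'\<bar>})"
  define E where "E = (\<lambda>j. {x \<in> G. \<exists>z\<in>net p. \<exists>w\<in>net p.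
        level_bound A \<beta> C p n j < bilinear_form p p (odd_kernel_matrix (band k j) n x) (net_vec p z) (net_vec p w)})"
  define F where "F = (\<Union>j<?J. E j)"
  have eq: "failure_set A \<beta> C \<alpha> k p n = (space ?M - G) \<union> V \<union> U \<union> F"
    by (simp add: failure_set_def G_def V_def U_def F_def E_def)
  have Gs: "G \<in> sets ?M" unfolding G_def by (rule sets_good_set)
  have Vs: "V \<in> sets ?M" unfolding V_def by (intro sets.finite_UN sets_row_norm) auto
  have Us: "U \<in> sets ?M" unfolding U_def
  proof (rule sets.finite_UN)
    show "finite {(i, i'). i < p \<and> i' < p \<and> i \<noteq> i'}" by (rule finite_subset[of _ "{..<p} \<times> {..<p}"]) auto
    fix s assume "s \<in> {(i, i'). i < p \<and> i' < p \<and> i \<noteq> i'}"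
    then obtain i i' where s: "s = (i, i')" "i < p" "i' < p" by auto
    show "(case s of (i, i') \<Rightarrow> {x \<in> space ?M. (\<Sum>l<n. (x (i, l))\<^sup>2) \<le> C * n \<and> real ?J < \<bar>gram n x i i'\<bar>}) \<in> sets ?M"
      unfolding s(1) prod.case by (intro sets_row_norm_gram s)
  qed
  have "continuous_on UNIV (band k j)" for j using k by (intro continuous_on_band) (simp add: admissible_kernel_def)
  then have Es: "E j \<in> sets ?M" for j unfolding E_def G_def by (intro sets_level_failure borel_measurable_continuous_onI)
  have Fs: "F \<in> sets ?M" unfolding F_def by (intro sets.finite_UN Es) auto
  show "failure_set A \<beta> C \<alpha> k p n \<in> sets ?M" unfolding eq
    by (intro sets.Un sets.compl_sets Gs Vs Us Fs)
  have "measure ?M (failure_set A \<beta> C \<alpha> k p n) \<le> measure ?M (space ?M - G) + measure ?M V + measure ?M U + measure ?M F"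
    unfolding eq
    by (intro order_trans[OF measure_Un_le] add_right_mono measure_Un_le
        sets.Un sets.compl_sets Gs Vs Us Fs)
  moreover have "measure ?M F \<le> 2 * (?J * (3 * exp (- sqrt p))) + 2 * measure ?M (space ?M - G)"
  proof (rule gauss.prob_le_of_mult_prob_le[OF Gs])
    have "measure ?M F \<le> (\<Sum>j<?J. measure ?M (E j))"
      unfolding F_def using Es by (intro gauss.finite_measure_subadditive_finite) auto
    then have "measure ?M F * measure ?M G \<le> (\<Sum>j<?J. measure ?M (E j) * measure ?M G)"
      unfolding sum_distrib_right[symmetric] by (intro mult_right_mono) auto
    also have "\<dots> \<le> (\<Sum>j<?J. 3 * exp (- sqrt p))"
      unfolding E_def G_def by (intro sum_mono level_failure k A C0 p n) auto
    finally show "measure ?M F * measure ?M G \<le> ?J * (3 * exp (- sqrt p))" by simp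
  qed simp
  moreover have "measure ?M (space ?M - G) \<le> exp (- sqrt p) + p * exp (- \<alpha> * n) + real ?J * real p * exp (- sqrt p)"
    unfolding G_def by (rule good_set_failure[OF \<alpha> C p n])
  moreover have "measure ?M V \<le> p * exp (- \<alpha> * n)" unfolding V_def by (rule row_norm_failure[OF \<alpha> C])
  moreover have "measure ?M U \<le> 2 * real p powr (- \<alpha>)" unfolding U_def by (rule gram_failure[OF \<alpha> C0 p n])
  \<comment> \<open>The complement of the good set counts once by itself and twice through
    \<open>prob_le_of_mult_prob_le\<close>.\<close>
  moreover have "F \<le> 3 * g' + v' + u' + 2 * q"
    if "F \<le> g + v + u + f" "f \<le> 2 * q + 2 * g" "g \<le> g'" "v \<le> v'" "u \<le> u'" for F g v u f q g' v' u' :: real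
    using that by linarith
  ultimately have "measure ?M (failure_set A \<beta> C \<alpha> k p n)
    \<le> 3 * (exp (- sqrt p) + p * exp (- \<alpha> * n) + real ?J * real p * exp (- sqrt p)) + p * exp (- \<alpha> * n) + 2 * real p powr (- \<alpha>) + 2 * (?J * (3 * exp (- sqrt p)))"
    by blast
  then show "measure ?M (failure_set A \<beta> C \<alpha> k p n)
      \<le> (3 + 3 * (?J * real p) + 6 * ?J) * exp (- sqrt p) + 4 * (p * exp (- \<alpha> * n)) + 2 * real p powr (- \<alpha>)"
    by (simp add: algebra_simps)
qed

text \<open>The matrix entries have the product law, so every estimate made on
  \<open>gauss_matrix p n\<close> transfers to the given probability space.\<close>

lemma iid_std_normal_matrix_distr:
  assumes M: "prob_space M" and X: "iid_std_normal_matrix M p n X" and p: "1 \<le> p" and n: "1 \<le> n"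
  defines "Y \<equiv> \<lambda>\<omega>. \<lambda>k\<in>{..<p} \<times> {..<n}. X (fst k) (snd k) \<omega>"
  shows "Y \<in> M \<rightarrow>\<^sub>M gauss_matrix p n" "distr M (gauss_matrix p n) Y = gauss_matrix p n"
proof -
  interpret prob_space M by (rule M)
  let ?I = "{..<p} \<times> {..<n}"
  have ind: "indep_vars (\<lambda>_. borel) (\<lambda>(i, j). X i j) ?I"
    and dist: "\<And>i j. i < p \<Longrightarrow> j < n \<Longrightarrow> distributed M lborel (X i j) std_normal_density"
    using X by (auto simp: iid_std_normal_matrix_def)
  have rv: "(\<lambda>\<omega>. X (fst k) (snd k) \<omega>) \<in> borel_measurable M" if "k \<in> ?I" for k
  proof -
    have "fst k < p" "snd k < n" using that by auto
    from distributed_measurable[OF dist[OF this]] show ?thesis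
      by (simp only: measurable_cong_sets[OF refl sets_lborel])
  qed
  have d1: "distr M borel (\<lambda>\<omega>. X (fst k) (snd k) \<omega>) = gauss1" if "k \<in> ?I" for k
  proof -
    have "distr M borel (\<lambda>\<omega>. X (fst k) (snd k) \<omega>) = distr M lborel (\<lambda>\<omega>. X (fst k) (snd k) \<omega>)" by (rule distr_cong) auto
    also have "\<dots> = gauss1"
    proof -
      have "fst k < p" "snd k < n" using that by auto
      from distributed_distr_eq_density[OF dist[OF this]] show ?thesis by (simp only: gauss1_def)
    qed
    finally show ?thesis .
  qed
  have Ym: "Y \<in> M \<rightarrow>\<^sub>M PiM ?I (\<lambda>_. borel)" unfolding Y_def by (intro measurable_restrict rv)
  show Ym': "Y \<in> M \<rightarrow>\<^sub>M gauss_matrix p n"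
    using Ym measurable_cong_sets[OF refl sets_gauss, of M ?I] by (simp only:)
  have "distr M (gauss_matrix p n) Y = distr M (PiM ?I (\<lambda>_. borel)) Y" by (intro distr_cong refl sets_gauss)
  also have "\<dots> = PiM ?I (\<lambda>k. distr M borel (\<lambda>\<omega>. X (fst k) (snd k) \<omega>))"
  proof -
    \<comment> \<open>The characterisation of independence by the joint law asks for a nonempty
      index set; p and n are at least 1.\<close>
    have "(0, 0) \<in> ?I" using p n by simp
    then have "?I \<noteq> {}" by blast
    moreover have "indep_vars (\<lambda>_. borel) (\<lambda>k \<omega>. X (fst k) (snd k) \<omega>) ?I"
      using ind by (simp add: case_prod_beta')
    ultimately show ?thesis
      using indep_vars_iff_distr_eq_PiM'[of ?I "\<lambda>k \<omega>. X (fst k) (snd k) \<omega>" "\<lambda>_. borel"] rv unfolding Y_def by auto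
  qed
  also have "\<dots> = gauss_matrix p n" unfolding gauss_def by (intro PiM_cong refl d1)
  finally show "distr M (gauss_matrix p n) Y = gauss_matrix p n" .
qed

theorem theorem1p6:
  fixes A \<beta> \<alpha> :: real
  assumes "A > 0" and "\<beta> > 0" and "\<alpha> > 0"
  shows "\<exists>C>0. \<exists>C'>0. \<forall>(k :: real \<Rightarrow> real) (p :: nat) (n :: nat) (M :: 'a measure)
           (X :: nat \<Rightarrow> nat \<Rightarrow> 'a \<Rightarrow> real).
           admissible_kernel A \<beta> k \<longrightarrow> p \<ge> 1 \<longrightarrow> n \<ge> 1 \<longrightarrow>
           prob_space M \<longrightarrow> iid_std_normal_matrix M p n X \<longrightarrow>
           measure M {\<omega> \<in> space M.
               spectral_norm p (kernel_matrix k n (\<lambda>i j. X i j \<omega>))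
                 > C * max (real p / real n) (sqrt (real p / real n))}
             \<le> C' * (real p powr (- \<alpha>) + real p * exp (- \<alpha> * real n))"
proof -
  define C where "C = 4 * \<alpha> + 2"
  have C: "0 < C" using assms by (simp add: C_def)
  obtain K where K: "0 < K" "\<And>p. 1 \<le> p \<Longrightarrow> (\<Sum>j<top_level C \<alpha> p. exp (\<beta> * (real j + 1)) * sqrt (level_rho C p j)) \<le> K"
    using level_sum_bounded[OF C assms(3,2)] by auto
  \<comment> \<open>Two powers of p beyond \<alpha> pay for the union over p rows and at most D p
    bands.\<close>
  obtain B where B: "0 < B" "\<And>p::nat. 1 \<le> p \<Longrightarrow> real p powr (\<alpha> + 2) * exp (- sqrt p) \<le> B"
    using powr_mult_exp_sqrt_bounded[of "\<alpha> + 2"] by auto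
  define D where "D = 2 + 2 * C * (\<alpha> + 2)"
  have D: "0 < D" using C assms by (simp add: D_def add_pos_pos)
  define C' where "C' = (3 + 9 * D) * B + 4"
  show ?thesis
  proof (intro exI conjI allI impI)
    show "0 < 33600 * A * K" using assms K by simp
    show "0 < C'" using B D by (simp add: C'_def add_pos_pos)
    fix k :: "real \<Rightarrow> real" and p n :: nat and M :: "'a measure" and X :: "nat \<Rightarrow> nat \<Rightarrow> 'a \<Rightarrow> real"
    assume k: "admissible_kernel A \<beta> k" and p: "1 \<le> p" and n: "1 \<le> n" and M: "prob_space M" and X: "iid_std_normal_matrix M p n X"
    interpret prob_space M by (rule M)
    let ?M = "gauss_matrix p n"
    let ?F = "failure_set A \<beta> C \<alpha> k p n"
    let ?J = "top_level C \<alpha> p"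
    define Y where "Y = (\<lambda>\<omega>. \<lambda>k\<in>{..<p} \<times> {..<n}. X (fst k) (snd k) \<omega>)"
    have Y: "Y \<in> M \<rightarrow>\<^sub>M ?M" "distr M ?M Y = ?M"
      using iid_std_normal_matrix_distr[OF M X p n] by (auto simp: Y_def)
    note F = failure_set_bound[OF k assms C_def p n]
    \<comment> \<open>Monotonicity asks for measurability of the larger set, the preimage of
      \<open>failure_set\<close>.\<close>
    have "{\<omega> \<in> space M. spectral_norm p (kernel_matrix k n (\<lambda>i j. X i j \<omega>)) > 33600 * A * K * max (real p / real n) (sqrt (real p / real n))}
        \<subseteq> Y -` ?F \<inter> space M"
    proof safe
      fix \<omega> assume \<omega>: "\<omega> \<in> space M" and gt: "spectral_norm p (kernel_matrix k n (\<lambda>i j. X i j \<omega>)) > 33600 * A * K * max (real p / real n) (sqrt (real p / real n))"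
      show "\<omega> \<in> Y -` ?F"
      proof (rule ccontr)
        assume "\<omega> \<notin> Y -` ?F"
        then have "Y \<omega> \<notin> ?F" by simp
        moreover have "Y \<omega> \<in> space ?M" using measurable_space[OF Y(1) \<omega>] .
        ultimately have "spectral_norm p (kernel_matrix k n (\<lambda>i j. X i j \<omega>)) \<le> 33600 * A * K * max (real p / real n) (sqrt (real p / real n))"
          by (intro spectral_norm_le_of_not_failure[OF k assms(1) p n C _ _ K(2)[OF p]]) (auto simp: Y_def)
        then show False using gt by simp
      qed
    qed
    then have "measure M {\<omega> \<in> space M. spectral_norm p (kernel_matrix k n (\<lambda>i j. X i j \<omega>)) > 33600 * A * K * max (real p / real n) (sqrt (real p / real n))}
        \<le> measure M (Y -` ?F \<inter> space M)"
      using measurable_sets[OF Y(1) F(1)] by (rule finite_measure_mono)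
    also have "\<dots> = measure ?M ?F" using measure_distr[OF Y(1) F(1)] Y(2) by simp
    also have "\<dots> \<le> (3 + 3 * (?J * real p) + 6 * ?J) * exp (- sqrt p) + 4 * (p * exp (- \<alpha> * n)) + 2 * real p powr (- \<alpha>)"
      by (rule F(2))
    also have "\<dots> \<le> C' * (real p powr (- \<alpha>) + real p * exp (- \<alpha> * real n))"
    proof -
      have J: "real ?J \<le> D * p" using top_level_le_linear[OF C assms(3) p] by (simp add: D_def)
      have "3 \<le> 3 * (real p)\<^sup>2" using p by simp
      moreover have "?J * real p \<le> D * p * p" using J by (intro mult_right_mono) auto
      moreover have "real ?J \<le> D * p * p"
      proof -
        have "D * p * 1 \<le> D * p * p" using p D by (intro mult_left_mono) auto
        then show ?thesis using J by simp
      qed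
      ultimately have "3 + 3 * (?J * real p) + 6 * ?J \<le> 3 * (real p)\<^sup>2 + 3 * (D * p * p) + 6 * (D * p * p)"
        by linarith
      then have "(3 + 3 * (?J * real p) + 6 * ?J) * exp (- sqrt p) \<le> ((3 + 9 * D) * (real p)\<^sup>2) * exp (- sqrt p)"
        by (intro mult_right_mono) (simp_all add: algebra_simps power2_eq_square)
      also have "\<dots> = (3 + 9 * D) * real p powr (- \<alpha>) * (real p powr (\<alpha> + 2) * exp (- sqrt p))"
        using p by (simp add: powr_add powr_minus)
      also have "\<dots> \<le> (3 + 9 * D) * real p powr (- \<alpha>) * B"
        using B(2)[OF p] D by (intro mult_left_mono) auto
      finally have "(3 + 3 * (?J * real p) + 6 * ?J) * exp (- sqrt p) \<le> (3 + 9 * D) * B * real p powr (- \<alpha>)" by (simp add: mult_ac)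
      moreover have "0 \<le> (3 + 9 * D) * B * (p * exp (- \<alpha> * n))" using B D by simp
      moreover have "0 \<le> real p powr (- \<alpha>)" by simp
      ultimately show ?thesis unfolding C'_def distrib_left distrib_right by linarith
    qed
    finally show "measure M {\<omega> \<in> space M. spectral_norm p (kernel_matrix k n (\<lambda>i j. X i j \<omega>)) > 33600 * A * K * max (real p / real n) (sqrt (real p / real n))}
      \<le> C' * (real p powr (- \<alpha>) + real p * exp (- \<alpha> * real n))" .
  qed
qed

end
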